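(* Let $1\le p<\frac{n}{n-1}$ and suppose that assumption (A1$_p$) (stated in the context, with constant $C_1$) is satisfied. There is a constant $C_0>0$ depending only on $n$, $p$ and $\|J_X\|_{L^\infty(\Theta)}$ (the geometric data $\Omega,\Theta,X$ being fixed) such that the following holds. Let $F\in L^p(\Theta)^n$, let $\varepsilon>0$, let $\delta^\varepsilon:\mathbb{R}^n\to\mathbb{R}$ be continuous with $\operatorname{supp}\delta^\varepsilon\subset B(0,K\varepsilon)$ for some $K>0$, and let $(u,\pi)$ and $(u^\varepsilon,\pi^\varepsilon)$ in $W^{1,p}_0(\Omega)^n\times L^p_0(\Omega)$ be the weak solutions of the Stokes problem with right-hand side $f$ and $f^\varepsilon$, respectively. Then $$\|u-u^\varepsilon\|_{W^{1,p}}+\|\pi-\pi^\varepsilon\|_{L^p}\le C_0C_1\|F\|_{L^p(\Theta)}\left[\left|1-\int_{\mathbb{R}^n}\delta^\varepsilon(y)\,dy\right|+\|\rho\,\delta^\varepsilon\|_{L^p(\mathbb{R}^n)}\right],$$ where $\rho(x)=x$.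
   Context: Geometry (fixed throughout). $\Omega\subset\mathbb{R}^n$, $n\in\{2,3\}$, is a (bounded) polyhedral domain with boundary $\partial\Omega$. It is divided into two disjoint components $\Omega_0,\Omega_1$ by a simple closed curve ($n=2$) or closed surface ($n=3$) $\Gamma$ (the immersed boundary), parametrized as $\Gamma=\{X(\theta)=(X_1(\theta),\dots,X_n(\theta)) : \theta\in\Theta\}$, where $\Theta\subset\mathbb{R}^{n-1}$ is bounded. Define $J_X=\sqrt{|\partial X_1/\partial\theta|^2+|\partial X_2/\partial\theta|^2}$ if $n=2$, and $J_X=\sqrt{\left|\frac{\partial(X_2,X_3)}{\partial(\theta_1,\theta_2)}\right|^2+\left|\frac{\partial(X_3,X_1)}{\partial(\theta_1,\theta_2)}\right|^2+\left|\frac{\partial(X_1,X_2)}{\partial(\theta_1,\theta_2)}\right|^2}$ if $n=3$. Standing assumptions: $\Gamma$ is a $C^1$ boundary and $X$ is a $C^1$ function; $\operatorname{dist}(\Gamma,\partial\Omega)>0$; $J_X(\theta)\ne0$ for $\theta\in\Theta$. Notation. $p'$ is the conjugate exponent of $p$. $W^{1,s}_0(\Omega)=\{v\in W^{1,s}(\Omega): v|_{\partial\Omega}=0\}$; $W^{-1,p}(\Omega)^n$ is the topological dual of $W^{1,p'}_0(\Omega)^n$; $L^s_0(\Omega)=\{q\in L^s(\Omega):\int_\Omega q\,dx=0\}$; $B(a,r)$ is the open ball. $\|\rho\delta^\varepsilon\|_{L^p(\mathbb{R}^n)}=\left(\int_{\mathbb{R}^n}|y|^p|\delta^\varepsilon(y)|^p\,dy\right)^{1/p}$.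 Forces. $f\in W^{-1,p}(\Omega)^n$ is the functional $\langle f,\varphi\rangle=\int_\Theta F(\theta)\cdot\varphi(X(\theta))\,d\theta$, $\varphi\in W^{1,p'}_0(\Omega)^n$ (note $p'>n$, so $\varphi$ is continuous). $f^\varepsilon(x)=\int_\Theta F(\theta)\,\delta^\varepsilon(x-X(\theta))\,d\theta$, identified with the functional $\varphi\mapsto\int_\Omega f^\varepsilon\cdot\varphi\,dx$. Stokes problem. Fix $\nu>0$. For $g\in W^{-1,p}(\Omega)^n$, a weak solution of $-\nu\Delta w+\nabla r=g$, $\nabla\cdot w=0$ in $\Omega$, $w=0$ on $\partial\Omega$, is a pair $(w,r)\in W^{1,p}_0(\Omega)^n\times L^p_0(\Omega)$ with $a(w,v)+b(r,v)=\langle g,v\rangle$ for all $v\in W^{1,p'}_0(\Omega)^n$ and $b(q,w)=0$ for all $q\in L^{p'}_0(\Omega)$, where $a(u,v)=\frac{\nu}{2}\int_\Omega\sum_{i,j}\left(\frac{\partial u_j}{\partial x_i}+\frac{\partial u_i}{\partial x_j}\right)\left(\frac{\partial v_j}{\partial x_i}+\frac{\partial v_i}{\partial x_j}\right)dx$ and $b(\pi,u)=-\int_\Omega\pi(\nabla\cdot u)\,dx$. Assumption (A1$_p$): for every $g\in W^{-1,p}(\Omega)^n$ there is a unique weak solution $(w,r)\in W^{1,p}_0(\Omega)^n\times L^p_0(\Omega)$ of the Stokes problem with right-hand side $g$, and $\|w\|_{W^{1,p}}+\|r\|_{L^p}\le C_1\|g\|_{W^{-1,p}}$; moreover, if $g\in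 W^{-1,2}(\Omega)^n\cap L^p(\Omega)^n$, then $(w,r)\in W^{2,p}(\Omega)^n\times W^{1,p}(\Omega)$ and $\|w\|_{W^{2,p}}+\|r\|_{W^{1,p}}\le C_2\|g\|_{L^p}$. Here $C_1,C_2>0$ depend only on $p$ and $\Omega$. *)

theory Defs
  imports "HOL-Analysis.Analysis" "HOL-Probability.Essential_Supremum"
begin

section \<open>Geometry\<close>

text \<open>Boundedness is implied: polytopes are compact and the union is finite. The condition
  \<open>interior (closure \<Omega>) = \<Omega>\<close> excludes slits and removed points.\<close>

definition polyhedral_domain :: "(real ^ 'n) set \<Rightarrow> bool" where
  "polyhedral_domain \<Omega> \<longleftrightarrow> \<Omega> \<noteq> {} \<and> open \<Omega> \<and> connected \<Omega> \<and> interior (closure \<Omega>) = \<Omega> \<and>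
     (\<exists>\<P>. finite \<P> \<and> (\<forall>P\<in>\<P>. polytope P) \<and> closure \<Omega> = \<Union>\<P>)"

text \<open>Only used on open sets \<open>U\<close>.\<close>

definition C1_on :: "'a::real_normed_vector set \<Rightarrow> ('a \<Rightarrow> 'b::real_normed_vector) \<Rightarrow> bool" where
  "C1_on U f \<longleftrightarrow> (\<forall>x\<in>U. f differentiable (at x)) \<and>
     (\<forall>v. continuous_on U (\<lambda>x. frechet_derivative f (at x) v))"

definition C1_interface ::
    "(real ^ 'n) set \<Rightarrow> (real ^ 'n) set \<Rightarrow> (real ^ 'n) set \<Rightarrow> bool" where
  "C1_interface \<Gamma> \<Omega>0 \<Omega>1 \<longleftrightarrow>
     (\<forall>x\<in>\<Gamma>. \<exists>U (h :: real ^ 'n \<Rightarrow> real). open U \<and> x \<in> U \<and> C1_on U h \<and>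
        (\<forall>y\<in>U. frechet_derivative h (at y) \<noteq> (\<lambda>_. 0)) \<and>
        \<Gamma> \<inter> U = {y\<in>U. h y = 0} \<and> \<Omega>0 \<inter> U = {y\<in>U. h y < 0} \<and> \<Omega>1 \<inter> U = {y\<in>U. h y > 0})"

text \<open>A closed curve (\<open>n = 2\<close>) or closed surface (\<open>n = 3\<close>) \<open>\<Gamma> \<subseteq> \<Omega>\<close> cutting \<open>\<Omega>\<close> into the two
  components \<open>\<Omega>0\<close>, \<open>\<Omega>1\<close>. That \<open>\<Gamma>\<close> is a manifold without boundary is part of \<open>C1_interface\<close>.\<close>

definition immersed_boundary ::
    "(real ^ 'n) set \<Rightarrow> (real ^ 'n) set \<Rightarrow> (real ^ 'n) set \<Rightarrow> (real ^ 'n) set \<Rightarrow> bool" where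
  "immersed_boundary \<Omega> \<Omega>0 \<Omega>1 \<Gamma> \<longleftrightarrow>
     \<Gamma> \<noteq> {} \<and> \<Gamma> \<subseteq> \<Omega> \<and> compact \<Gamma> \<and> connected \<Gamma> \<and>
     (CARD('n) = 2 \<longrightarrow> (\<exists>\<gamma>. simple_path \<gamma> \<and> pathfinish \<gamma> = pathstart \<gamma> \<and> path_image \<gamma> = \<Gamma>)) \<and>
     \<Omega>0 \<noteq> \<Omega>1 \<and> components (\<Omega> - \<Gamma>) = {\<Omega>0, \<Omega>1} \<and>
     C1_interface \<Gamma> \<Omega>0 \<Omega>1 \<and> setdist \<Gamma> (frontier \<Omega>) > 0"

text \<open>\<open>DX\<close> is the Jacobian matrix of \<open>X\<close> on \<open>\<Theta>\<close>; derivatives are taken within \<open>\<Theta>\<close>, which need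
  not be open (e.g. a half-open parameter interval).\<close>

definition C1_parametrization ::
    "(real ^ 'm) set \<Rightarrow> (real ^ 'm \<Rightarrow> real ^ 'n) \<Rightarrow> (real ^ 'm \<Rightarrow> real ^ 'm ^ 'n) \<Rightarrow> bool" where
  "C1_parametrization \<Theta> X DX \<longleftrightarrow>
     (\<forall>\<theta>\<in>\<Theta>. (X has_derivative (\<lambda>h. DX \<theta> *v h)) (at \<theta> within \<Theta>)) \<and> continuous_on \<Theta> DX"

text \<open>For \<open>CARD('n) = CARD('m) + 1\<close>: the square root of the sum of the squared maximal minors,
  the \<open>i\<close>-th minor being formed from all rows except \<open>i\<close>. The enumeration of these rows is
  arbitrary since it only affects the sign of the minor.\<close>

definition row_enum :: "'n \<Rightarrow> 'm \<Rightarrow> 'n" where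
  "row_enum i = (SOME e. bij_betw e UNIV (UNIV - {i}))"

definition surface_jacobian :: "real ^ 'm ^ 'n \<Rightarrow> real" where
  "surface_jacobian D = sqrt (\<Sum>i\<in>UNIV. (det (\<chi> j. D $ row_enum i j :: real ^ 'm ^ 'm))\<^sup>2)"


section \<open>Lebesgue spaces\<close>

text \<open>Elements of function spaces are represented by functions, identified almost everywhere
  on the domain; their values outside the domain are irrelevant.\<close>

definition conj_exponent :: "real \<Rightarrow> ennreal" where
  "conj_exponent p = (if p = 1 then \<infinity> else ennreal (p / (p - 1)))"

definition Lspace :: "ennreal \<Rightarrow> 'a measure \<Rightarrow> ('a \<Rightarrow> 'b::euclidean_space) set" where
  "Lspace s M = {f \<in> borel_measurable M.
     if s = \<infinity> then esssup M (\<lambda>x. ennreal (norm (f x))) < \<infinity>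
     else integrable M (\<lambda>x. norm (f x) powr enn2real s)}"

definition Lnorm :: "ennreal \<Rightarrow> 'a measure \<Rightarrow> ('a \<Rightarrow> 'b::euclidean_space) \<Rightarrow> real" where
  "Lnorm s M f =
     (if s = \<infinity> then enn2real (esssup M (\<lambda>x. ennreal (norm (f x))))
      else (\<integral>x. norm (f x) powr enn2real s \<partial>M) powr (1 / enn2real s))"

definition L0space :: "ennreal \<Rightarrow> (real ^ 'n) set \<Rightarrow> (real ^ 'n \<Rightarrow> real) set" where
  "L0space s \<Omega> = {q \<in> Lspace s (lebesgue_on \<Omega>). (\<integral>x. q x \<partial>lebesgue_on \<Omega>) = 0}"


section \<open>Sobolev spaces\<close>

definition C1_compact :: "(real ^ 'n) set \<Rightarrow> (real ^ 'n \<Rightarrow> 'b::euclidean_space) set" where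
  "C1_compact \<Omega> = {\<phi>. C1_on UNIV \<phi> \<and> (\<exists>K. compact K \<and> K \<subseteq> \<Omega> \<and> (\<forall>x. x \<notin> K \<longrightarrow> \<phi> x = 0))}"

text \<open>The \<open>i\<close>-th entry of a weak gradient is the weak partial derivative in direction \<open>i\<close>. For a
  vector field \<open>u\<close>, \<open>wgrad \<Omega> u x $ i $ j\<close> is thus the \<open>i\<close>-th partial derivative of the
  \<open>j\<close>-th component.\<close>

definition locally_integrable :: "(real ^ 'n) set \<Rightarrow> (real ^ 'n \<Rightarrow> 'b::euclidean_space) \<Rightarrow> bool" where
  "locally_integrable \<Omega> v \<longleftrightarrow> (\<forall>K. compact K \<and> K \<subseteq> \<Omega> \<longrightarrow> integrable (lebesgue_on K) v)"

definition has_weak_gradient ::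
    "(real ^ 'n) set \<Rightarrow> (real ^ 'n \<Rightarrow> 'b::euclidean_space) \<Rightarrow> (real ^ 'n \<Rightarrow> 'b ^ 'n) \<Rightarrow> bool" where
  "has_weak_gradient \<Omega> v G \<longleftrightarrow> locally_integrable \<Omega> v \<and> locally_integrable \<Omega> G \<and>
     (\<forall>\<phi>\<in>C1_compact \<Omega>. \<forall>i.
        (\<integral>x. frechet_derivative \<phi> (at x) (axis i 1) *\<^sub>R v x \<partial>lebesgue_on \<Omega>) =
        - (\<integral>x. \<phi> x *\<^sub>R (G x $ i) \<partial>lebesgue_on \<Omega>))"

definition wgrad :: "(real ^ 'n) set \<Rightarrow> (real ^ 'n \<Rightarrow> 'b::euclidean_space) \<Rightarrow> real ^ 'n \<Rightarrow> 'b ^ 'n" where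
  "wgrad \<Omega> v = (SOME G. has_weak_gradient \<Omega> v G)"

definition W1 :: "ennreal \<Rightarrow> (real ^ 'n) set \<Rightarrow> (real ^ 'n \<Rightarrow> 'b::euclidean_space) set" where
  "W1 s \<Omega> = {v \<in> Lspace s (lebesgue_on \<Omega>).
     \<exists>G \<in> Lspace s (lebesgue_on \<Omega>). has_weak_gradient \<Omega> v G}"

definition W1_norm :: "ennreal \<Rightarrow> (real ^ 'n) set \<Rightarrow> (real ^ 'n \<Rightarrow> 'b::euclidean_space) \<Rightarrow> real" where
  "W1_norm s \<Omega> v = Lnorm s (lebesgue_on \<Omega>) v + Lnorm s (lebesgue_on \<Omega>) (wgrad \<Omega> v)"

definition W2 :: "ennreal \<Rightarrow> (real ^ 'n) set \<Rightarrow> (real ^ 'n \<Rightarrow> 'b::euclidean_space) set" where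
  "W2 s \<Omega> = {v \<in> W1 s \<Omega>. wgrad \<Omega> v \<in> W1 s \<Omega>}"

definition W2_norm :: "ennreal \<Rightarrow> (real ^ 'n) set \<Rightarrow> (real ^ 'n \<Rightarrow> 'b::euclidean_space) \<Rightarrow> real" where
  "W2_norm s \<Omega> v = Lnorm s (lebesgue_on \<Omega>) v + W1_norm s \<Omega> (wgrad \<Omega> v)"

text \<open>Vanishing boundary trace of a $W^{1,1}$ function on a bounded domain, as membership
  in the $W^{1,1}$ closure of the compactly supported functions. For \<open>1 \<le> s < \<infinity>\<close>,
  imposing it on \<open>W1 s \<Omega>\<close> gives the usual space. Closing in the norm
  of \<open>W1 s \<Omega>\<close> itself would be wrong for \<open>s = \<infinity>\<close>, where only $C^1$ functions would survive
  instead of all Lipschitz functions vanishing on the boundary.\<close>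

definition zero_trace :: "(real ^ 'n) set \<Rightarrow> (real ^ 'n \<Rightarrow> 'b::euclidean_space) \<Rightarrow> bool" where
  "zero_trace \<Omega> v \<longleftrightarrow> v \<in> W1 1 \<Omega> \<and>
     (\<exists>\<phi>. (\<forall>k::nat. \<phi> k \<in> C1_compact \<Omega>) \<and> (\<lambda>k. W1_norm 1 \<Omega> (\<lambda>x. v x - \<phi> k x)) \<longlonglongrightarrow> 0)"

definition W10 :: "ennreal \<Rightarrow> (real ^ 'n) set \<Rightarrow> (real ^ 'n \<Rightarrow> 'b::euclidean_space) set" where
  "W10 s \<Omega> = {v \<in> W1 s \<Omega>. zero_trace \<Omega> v}"

text \<open>The dual of \<open>W10 (conj_exponent p) \<Omega>\<close>. Functionals are functions of representatives;
  the bound forces them to respect almost everywhere equality.\<close>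

definition Wdual :: "real \<Rightarrow> (real ^ 'n) set \<Rightarrow> ((real ^ 'n \<Rightarrow> real ^ 'n) \<Rightarrow> real) set" where
  "Wdual p \<Omega> = {g.
     (\<forall>v \<in> W10 (conj_exponent p) \<Omega>. \<forall>w \<in> W10 (conj_exponent p) \<Omega>. g (\<lambda>x. v x + w x) = g v + g w) \<and>
     (\<forall>c. \<forall>v \<in> W10 (conj_exponent p) \<Omega>. g (\<lambda>x. c *\<^sub>R v x) = c * g v) \<and>
     (\<exists>C. \<forall>v \<in> W10 (conj_exponent p) \<Omega>. \<bar>g v\<bar> \<le> C * W1_norm (conj_exponent p) \<Omega> v)}"

definition Wdual_norm :: "real \<Rightarrow> (real ^ 'n) set \<Rightarrow> ((real ^ 'n \<Rightarrow> real ^ 'n) \<Rightarrow> real) \<Rightarrow> real" where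
  "Wdual_norm p \<Omega> g =
     Sup {\<bar>g v\<bar> | v. v \<in> W10 (conj_exponent p) \<Omega> \<and> W1_norm (conj_exponent p) \<Omega> v \<le> 1}"


section \<open>Forces\<close>

definition volume_functional ::
    "(real ^ 'n) set \<Rightarrow> (real ^ 'n \<Rightarrow> real ^ 'n) \<Rightarrow> (real ^ 'n \<Rightarrow> real ^ 'n) \<Rightarrow> real" where
  "volume_functional \<Omega> g \<phi> = (\<integral>x. g x \<bullet> \<phi> x \<partial>lebesgue_on \<Omega>)"

text \<open>Point values on \<open>\<Gamma>\<close> are those of the continuous representative, which is unique on an
  open \<open>\<Omega>\<close> and exists for \<open>\<phi>\<close> in \<open>W10 s \<Omega>\<close> with \<open>s > n\<close>.\<close>

definition cont_rep :: "(real ^ 'n) set \<Rightarrow> (real ^ 'n \<Rightarrow> real ^ 'n) \<Rightarrow> real ^ 'n \<Rightarrow> real ^ 'n" where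
  "cont_rep \<Omega> \<phi> = (SOME \<psi>. continuous_on \<Omega> \<psi> \<and> (AE x in lebesgue_on \<Omega>. \<psi> x = \<phi> x))"

definition immersed_force ::
    "(real ^ 'n) set \<Rightarrow> (real ^ 'm) set \<Rightarrow> (real ^ 'm \<Rightarrow> real ^ 'n) \<Rightarrow> (real ^ 'm \<Rightarrow> real ^ 'n) \<Rightarrow>
     (real ^ 'n \<Rightarrow> real ^ 'n) \<Rightarrow> real" where
  "immersed_force \<Omega> \<Theta> X F \<phi> = (\<integral>\<theta>. F \<theta> \<bullet> cont_rep \<Omega> \<phi> (X \<theta>) \<partial>lebesgue_on \<Theta>)"

definition regularized_force ::
    "(real ^ 'm) set \<Rightarrow> (real ^ 'm \<Rightarrow> real ^ 'n) \<Rightarrow> (real ^ 'm \<Rightarrow> real ^ 'n) \<Rightarrow> (real ^ 'n \<Rightarrow> real) \<Rightarrow>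
     real ^ 'n \<Rightarrow> real ^ 'n" where
  "regularized_force \<Theta> X F \<delta> x = (\<integral>\<theta>. \<delta> (x - X \<theta>) *\<^sub>R F \<theta> \<partial>lebesgue_on \<Theta>)"


section \<open>The Stokes problem\<close>

definition stokes_a ::
    "real \<Rightarrow> (real ^ 'n) set \<Rightarrow> (real ^ 'n \<Rightarrow> real ^ 'n) \<Rightarrow> (real ^ 'n \<Rightarrow> real ^ 'n) \<Rightarrow> real" where
  "stokes_a \<nu> \<Omega> u v = \<nu> / 2 * (\<integral>x. (\<Sum>i\<in>UNIV. \<Sum>j\<in>UNIV.
      (wgrad \<Omega> u x $ i $ j + wgrad \<Omega> u x $ j $ i) *
      (wgrad \<Omega> v x $ i $ j + wgrad \<Omega> v x $ j $ i)) \<partial>lebesgue_on \<Omega>)"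

definition stokes_b ::
    "(real ^ 'n) set \<Rightarrow> (real ^ 'n \<Rightarrow> real) \<Rightarrow> (real ^ 'n \<Rightarrow> real ^ 'n) \<Rightarrow> real" where
  "stokes_b \<Omega> q u = - (\<integral>x. q x * (\<Sum>i\<in>UNIV. wgrad \<Omega> u x $ i $ i) \<partial>lebesgue_on \<Omega>)"

definition weak_stokes_solution ::
    "real \<Rightarrow> real \<Rightarrow> (real ^ 'n) set \<Rightarrow> ((real ^ 'n \<Rightarrow> real ^ 'n) \<Rightarrow> real) \<Rightarrow>
     (real ^ 'n \<Rightarrow> real ^ 'n) \<Rightarrow> (real ^ 'n \<Rightarrow> real) \<Rightarrow> bool" where
  "weak_stokes_solution \<nu> p \<Omega> g w r \<longleftrightarrow>
     w \<in> W10 (ennreal p) \<Omega> \<and> r \<in> L0space (ennreal p) \<Omega> \<and>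
     (\<forall>v \<in> W10 (conj_exponent p) \<Omega>. stokes_a \<nu> \<Omega> w v + stokes_b \<Omega> r v = g v) \<and>
     (\<forall>q \<in> L0space (conj_exponent p) \<Omega>. stokes_b \<Omega> q w = 0)"

text \<open>In the regularity part, membership in $W^{-1,2}$ of a function \<open>g\<close> in $L^p$ is
  understood in the sense of distributions, because for small \<open>p\<close> the product of \<open>g\<close> with
  an arbitrary $W^{1,2}$ function need not be integrable.\<close>

definition stokes_A1 :: "real \<Rightarrow> real \<Rightarrow> (real ^ 'n) set \<Rightarrow> real \<Rightarrow> real \<Rightarrow> bool" where
  "stokes_A1 \<nu> p \<Omega> C1 C2 \<longleftrightarrow>
     (\<forall>g \<in> Wdual p \<Omega>. \<exists>w r. weak_stokes_solution \<nu> p \<Omega> g w r \<and>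
        (\<forall>w' r'. weak_stokes_solution \<nu> p \<Omega> g w' r' \<longrightarrow>
           (AE x in lebesgue_on \<Omega>. w' x = w x \<and> r' x = r x)) \<and>
        W1_norm (ennreal p) \<Omega> w + Lnorm (ennreal p) (lebesgue_on \<Omega>) r \<le> C1 * Wdual_norm p \<Omega> g) \<and>
     (\<forall>g \<in> Lspace (ennreal p) (lebesgue_on \<Omega>).
        (\<exists>h \<in> Wdual 2 \<Omega>. \<forall>\<phi> \<in> C1_compact \<Omega>. h \<phi> = volume_functional \<Omega> g \<phi>) \<longrightarrow>
        (\<forall>w r. weak_stokes_solution \<nu> p \<Omega> (volume_functional \<Omega> g) w r \<longrightarrow>
           w \<in> W2 (ennreal p) \<Omega> \<and> r \<in> W1 (ennreal p) \<Omega> \<and>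
           W2_norm (ennreal p) \<Omega> w + W1_norm (ennreal p) \<Omega> r
             \<le> C2 * Lnorm (ennreal p) (lebesgue_on \<Omega>) g))"

end

theory Submission
  imports Defs
begin

text \<open>
  The pair \<open>(u - u\<epsilon>, \<pi> - \<pi>\<epsilon>)\<close> is a weak solution for the right-hand side \<open>g = f - f\<epsilon>\<close>
  (\<open>weak_stokes_solution_diff\<close>). By uniqueness it agrees almost everywhere with the solution that
  the stability assumption provides, so its norm is at most \<open>C1\<close> times the dual norm of \<open>g\<close>, and
  everything reduces to estimating \<open>g\<close> on a test function \<open>v\<close> in the space with exponent
  \<open>p' = conj_exponent p\<close> (\<open>immersed_force_error_Wdual\<close>).

  Let \<open>\<psi>\<close> be the continuous representative of \<open>v\<close>, extended by zero. Fubini's theorem turns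
  \<open>g v\<close> into the integral over \<open>\<Theta>\<close> of \<open>F\<close> against the values at \<open>X \<theta>\<close> of
  \<open>\<psi> x - \<integral> \<delta> y \<psi> (x + y) dy = (1 - \<integral> \<delta>) \<psi> x + \<integral> \<delta> y (\<psi> x - \<psi> (x + y)) dy\<close>.
  Both terms are bounded uniformly in \<open>x\<close>. In the second one the increment of \<open>\<psi>\<close> is the
  integral of the gradient along the segment from \<open>x\<close> to \<open>x + y\<close>; for fixed \<open>t\<close> in \<open>(0, 1)\<close>
  Hoelder's inequality in \<open>y\<close> bounds the contribution of the points \<open>x + t y\<close> by the \<open>L p\<close> norm of
  \<open>\<delta> y y\<close> times the \<open>L p'\<close> norm of \<open>\<lambda>y. \<nabla>v (x + t y)\<close>, and the latter is
  \<open>t powr (- n / p')\<close> times the norm of \<open>\<nabla>v\<close>. The power is integrable over \<open>(0, 1)\<close> because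
  \<open>n / p' < 1\<close>, which is the condition \<open>p < n / (n - 1)\<close> (\<open>segment_potential_le\<close>). The first term
  needs a bound for the supremum of \<open>\<psi>\<close>, which follows from the estimate of the second term, applied
  to one fixed kernel of integral \<open>1\<close>. As the bounds hold at every point, integrating them over
  \<open>\<Theta>\<close> only costs the \<open>L 1\<close> norm of \<open>F\<close>, and \<open>\<Theta>\<close> is bounded.

  A test function is a limit of \<open>C1\<close> functions with compact support in the \<open>W 1 1\<close> norm only,
  whereas its gradient is controlled in \<open>L p'\<close>. The estimate by the potential of the gradient is
  therefore proved for the approximating functions and carried to the limit in \<open>L 1\<close>
  (\<open>convolution_defect_AE_le\<close>); Hoelder's inequality is applied after the limit. This gives the
  estimate for almost every \<open>x\<close>. For kernels of integral \<open>1\<close> whose first moments tend to zero it says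
  that \<open>v\<close> is almost everywhere a uniform limit of continuous functions; hence the continuous
  representative exists and the estimate holds at every point
  (\<open>W10_continuous_representative\<close>).

  All these computations concern a gradient chosen by \<open>wgrad\<close>, which is determined almost
  everywhere by the fundamental lemma of the calculus of variations.
\<close>

section \<open>Lebesgue spaces\<close>

lemma Lspace_measurable: "f \<in> Lspace s M \<Longrightarrow> f \<in> borel_measurable M"
  by (simp add: Lspace_def)

lemma AE_le_Lnorm_infinity:
  assumes "f \<in> Lspace top M"
  shows "AE x in M. norm (f x) \<le> Lnorm top M f"
proof -
  have fin: "esssup M (\<lambda>x. ennreal (norm (f x))) < \<infinity>"
    using assms by (simp add: Lspace_def)
  show ?thesis
    using esssup_AE[of "\<lambda>x. ennreal (norm (f x))" M]
  proof eventually_elim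
    case (elim x)
    with fin have "enn2real (ennreal (norm (f x))) \<le> enn2real (esssup M (\<lambda>x. ennreal (norm (f x))))"
      by (intro enn2real_mono) auto
    then show ?case by (simp add: Lnorm_def)
  qed
qed

lemma esssup_norm_le:
  fixes f :: "'a \<Rightarrow> 'b::euclidean_space"
  assumes [measurable]: "f \<in> borel_measurable M" and "AE x in M. norm (f x) \<le> C"
  shows "esssup M (\<lambda>x. ennreal (norm (f x))) \<le> ennreal C"
proof -
  have "AE x in M. ennreal (norm (f x)) \<le> ennreal C"
    using assms(2) by eventually_elim (simp add: ennreal_leI)
  then show ?thesis by (intro esssup_I) auto
qed

text \<open>The definition speaks of an extended essential supremum; all later arguments use a real bound
  almost everywhere.\<close>

lemma Lspace_infinity_iff:
  fixes f :: "'a \<Rightarrow> 'b::euclidean_space"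
  shows "f \<in> Lspace top M \<longleftrightarrow> f \<in> borel_measurable M \<and> (\<exists>C. AE x in M. norm (f x) \<le> C)"
proof
  assume "f \<in> Lspace top M"
  then show "f \<in> borel_measurable M \<and> (\<exists>C. AE x in M. norm (f x) \<le> C)"
    using AE_le_Lnorm_infinity[of f M] Lspace_measurable[of f top M] by blast
next
  assume *: "f \<in> borel_measurable M \<and> (\<exists>C. AE x in M. norm (f x) \<le> C)"
  then obtain C where "esssup M (\<lambda>x. ennreal (norm (f x))) \<le> ennreal C"
    using esssup_norm_le[of f M] by blast
  then have "esssup M (\<lambda>x. ennreal (norm (f x))) < \<infinity>" by (rule le_less_trans) simp
  with * show "f \<in> Lspace top M" by (simp add: Lspace_def)
qed

lemma Lnorm_infinity_le:
  fixes f :: "'a \<Rightarrow> 'b::euclidean_space"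
  assumes "f \<in> borel_measurable M" "AE x in M. norm (f x) \<le> C" "0 \<le> C"
  shows "Lnorm top M f \<le> C"
  using enn2real_mono[OF esssup_norm_le[OF assms(1,2)]] assms(3) by (simp add: Lnorm_def)

lemma Lspace_finite_iff:
  "0 < q \<Longrightarrow> f \<in> Lspace (ennreal q) M \<longleftrightarrow>
    f \<in> borel_measurable M \<and> integrable M (\<lambda>x. norm (f x) powr q)"
  by (simp add: Lspace_def)

lemma Lnorm_finite:
  "0 < q \<Longrightarrow> Lnorm (ennreal q) M f = (\<integral>x. norm (f x) powr q \<partial>M) powr (1 / q)"
  by (simp add: Lnorm_def)

lemma Lspace_1_iff:
  fixes f :: "'a \<Rightarrow> 'b::euclidean_space"
  shows "f \<in> Lspace 1 M \<longleftrightarrow> integrable M f"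
  using Lspace_finite_iff[of 1 f M] integrable_norm_cancel[of M f] by auto

lemma Lnorm_1:
  fixes f :: "'a \<Rightarrow> 'b::euclidean_space"
  shows "Lnorm 1 M f = (\<integral>x. norm (f x) \<partial>M)"
  using Lnorm_finite[of 1 M f] by simp

lemma Lnorm_nonneg: "0 \<le> Lnorm s M f"
  by (simp add: Lnorm_def)

lemma Lnorm_AE_cong:
  assumes [measurable]: "f \<in> borel_measurable M" "g \<in> borel_measurable M"
    and "AE x in M. norm (f x) = norm (g x)"
  shows "Lnorm s M f = Lnorm s M g"
proof -
  have "esssup M (\<lambda>x. ennreal (norm (f x))) = esssup M (\<lambda>x. ennreal (norm (g x)))"
    using assms(3) by (intro esssup_AE_cong) auto
  moreover have "(\<integral>x. norm (f x) powr q \<partial>M) = (\<integral>x. norm (g x) powr q \<partial>M)" for q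
    using assms(3) by (intro integral_cong_AE) auto
  ultimately show ?thesis by (simp add: Lnorm_def)
qed

definition exponent :: "ennreal \<Rightarrow> bool" where
  "exponent s \<longleftrightarrow> s = top \<or> (\<exists>q\<ge>1. s = ennreal q)"

lemma exponent_ennreal: "1 \<le> q \<Longrightarrow> exponent (ennreal q)"
  by (auto simp: exponent_def)

lemma exponent_1: "exponent 1"
  using exponent_ennreal[of 1] by simp

lemma conj_exponent_cases:
  assumes "1 \<le> p"
  obtains "p = 1" "conj_exponent p = top"
  | q where "1 < p" "1 < q" "1 / p + 1 / q = 1" "conj_exponent p = ennreal q"
proof (cases "p = 1")
  case False
  with assms have "1 < p" by simp
  then have "1 < p / (p - 1)" "1 / p + 1 / (p / (p - 1)) = 1"
    by (auto simp: field_simps)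
  with \<open>1 < p\<close> False that(2)[of "p / (p - 1)"] show ?thesis
    by (simp add: conj_exponent_def)
qed (use that(1) in \<open>simp add: conj_exponent_def\<close>)

lemma exponent_conj_exponent: "1 \<le> p \<Longrightarrow> exponent (conj_exponent p)"
  by (erule conj_exponent_cases) (auto simp: exponent_def intro: less_imp_le)

lemma Lspace_dominated:
  fixes f :: "'a \<Rightarrow> 'b::euclidean_space" and g :: "'a \<Rightarrow> 'c::euclidean_space"
  assumes s: "exponent s" and g: "g \<in> Lspace s M" and [measurable]: "f \<in> borel_measurable M"
    and le: "AE x in M. norm (f x) \<le> c * norm (g x)" and c: "0 \<le> c"
  shows "f \<in> Lspace s M"
  using s unfolding exponent_def
proof (elim disjE exE conjE)
  assume [simp]: "s = top"
  have "AE x in M. norm (f x) \<le> c * Lnorm top M g"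
    using le AE_le_Lnorm_infinity[OF g[simplified]]
    by eventually_elim (use c mult_left_mono order_trans in blast)
  then show ?thesis by (auto simp: Lspace_infinity_iff)
next
  fix q :: real assume q: "1 \<le> q" "s = ennreal q"
  have [measurable]: "g \<in> borel_measurable M" and int: "integrable M (\<lambda>x. norm (g x) powr q)"
    using g q by (auto simp: Lspace_finite_iff)
  have "integrable M (\<lambda>x. c powr q * norm (g x) powr q)" using int by simp
  then have "integrable M (\<lambda>x. norm (f x) powr q)"
  proof (rule Bochner_Integration.integrable_bound)
    show "AE x in M. norm (norm (f x) powr q) \<le> norm (c powr q * norm (g x) powr q)"
      using le
    proof eventually_elim
      case (elim x)
      then have "norm (f x) powr q \<le> (c * norm (g x)) powr q"
        using q by (intro powr_mono2) auto
      then show ?case using c by (simp add: powr_mult)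
    qed
  qed auto
  then show ?thesis using q by (simp add: Lspace_finite_iff)
qed

lemma Lspace_add:
  fixes f g :: "'a \<Rightarrow> 'b::euclidean_space"
  assumes s: "exponent s" and f: "f \<in> Lspace s M" and g: "g \<in> Lspace s M"
  shows "(\<lambda>x. f x + g x) \<in> Lspace s M"
  using s unfolding exponent_def
proof (elim disjE exE conjE)
  assume [simp]: "s = top"
  have "AE x in M. norm (f x + g x) \<le> Lnorm top M f + Lnorm top M g"
    using AE_le_Lnorm_infinity[OF f[simplified]] AE_le_Lnorm_infinity[OF g[simplified]]
    by eventually_elim (rule order_trans[OF norm_triangle_ineq], simp)
  then show ?thesis using f g by (auto simp: Lspace_infinity_iff)
next
  fix q :: real assume q: "1 \<le> q" "s = ennreal q"
  have [measurable]: "f \<in> borel_measurable M" "g \<in> borel_measurable M"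
    and int: "integrable M (\<lambda>x. norm (f x) powr q)" "integrable M (\<lambda>x. norm (g x) powr q)"
    using f g q by (auto simp: Lspace_finite_iff)
  have "integrable M (\<lambda>x. 2 powr q * (norm (f x) powr q + norm (g x) powr q))" using int by simp
  then have "integrable M (\<lambda>x. norm (f x + g x) powr q)"
  proof (rule Bochner_Integration.integrable_bound)
    show "AE x in M. norm (norm (f x + g x) powr q)
        \<le> norm (2 powr q * (norm (f x) powr q + norm (g x) powr q))"
    proof (intro AE_I2)
      fix x
      have "norm (f x + g x) powr q \<le> (2 * max (norm (f x)) (norm (g x))) powr q"
        using q norm_triangle_ineq[of "f x" "g x"] by (intro powr_mono2) auto
      also have "\<dots> = 2 powr q * max (norm (f x)) (norm (g x)) powr q"
        by (simp add: powr_mult)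
      also have "\<dots> \<le> 2 powr q * (norm (f x) powr q + norm (g x) powr q)"
        by (intro mult_left_mono) (auto simp: max_def)
      finally show "norm (norm (f x + g x) powr q)
          \<le> norm (2 powr q * (norm (f x) powr q + norm (g x) powr q))" by simp
    qed
  qed auto
  then show ?thesis using q by (simp add: Lspace_finite_iff)
qed

lemma Lspace_diff:
  fixes f g :: "'a \<Rightarrow> 'b::euclidean_space"
  assumes s: "exponent s" and f: "f \<in> Lspace s M" and g: "g \<in> Lspace s M"
  shows "(\<lambda>x. f x - g x) \<in> Lspace s M"
proof -
  have "(\<lambda>x. - g x) \<in> Lspace s M"
    using Lspace_dominated[OF s g, of "\<lambda>x. - g x" 1] Lspace_measurable[OF g] by simp
  from Lspace_add[OF s f this] show ?thesis by simp
qed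

lemma Lspace_AE_cong:
  fixes f :: "'a \<Rightarrow> 'b::euclidean_space" and g :: "'a \<Rightarrow> 'c::euclidean_space"
  assumes "exponent s" "g \<in> Lspace s M" "f \<in> borel_measurable M" "AE x in M. norm (f x) = norm (g x)"
  shows "f \<in> Lspace s M"
  using assms(4) by (intro Lspace_dominated[OF assms(1-3), of 1]) auto

lemma Lspace_bounded:
  fixes f :: "'a \<Rightarrow> 'b::euclidean_space"
  assumes "finite_measure M" and s: "exponent s" and [measurable]: "f \<in> borel_measurable M"
    and C: "\<And>x. x \<in> space M \<Longrightarrow> norm (f x) \<le> C"
  shows "f \<in> Lspace s M"
proof -
  interpret finite_measure M by fact
  have *: "(\<lambda>x. \<bar>C\<bar>) \<in> Lspace s M"
    using s unfolding exponent_def by (auto simp: Lspace_infinity_iff Lspace_finite_iff intro!: exI[of _ "\<bar>C\<bar>"])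
  show ?thesis
  proof (rule Lspace_dominated[OF s *, where c=1])
    show "AE x in M. norm (f x) \<le> 1 * norm \<bar>C\<bar>"
      using C by (intro AE_I2) fastforce
  qed auto
qed

text \<open>Normalising both factors reduces the inequality to Young's inequality, integrated.\<close>

lemma Holder_inequality_conj:
  fixes f :: "'a \<Rightarrow> 'b::euclidean_space" and g :: "'a \<Rightarrow> 'c::euclidean_space"
  assumes p: "1 \<le> p" and f: "f \<in> Lspace (ennreal p) M" and g: "g \<in> Lspace (conj_exponent p) M"
  shows "integrable M (\<lambda>x. norm (f x) * norm (g x)) \<and>
    (\<integral>x. norm (f x) * norm (g x) \<partial>M) \<le> Lnorm (ennreal p) M f * Lnorm (conj_exponent p) M g"
proof -
  have [measurable]: "f \<in> borel_measurable M" "g \<in> borel_measurable M"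
    using f g by (auto dest: Lspace_measurable)
  show ?thesis using p
  proof (cases rule: conj_exponent_cases)
    case 1
    have int: "integrable M (\<lambda>x. norm (f x))" using f 1 by (simp add: Lspace_1_iff)
    have AE: "AE x in M. norm (g x) \<le> Lnorm top M g"
      using AE_le_Lnorm_infinity g 1 by simp
    have AE': "AE x in M. norm (f x) * norm (g x) \<le> norm (f x) * Lnorm top M g"
      using AE by eventually_elim (simp add: mult_left_mono)
    have int': "integrable M (\<lambda>x. norm (f x) * norm (g x))"
      by (rule Bochner_Integration.integrable_bound[of M "\<lambda>x. norm (f x) * Lnorm top M g"])
        (use int AE' in \<open>auto simp: abs_mult Lnorm_nonneg\<close>)
    have "(\<integral>x. norm (f x) * norm (g x) \<partial>M) \<le> (\<integral>x. norm (f x) * Lnorm top M g \<partial>M)"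
      using int int' AE' by (intro integral_mono_AE) auto
    with int' show ?thesis using 1 by (simp add: Lnorm_1)
  next
    case (2 q)
    define A where "A = (\<integral>x. norm (f x) powr p \<partial>M)"
    define B where "B = (\<integral>x. norm (g x) powr q \<partial>M)"
    have q0: "0 < p" "0 < q" using 2 by auto
    have int: "integrable M (\<lambda>x. norm (f x) powr p)" "integrable M (\<lambda>x. norm (g x) powr q)"
      using f g 2 by (auto simp: Lspace_finite_iff)
    have A0: "0 \<le> A" and B0: "0 \<le> B" unfolding A_def B_def by auto
    have int': "integrable M (\<lambda>x. norm (f x) * norm (g x))"
    proof (rule Bochner_Integration.integrable_bound)
      show "integrable M (\<lambda>x. norm (f x) powr p / p + norm (g x) powr q / q)" using int by simp
      show "AE x in M. norm (norm (f x) * norm (g x)) \<le> norm (norm (f x) powr p / p + norm (g x) powr q / q)"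
      proof (intro AE_I2)
        fix x
        have "norm (f x) * norm (g x) \<le> norm (f x) powr p / p + norm (g x) powr q / q"
          using Youngs_inequality[of p q] 2 by auto
        then show "norm (norm (f x) * norm (g x)) \<le> norm (norm (f x) powr p / p + norm (g x) powr q / q)"
          by (simp add: abs_mult)
      qed
    qed auto
    have eq: "Lnorm (ennreal p) M f * Lnorm (conj_exponent p) M g = A powr (1/p) * B powr (1/q)"
      using 2 by (simp add: Lnorm_finite A_def B_def)
    have "(\<integral>x. norm (f x) * norm (g x) \<partial>M) \<le> A powr (1/p) * B powr (1/q)"
    proof (cases "A = 0 \<or> B = 0")
      case True
      then have "AE x in M. norm (f x) * norm (g x) = 0"
      proof
        assume "A = 0"
        then have "AE x in M. norm (f x) powr p = 0"
          unfolding A_def using int by (subst (asm) integral_nonneg_eq_0_iff_AE) auto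
        then show ?thesis by eventually_elim simp
      next
        assume "B = 0"
        then have "AE x in M. norm (g x) powr q = 0"
          unfolding B_def using int by (subst (asm) integral_nonneg_eq_0_iff_AE) auto
        then show ?thesis by eventually_elim simp
      qed
      then have "(\<integral>x. norm (f x) * norm (g x) \<partial>M) = (\<integral>x. 0 \<partial>M)"
        by (intro integral_cong_AE) auto
      then show ?thesis using A0 B0 by simp
    next
      case False
      then have AB: "0 < A" "0 < B" using A0 B0 by auto
      define a where "a = A powr (1/p)"
      define b where "b = B powr (1/q)"
      have ab: "0 < a" "0 < b" "a powr p = A" "b powr q = B"
        using AB q0 by (auto simp: a_def b_def powr_powr)
      \<comment> \<open>Young's inequality for the normalised functions \<open>f / a\<close> and \<open>g / b\<close>.\<close>
      have "(\<integral>x. norm (f x) * norm (g x) \<partial>M)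
          \<le> (\<integral>x. (a * b) * (norm (f x) powr p / (A * p) + norm (g x) powr q / (B * q)) \<partial>M)"
      proof (rule integral_mono)
        fix x
        have "(norm (f x) / a) * (norm (g x) / b) \<le> (norm (f x) / a) powr p / p + (norm (g x) / b) powr q / q"
          using ab 2 by (intro Youngs_inequality) auto
        also have "\<dots> = norm (f x) powr p / (A * p) + norm (g x) powr q / (B * q)"
          using ab by (simp add: powr_divide)
        finally have "(norm (f x) / a) * (norm (g x) / b) * (a * b)
            \<le> (norm (f x) powr p / (A * p) + norm (g x) powr q / (B * q)) * (a * b)"
          using ab by (intro mult_right_mono) auto
        then show "norm (f x) * norm (g x)
            \<le> (a * b) * (norm (f x) powr p / (A * p) + norm (g x) powr q / (B * q))"
          using ab by (simp add: mult.commute)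
      qed (use int int' in auto)
      also have "\<dots> = (a * b) * (A / (A * p) + B / (B * q))"
        using int by (simp add: A_def B_def)
      also have "\<dots> = a * b * (1 / p + 1 / q)" using AB by simp
      also have "\<dots> = a * b" using 2 by simp
      finally show ?thesis by (simp add: a_def b_def)
    qed
    with int' eq show ?thesis by simp
  qed
qed

lemmas Holder_inequality = Holder_inequality_conj[THEN conjunct1] Holder_inequality_conj[THEN conjunct2]

lemma Holder_integrable_mult:
  fixes f g :: "'a \<Rightarrow> real"
  assumes p: "1 \<le> p" and f: "f \<in> Lspace (ennreal p) M" and g: "g \<in> Lspace (conj_exponent p) M"
  shows "integrable M (\<lambda>x. f x * g x)"
  by (rule Bochner_Integration.integrable_bound[OF Holder_inequality(1)[OF p f g]])
    (use Lspace_measurable[OF f] Lspace_measurable[OF g] in \<open>auto simp: abs_mult\<close>)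

lemma nn_Holder_inequality:
  fixes f g :: "'a \<Rightarrow> real"
  assumes p: "1 \<le> p" and f: "f \<in> Lspace (ennreal p) M" and g: "g \<in> Lspace (conj_exponent p) M"
  shows "(\<integral>\<^sup>+x. ennreal (\<bar>f x\<bar> * \<bar>g x\<bar>) \<partial>M) \<le> ennreal (Lnorm (ennreal p) M f * Lnorm (conj_exponent p) M g)"
  using Holder_inequality[OF p f g] by (subst nn_integral_eq_integral) (auto intro: ennreal_leI)

lemma lborel_integral_affine:
  fixes f :: "'a::euclidean_space \<Rightarrow> real"
  assumes t: "0 < t" and [measurable]: "f \<in> borel_measurable borel"
  shows "integrable lborel f \<Longrightarrow> integrable lborel (\<lambda>y. f (x + t *\<^sub>R y))"
    and "(\<integral>y. f y \<partial>lborel) = t ^ DIM('a) * (\<integral>y. f (x + t *\<^sub>R y) \<partial>lborel)"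
proof -
  have lb: "lborel = density (distr lborel borel (\<lambda>y. x + t *\<^sub>R y)) (\<lambda>_. ennreal (t ^ DIM('a)))"
    using lborel_affine[of t x] t by simp
  show "integrable lborel (\<lambda>y. f (x + t *\<^sub>R y))" if "integrable lborel f"
    using that t by (subst (asm) lb, subst (asm) integrable_density) (auto simp: integrable_distr_eq)
  show "(\<integral>y. f y \<partial>lborel) = t ^ DIM('a) * (\<integral>y. f (x + t *\<^sub>R y) \<partial>lborel)"
    using t by (subst lb, subst integral_density) (auto simp: integral_distr)
qed

text \<open>The substitution \<open>z = x + t y\<close> has Jacobian determinant \<open>t ^ n\<close>. The power is written with
  \<open>1 - 1 / p\<close> since this equals \<open>1 / p'\<close> for all pairs of conjugate exponents, including \<open>p' = \<infinity>\<close>.\<close>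

lemma Lspace_affine_conj:
  fixes g :: "'a::euclidean_space \<Rightarrow> real"
  assumes p: "1 \<le> p" and g: "g \<in> Lspace (conj_exponent p) lborel" and t: "0 < t"
  shows "(\<lambda>y. g (x + t *\<^sub>R y)) \<in> Lspace (conj_exponent p) lborel \<and>
    Lnorm (conj_exponent p) lborel (\<lambda>y. g (x + t *\<^sub>R y))
      \<le> t powr (- (real DIM('a) * (1 - 1 / p))) * Lnorm (conj_exponent p) lborel g"
proof -
  have [measurable]: "g \<in> borel_measurable borel" using Lspace_measurable[OF g] by simp
  have lb: "lborel = density (distr lborel borel (\<lambda>y. x + t *\<^sub>R y)) (\<lambda>_. ennreal (t ^ DIM('a)))"
    using lborel_affine[of t x] t by simp
  show ?thesis using p
  proof (cases rule: conj_exponent_cases)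
    case 1
    have "AE y in lborel. norm (g y) \<le> Lnorm top lborel g"
      using AE_le_Lnorm_infinity[of g lborel] g unfolding 1(2) by blast
    then have "AE y in density (distr lborel borel (\<lambda>y. x + t *\<^sub>R y)) (\<lambda>_. ennreal (t ^ DIM('a))).
        norm (g y) \<le> Lnorm top lborel g"
      by (simp only: lb[symmetric])
    then have AE: "AE y in lborel. norm (g (x + t *\<^sub>R y)) \<le> Lnorm top lborel g"
      using t by (simp add: AE_density AE_distr_iff)
    show ?thesis
      using AE 1 t Lnorm_infinity_le[OF _ AE Lnorm_nonneg] by (auto simp: Lspace_infinity_iff)
  next
    case (2 q)
    have q0: "0 < q" using 2 by auto
    have int: "integrable lborel (\<lambda>y. norm (g y) powr q)"
      using g 2 by (simp add: Lspace_finite_iff)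
    note A = lborel_integral_affine[OF t, of "\<lambda>y. norm (g y) powr q" x]
    have int': "integrable lborel (\<lambda>y. norm (g (x + t *\<^sub>R y)) powr q)" by (rule A(1)[OF _ int]) measurable
    have eq: "(\<integral>y. norm (g (x + t *\<^sub>R y)) powr q \<partial>lborel)
        = t powr (- real DIM('a)) * (\<integral>y. norm (g y) powr q \<partial>lborel)"
      using t by (subst A(2)) (auto simp: powr_minus powr_realpow)
    have "1 / q = 1 - 1 / p" using 2 by simp
    then have "- (real DIM('a) * (1 - 1 / p)) = - real DIM('a) * (1 / q)" by simp
    then have "Lnorm (conj_exponent p) lborel (\<lambda>y. g (x + t *\<^sub>R y))
        = t powr (- (real DIM('a) * (1 - 1 / p))) * Lnorm (conj_exponent p) lborel g"
      using q0 by (simp add: 2 Lnorm_finite eq[unfolded real_norm_def] powr_mult powr_powr)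
    then show ?thesis using int' q0 2 by (simp add: Lspace_finite_iff)
  qed
qed

lemmas Lspace_affine = Lspace_affine_conj[THEN conjunct1] Lspace_affine_conj[THEN conjunct2]

section \<open>Lebesgue measure and Borel functions\<close>

text \<open>Product measures and translations are taken of Borel measures, so Lebesgue measurable functions
  are first replaced by Borel functions. Scalar functions have Borel versions, and vector-valued
  ones are assembled from their coordinates.\<close>

lemma lebesgue_borel_version:
  fixes f :: "'a::euclidean_space \<Rightarrow> 'b::euclidean_space"
  assumes "f \<in> borel_measurable lebesgue"
  shows "\<exists>g\<in>borel_measurable borel. AE x in lborel. f x = g x"
proof -
  have "\<exists>g\<in>borel_measurable lborel. AE x in lborel. f x \<bullet> b = g x" for b
    using assms by (intro completion_ex_borel_measurable_real) auto
  then obtain g where g: "\<And>b. g b \<in> borel_measurable lborel" "\<And>b. AE x in lborel. f x \<bullet> b = g b x"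
    by metis
  have gm: "g b \<in> borel_measurable borel" for b using g(1)[of b] by simp
  have "AE x in lborel. \<forall>b\<in>Basis. f x \<bullet> b = g b x"
    using g(2) by (intro AE_finite_allI) auto
  then have "AE x in lborel. f x = (\<Sum>b\<in>Basis. g b x *\<^sub>R b)"
  proof eventually_elim
    case (elim x)
    have "f x = (\<Sum>b\<in>Basis. (f x \<bullet> b) *\<^sub>R b)" by (simp add: euclidean_representation)
    also have "\<dots> = (\<Sum>b\<in>Basis. g b x *\<^sub>R b)" using elim by (intro sum.cong) auto
    finally show ?case .
  qed
  moreover have "(\<lambda>x. \<Sum>b\<in>Basis. g b x *\<^sub>R b) \<in> borel_measurable borel"
    by (intro borel_measurable_sum borel_measurable_scaleR gm borel_measurable_const)
  ultimately show ?thesis by (rule bexI)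
qed

lemma borel_measurable_lebesgue_on_AE:
  fixes f g :: "'a::euclidean_space \<Rightarrow> 'b::euclidean_space"
  assumes S: "S \<in> sets lebesgue" and f: "f \<in> borel_measurable (lebesgue_on S)"
    and eq: "AE x in lebesgue_on S. f x = g x"
  shows "g \<in> borel_measurable (lebesgue_on S)"
proof -
  have "(\<lambda>x. if x \<in> S then f x else 0) \<in> borel_measurable lebesgue"
    using f S by (rule borel_measurable_if_I)
  moreover have "AE x in lebesgue. (if x \<in> S then f x else 0) = (if x \<in> S then g x else 0)"
    using eq S by (subst (asm) AE_restrict_space_iff) (auto elim: eventually_mono)
  ultimately have "(\<lambda>x. if x \<in> S then g x else 0) \<in> borel_measurable lebesgue"
    by (rule borel_measurable_AE)
  then show ?thesis by (rule borel_measurable_if_D)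
qed

lemma integral_lebesgue_on_eq_lborel:
  fixes f :: "'a::euclidean_space \<Rightarrow> 'b::euclidean_space"
  assumes "S \<in> sets lebesgue" and "f \<in> borel_measurable borel" and "\<And>x. x \<notin> S \<Longrightarrow> f x = 0"
  shows "(\<integral>x. f x \<partial>lebesgue_on S) = (\<integral>x. f x \<partial>lborel)"
proof -
  have "(\<integral>x. f x \<partial>lebesgue_on S) = (\<integral>x. (if x \<in> S then f x else 0) \<partial>lebesgue)"
    using assms(1) by (simp add: Lebesgue_Measure.integral_restrict_UNIV)
  also have "(\<lambda>x. if x \<in> S then f x else 0) = f" using assms(3) by auto
  finally show ?thesis using assms(2) by (simp add: integral_completion)
qed

definition Cc :: "('a::euclidean_space \<Rightarrow> 'b::euclidean_space) set" where
  "Cc = {f. continuous_on UNIV f \<and> (\<exists>K. compact K \<and> (\<forall>x. x \<notin> K \<longrightarrow> f x = 0))}"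

lemma CcI: "continuous_on UNIV f \<Longrightarrow> compact K \<Longrightarrow> (\<And>x. x \<notin> K \<Longrightarrow> f x = 0) \<Longrightarrow> f \<in> Cc"
  by (auto simp: Cc_def)

lemma CcD:
  assumes "f \<in> Cc"
  obtains K where "continuous_on UNIV f" "compact K" "\<And>x. x \<notin> K \<Longrightarrow> f x = 0"
  using assms by (auto simp: Cc_def)

lemma Cc_measurable: "f \<in> Cc \<Longrightarrow> f \<in> borel_measurable borel"
  by (auto simp: Cc_def intro: borel_measurable_continuous_onI)

lemma Cc_integrable:
  assumes "f \<in> Cc"
  shows "integrable lborel f"
proof -
  obtain K where K: "continuous_on UNIV f" "compact K" "\<And>x. x \<notin> K \<Longrightarrow> f x = 0" using CcD[OF assms] by blast
  have "integrable lborel (\<lambda>x. indicator K x *\<^sub>R f x)"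
    using K(2) continuous_on_subset[OF K(1)] by (intro borel_integrable_compact) auto
  also have "(\<lambda>x. indicator K x *\<^sub>R f x) = f" using K(3) by (auto simp: indicator_def fun_eq_iff)
  finally show ?thesis .
qed

lemma Cc_bounded:
  assumes "f \<in> Cc"
  obtains M where "0 \<le> M" "\<And>x. norm (f x) \<le> M"
proof -
  obtain K where K: "continuous_on UNIV f" "compact K" "\<And>x. x \<notin> K \<Longrightarrow> f x = 0" using CcD[OF assms] by blast
  have "compact (f ` K)" using K by (intro compact_continuous_image) (auto intro: continuous_on_subset)
  then obtain M where M: "\<And>x. x \<in> K \<Longrightarrow> norm (f x) \<le> M"
    by (meson bounded_iff compact_imp_bounded imageI)
  show ?thesis
    by (rule that[of "max 0 M"]) (use K(3) M in \<open>fastforce simp: le_max_iff_disj\<close>)+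
qed

section \<open>Continuously differentiable functions\<close>

lemma C1_onI:
  assumes "open U" "\<And>x. x \<in> U \<Longrightarrow> (f has_derivative f' x) (at x)"
    and "\<And>v. continuous_on U (\<lambda>x. f' x v)"
  shows "C1_on U f"
proof -
  have "frechet_derivative f (at x) = f' x" if "x \<in> U" for x
    using frechet_derivative_at[OF assms(2)[OF that]] by simp
  then have "continuous_on U (\<lambda>x. frechet_derivative f (at x) v)" for v
    using assms(3)[of v] by (simp cong: continuous_on_cong)
  then show ?thesis using assms(2) by (auto simp: C1_on_def differentiable_def)
qed

lemma C1_on_UNIV:
  assumes "C1_on UNIV f"
  shows "(f has_derivative frechet_derivative f (at x)) (at x)"
    and "continuous_on UNIV (\<lambda>x. frechet_derivative f (at x) v)"
    and "continuous_on UNIV f"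
proof -
  have diff: "f differentiable at x" for x using assms by (simp add: C1_on_def)
  then show "(f has_derivative frechet_derivative f (at x)) (at x)"
    by (simp add: frechet_derivative_works[symmetric])
  show "continuous_on UNIV (\<lambda>x. frechet_derivative f (at x) v)"
    using assms by (simp add: C1_on_def)
  show "continuous_on UNIV f"
    using diff by (intro differentiable_imp_continuous_on) (simp add: differentiable_on_def)
qed

lemma C1_on_scaleR:
  fixes f :: "'a::real_normed_vector \<Rightarrow> real" and g :: "'a \<Rightarrow> 'b::real_normed_vector"
  assumes f: "C1_on UNIV f" and g: "C1_on UNIV g"
  shows "C1_on UNIV (\<lambda>x. f x *\<^sub>R g x)"
proof (rule C1_onI)
  show "((\<lambda>x. f x *\<^sub>R g x) has_derivative
      (\<lambda>v. f x *\<^sub>R frechet_derivative g (at x) v + frechet_derivative f (at x) v *\<^sub>R g x)) (at x)" for x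
    by (intro has_derivative_scaleR C1_on_UNIV assms)
  show "continuous_on UNIV (\<lambda>x. f x *\<^sub>R frechet_derivative g (at x) v
      + frechet_derivative f (at x) v *\<^sub>R g x)" for v
    by (intro continuous_intros C1_on_UNIV assms)
qed simp

lemma C1_on_compose_real:
  fixes f :: "'a::real_normed_vector \<Rightarrow> real" and h h' :: "real \<Rightarrow> real"
  assumes f: "C1_on UNIV f" and h: "\<And>t. (h has_real_derivative h' t) (at t)" "continuous_on UNIV h'"
  shows "C1_on UNIV (\<lambda>x. h (f x))"
proof (rule C1_onI)
  show "((\<lambda>x. h (f x)) has_derivative (\<lambda>v. h' (f x) * frechet_derivative f (at x) v)) (at x)" for x
    using has_derivative_compose[OF C1_on_UNIV(1)[OF f] h(1)[unfolded has_field_derivative_def]] by simp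
  show "continuous_on UNIV (\<lambda>x. h' (f x) * frechet_derivative f (at x) v)" for v
    by (intro continuous_intros C1_on_UNIV f continuous_on_compose2[OF h(2)]) auto
qed simp

lemma C1_on_prod:
  fixes f :: "'i \<Rightarrow> 'a::real_normed_vector \<Rightarrow> real"
  assumes "finite I" "\<And>i. i \<in> I \<Longrightarrow> C1_on UNIV (f i)"
  shows "C1_on UNIV (\<lambda>x. \<Prod>i\<in>I. f i x)"
  using assms
proof (induction I rule: finite_induct)
  case empty
  show ?case by (rule C1_onI[where f'="\<lambda>_ _. 0"]) auto
next
  case (insert i I)
  then have "C1_on UNIV (\<lambda>x. f i x *\<^sub>R (\<Prod>i\<in>I. f i x))"
    by (intro C1_on_scaleR) auto
  then show ?case using insert by simp
qed

definition grad :: "(real ^ 'n \<Rightarrow> 'b::euclidean_space) \<Rightarrow> real ^ 'n \<Rightarrow> 'b ^ 'n" where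
  "grad \<phi> x = (\<chi> i. frechet_derivative \<phi> (at x) (axis i 1))"

lemma grad_nth: "grad \<phi> x $ i = frechet_derivative \<phi> (at x) (axis i 1)"
  by (simp add: grad_def)

lemma continuous_on_grad: "C1_on UNIV \<phi> \<Longrightarrow> continuous_on UNIV (grad \<phi>)"
  unfolding grad_def[abs_def] by (intro continuous_intros C1_on_UNIV)

text \<open>Cauchy-Schwarz over the coordinate directions; the norm of the gradient is the \<open>\<ell>\<^sup>2\<close> norm of
  the partial derivatives.\<close>

lemma norm_frechet_derivative_le_grad:
  fixes \<phi> :: "real ^ 'n \<Rightarrow> 'b::euclidean_space"
  assumes "C1_on UNIV \<phi>"
  shows "norm (frechet_derivative \<phi> (at x) y) \<le> norm y * norm (grad \<phi> x)"
proof -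
  interpret D: bounded_linear "frechet_derivative \<phi> (at x)"
    using C1_on_UNIV(1)[OF assms] by (rule has_derivative_bounded_linear)
  have "y = (\<Sum>i\<in>UNIV. y $ i *\<^sub>R axis i 1)"
    using basis_expansion[of y] by (simp add: scalar_mult_eq_scaleR)
  then have "frechet_derivative \<phi> (at x) y = frechet_derivative \<phi> (at x) (\<Sum>i\<in>UNIV. y $ i *\<^sub>R axis i 1)"
    by (rule arg_cong)
  also have "\<dots> = (\<Sum>i\<in>UNIV. y $ i *\<^sub>R grad \<phi> x $ i)"
    by (simp only: D.sum D.scaleR grad_nth)
  also have "norm \<dots> \<le> (\<Sum>i\<in>UNIV. \<bar>y $ i\<bar> * norm (grad \<phi> x $ i))"
    by (rule order_trans[OF norm_sum]) simp
  also have "\<dots> \<le> norm y * norm (grad \<phi> x)"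
    using L2_set_mult_ineq[of "\<lambda>i. y $ i" "\<lambda>i. norm (grad \<phi> x $ i)" UNIV]
    by (simp add: norm_vec_def L2_set_def)
  finally show ?thesis .
qed

lemma C1_compactD:
  fixes \<phi> :: "real ^ 'n \<Rightarrow> 'b::euclidean_space"
  assumes "\<phi> \<in> C1_compact \<Omega>"
  obtains K where "C1_on UNIV \<phi>" "compact K" "K \<subseteq> \<Omega>" "\<And>x. x \<notin> K \<Longrightarrow> \<phi> x = 0"
    "\<And>x. x \<notin> K \<Longrightarrow> frechet_derivative \<phi> (at x) = (\<lambda>_. 0)" "\<And>x. x \<notin> K \<Longrightarrow> grad \<phi> x = 0"
proof -
  from assms obtain K where K: "C1_on UNIV \<phi>" "compact K" "K \<subseteq> \<Omega>" "\<And>x. x \<notin> K \<Longrightarrow> \<phi> x = 0"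
    unfolding C1_compact_def by blast
  have D: "frechet_derivative \<phi> (at x) = (\<lambda>_. 0)" if "x \<notin> K" for x
  proof -
    have o: "open (- K)" by (rule open_Compl[OF compact_imp_closed[OF K(2)]])
    have "(\<phi> has_derivative (\<lambda>_. 0)) (at x)"
    proof (rule has_derivative_transform_within_open[OF _ o])
      show "((\<lambda>_. 0) has_derivative (\<lambda>_. 0)) (at x)" by (rule has_derivative_const)
      show "x \<in> - K" using that by simp
      show "0 = \<phi> y" if "y \<in> - K" for y using K(4)[of y] that by simp
    qed
    then show ?thesis using frechet_derivative_at[of \<phi> "\<lambda>_. 0" x] by simp
  qed
  have "grad \<phi> x = 0" if "x \<notin> K" for x
    unfolding grad_def D[OF that] by (simp add: vec_eq_iff)
  with K D show ?thesis by (rule that)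
qed

lemma C1_compact_Cc:
  fixes \<phi> :: "real ^ 'n \<Rightarrow> 'b::euclidean_space"
  assumes "\<phi> \<in> C1_compact \<Omega>"
  shows "\<phi> \<in> Cc" "grad \<phi> \<in> Cc"
proof -
  obtain K where K: "C1_on UNIV \<phi>" "compact K" "\<And>x. x \<notin> K \<Longrightarrow> \<phi> x = 0" "\<And>x. x \<notin> K \<Longrightarrow> grad \<phi> x = 0"
    using C1_compactD[OF assms] by metis
  show "\<phi> \<in> Cc" by (rule CcI[OF C1_on_UNIV(3)[OF K(1)] K(2,3)])
  show "grad \<phi> \<in> Cc" by (rule CcI[OF continuous_on_grad[OF K(1)] K(2,4)])
qed

lemma C1_compact_scaleR:
  fixes g :: "real ^ 'n \<Rightarrow> 'b::euclidean_space"
  assumes "f \<in> C1_compact \<Omega>" "g \<in> C1_compact \<Omega>"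
  shows "(\<lambda>x. f x *\<^sub>R g x) \<in> C1_compact \<Omega>"
proof -
  obtain K where K: "C1_on UNIV f" "compact K" "K \<subseteq> \<Omega>" "\<And>x. x \<notin> K \<Longrightarrow> f x = 0"
    using C1_compactD[OF assms(1)] by metis
  have "C1_on UNIV g" using assms(2) by (simp add: C1_compact_def)
  then have "C1_on UNIV (\<lambda>x. f x *\<^sub>R g x)" by (rule C1_on_scaleR[OF K(1)])
  with K show ?thesis unfolding C1_compact_def by (auto intro!: exI[of _ K])
qed

lemma C1_compact_diff:
  fixes f g :: "real ^ 'n \<Rightarrow> 'b::euclidean_space"
  assumes "f \<in> C1_compact \<Omega>" "g \<in> C1_compact \<Omega>"
  shows "(\<lambda>x. f x - g x) \<in> C1_compact \<Omega>"
proof -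
  obtain K where K: "C1_on UNIV f" "compact K" "K \<subseteq> \<Omega>" "\<And>x. x \<notin> K \<Longrightarrow> f x = 0"
    using C1_compactD[OF assms(1)] by metis
  obtain L where L: "C1_on UNIV g" "compact L" "L \<subseteq> \<Omega>" "\<And>x. x \<notin> L \<Longrightarrow> g x = 0"
    using C1_compactD[OF assms(2)] by metis
  have "C1_on UNIV (\<lambda>x. f x - g x)"
  proof (rule C1_onI)
    show "((\<lambda>x. f x - g x) has_derivative
        (\<lambda>v. frechet_derivative f (at x) v - frechet_derivative g (at x) v)) (at x)" for x
      by (intro has_derivative_diff C1_on_UNIV K L)
    show "continuous_on UNIV (\<lambda>x. frechet_derivative f (at x) v - frechet_derivative g (at x) v)" for v
      by (intro continuous_intros C1_on_UNIV K L)
  qed simp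
  moreover have "compact (K \<union> L)" using K L by auto
  moreover have "K \<union> L \<subseteq> \<Omega>" "\<forall>x. x \<notin> K \<union> L \<longrightarrow> f x - g x = 0" using K L by auto
  ultimately show ?thesis unfolding C1_compact_def by blast
qed

text \<open>The definition of the derivative, restricted to the line in direction \<open>e\<close>.\<close>

lemma directional_derivative_limit:
  fixes \<phi> :: "'a::real_normed_vector \<Rightarrow> 'b::real_normed_vector"
  assumes "(\<phi> has_derivative D) (at x)"
  shows "((\<lambda>t. (\<phi> (x + t *\<^sub>R e) - \<phi> x) /\<^sub>R t) \<longlongrightarrow> D e) (at 0)"
proof -
  interpret D: bounded_linear D using assms by (rule has_derivative_bounded_linear)
  have "((\<lambda>t. \<phi> (x + t *\<^sub>R e)) has_derivative (\<lambda>t. D (t *\<^sub>R e))) (at 0)"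
    by (rule has_derivative_compose[of "\<lambda>t. x + t *\<^sub>R e"])
      (use assms in \<open>auto intro!: derivative_eq_intros\<close>)
  then have "((\<lambda>t. norm (\<phi> (x + t *\<^sub>R e) - \<phi> x - t *\<^sub>R D e) / norm t) \<longlongrightarrow> 0) (at 0)"
    by (simp add: has_derivative_at D.scaleR)
  moreover have "norm (\<phi> (x + t *\<^sub>R e) - \<phi> x - t *\<^sub>R D e) / norm t
      = norm ((\<phi> (x + t *\<^sub>R e) - \<phi> x) /\<^sub>R t - D e)" if "t \<noteq> 0" for t
  proof -
    have "(\<phi> (x + t *\<^sub>R e) - \<phi> x) /\<^sub>R t - D e = (\<phi> (x + t *\<^sub>R e) - \<phi> x - t *\<^sub>R D e) /\<^sub>R t"
      using that by (simp add: scaleR_diff_right)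
    then show ?thesis by (simp add: divide_inverse mult.commute)
  qed
  ultimately have "((\<lambda>t. norm ((\<phi> (x + t *\<^sub>R e) - \<phi> x) /\<^sub>R t - D e)) \<longlongrightarrow> 0) (at 0)"
    by (elim Lim_transform_eventually) (auto simp: eventually_at_filter)
  then show ?thesis by (simp add: tendsto_norm_zero_iff LIM_zero_iff)
qed

lemma lborel_translation:
  fixes f :: "'a::euclidean_space \<Rightarrow> 'b::euclidean_space"
  assumes "integrable lborel f"
  shows "integrable lborel (\<lambda>x. f (a + x))" and "(\<integral>x. f (a + x) \<partial>lborel) = (\<integral>x. f x \<partial>lborel)"
proof -
  have [measurable]: "f \<in> borel_measurable borel" using assms by auto
  have *: "distr lborel borel (\<lambda>x. a + x) = (lborel :: 'a measure)" by (rule lborel_distr_plus)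
  have "integrable (distr lborel borel (\<lambda>x. a + x)) f" using assms unfolding * .
  then show "integrable lborel (\<lambda>x. f (a + x))" by (simp add: integrable_distr_eq)
  have "(\<integral>x. f (a + x) \<partial>lborel) = (\<integral>x. f x \<partial>distr lborel borel (\<lambda>x. a + x))"
    by (rule integral_distr[symmetric]) auto
  then show "(\<integral>x. f (a + x) \<partial>lborel) = (\<integral>x. f x \<partial>lborel)" unfolding * .
qed

text \<open>The integral of a difference quotient of \<open>\<phi>\<close> vanishes by translation invariance, and the
  difference quotients converge to the derivative, dominated because \<open>\<phi>\<close> is Lipschitz with
  compact support.\<close>

lemma integral_frechet_derivative_eq_0:
  fixes \<phi> :: "real ^ 'n \<Rightarrow> 'b::euclidean_space"
  assumes "\<phi> \<in> C1_compact UNIV"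
  shows "(\<integral>x. frechet_derivative \<phi> (at x) e \<partial>lborel) = 0"
proof -
  obtain K where C1: "C1_on UNIV \<phi>" and K: "compact K" "\<And>x. x \<notin> K \<Longrightarrow> \<phi> x = 0"
    using C1_compactD[OF assms] by metis
  have [measurable]: "\<phi> \<in> borel_measurable borel" by (rule Cc_measurable[OF C1_compact_Cc(1)[OF assms]])
  have [measurable]: "(\<lambda>x. frechet_derivative \<phi> (at x) e) \<in> borel_measurable borel"
    using C1_on_UNIV(2)[OF C1] by (rule borel_measurable_continuous_onI)
  have int: "integrable lborel \<phi>" by (rule Cc_integrable[OF C1_compact_Cc(1)[OF assms]])
  obtain M where M: "0 \<le> M" "\<And>x. norm (grad \<phi> x) \<le> M"
    using Cc_bounded[OF C1_compact_Cc(2)[OF assms]] by blast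
  obtain R where R: "K \<subseteq> ball 0 R" "0 < R"
    using bounded_subset_ballD[OF compact_imp_bounded[OF K(1)]] by blast
  define h where "h = (\<lambda>n. 1 / real (Suc n))"
  have h0: "0 < h n" "h n \<le> 1" for n by (auto simp: h_def)
  have h_ne: "h n \<noteq> 0" for n using h0(1)[of n] by simp
  have h_lim: "h \<longlonglongrightarrow> 0" unfolding h_def by (rule LIMSEQ_Suc[OF lim_1_over_n])
  define q where "q = (\<lambda>n x. (1 / h n) *\<^sub>R (\<phi> (x + h n *\<^sub>R e) - \<phi> x))"
  have on: "onorm (frechet_derivative \<phi> (at x)) \<le> M" for x
  proof (rule onorm_le)
    fix y
    have "norm (frechet_derivative \<phi> (at x) y) \<le> norm y * norm (grad \<phi> x)"
      by (rule norm_frechet_derivative_le_grad[OF C1])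
    also have "\<dots> \<le> norm y * M" by (intro mult_left_mono M) auto
    finally show "norm (frechet_derivative \<phi> (at x) y) \<le> M * norm y" by (simp add: mult.commute)
  qed
  have lip: "norm (\<phi> x - \<phi> y) \<le> M * norm (x - y)" for x y
    by (rule differentiable_bound[of UNIV \<phi> "\<lambda>x. frechet_derivative \<phi> (at x)"])
      (use C1_on_UNIV(1)[OF C1] on in auto)
  have q_int: "(\<integral>x. q n x \<partial>lborel) = 0" for n
  proof -
    have *: "integrable lborel (\<lambda>x. \<phi> (x + h n *\<^sub>R e))"
      "(\<integral>x. \<phi> (x + h n *\<^sub>R e) \<partial>lborel) = (\<integral>x. \<phi> x \<partial>lborel)"
      using lborel_translation[OF int, of "h n *\<^sub>R e"] by (simp_all add: add.commute)
    show ?thesis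
      unfolding q_def integral_scaleR_right Bochner_Integration.integral_diff[OF *(1) int] *(2) by simp
  qed
  have "(\<lambda>n. \<integral>x. q n x \<partial>lborel) \<longlonglongrightarrow> (\<integral>x. frechet_derivative \<phi> (at x) e \<partial>lborel)"
  proof (rule integral_dominated_convergence)
    show "integrable lborel (\<lambda>x :: real ^ 'n. indicator (cball 0 (R + norm e)) x *\<^sub>R (norm e * M))"
      using emeasure_bounded_finite[OF bounded_cball[of "0 :: real ^ 'n" "R + norm e"]]
      by (intro integrable_indicator) simp_all
    show "AE x in lborel. (\<lambda>n. q n x) \<longlonglongrightarrow> frechet_derivative \<phi> (at x) e"
    proof (intro AE_I2)
      fix x
      have "((\<lambda>t. (\<phi> (x + t *\<^sub>R e) - \<phi> x) /\<^sub>R t) \<longlongrightarrow> frechet_derivative \<phi> (at x) e) (at 0)"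
        by (rule directional_derivative_limit[OF C1_on_UNIV(1)[OF C1]])
      then have "((\<lambda>n. (\<phi> (x + h n *\<^sub>R e) - \<phi> x) /\<^sub>R h n) \<longlonglongrightarrow> frechet_derivative \<phi> (at x) e)"
        by (rule filterlim_compose) (use h_lim h_ne in \<open>auto simp: filterlim_at\<close>)
      then show "(\<lambda>n. q n x) \<longlonglongrightarrow> frechet_derivative \<phi> (at x) e"
        by (simp add: q_def divide_inverse)
    qed
    show "AE x in lborel. norm (q n x) \<le> indicator (cball 0 (R + norm e)) x *\<^sub>R (norm e * M)" for n
    proof (intro AE_I2)
      fix x
      have "norm (q n x) = norm (\<phi> (x + h n *\<^sub>R e) - \<phi> x) / h n"
        using h0[of n] by (simp add: q_def)
      also have "\<dots> \<le> M * norm (h n *\<^sub>R e) / h n"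
        using lip[of "x + h n *\<^sub>R e" x] h0[of n] by (intro divide_right_mono) auto
      also have "\<dots> = norm e * M" using h0(1)[of n] by simp
      finally have b: "norm (q n x) \<le> norm e * M" .
      have "q n x = 0" if "x \<notin> cball 0 (R + norm e)"
      proof -
        have "norm x > R + norm e" using that by simp
        moreover have "norm (h n *\<^sub>R e) \<le> norm e" using h0[of n] by (simp add: mult_left_le_one_le)
        moreover have "norm x \<le> norm (x + h n *\<^sub>R e) + norm (h n *\<^sub>R e)"
          using norm_triangle_ineq4[of "x + h n *\<^sub>R e" "h n *\<^sub>R e"] by simp
        ultimately have "R \<le> norm x" "R \<le> norm (x + h n *\<^sub>R e)"
          using norm_ge_zero[of e] by linarith+
        then have "x \<notin> K" "x + h n *\<^sub>R e \<notin> K"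
          using R(1) by (auto dest!: subsetD)
        then show ?thesis using K by (simp add: q_def)
      qed
      then show "norm (q n x) \<le> indicator (cball 0 (R + norm e)) x *\<^sub>R (norm e * M)"
        using b by (auto simp: indicator_def)
    qed
  qed (auto simp: q_def)
  then show ?thesis unfolding q_int by (simp add: LIMSEQ_const_iff)
qed

lemma sets_lebesgue_open: "open S \<Longrightarrow> S \<in> sets lebesgue"
  by (simp add: sets_completionI_sets)

text \<open>Integration by parts: the derivative of the product \<open>\<psi> *\<^sub>R \<phi>\<close> has integral zero.\<close>

lemma has_weak_gradient_classical:
  fixes \<phi> :: "real ^ 'n \<Rightarrow> 'b::euclidean_space"
  assumes \<Omega>: "open \<Omega>" and \<phi>: "\<phi> \<in> C1_compact \<Omega>"
  shows "has_weak_gradient \<Omega> \<phi> (grad \<phi>)"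
  unfolding has_weak_gradient_def
proof (intro conjI ballI allI)
  have C1: "C1_on UNIV \<phi>" using \<phi> by (simp add: C1_compact_def)
  have loc: "locally_integrable \<Omega> f" if "continuous_on UNIV f" for f :: "real ^ 'n \<Rightarrow> 'c::euclidean_space"
    unfolding locally_integrable_def
  proof (intro allI impI)
    fix K assume K: "compact K \<and> K \<subseteq> \<Omega>"
    have "set_integrable lebesgue K f"
        using K continuous_on_subset[OF that, of K] unfolding set_integrable_def
      using borel_integrable_compact[of K f] by (subst integrable_completion) auto
    then show "integrable (lebesgue_on K) f"
      using K by (simp add: set_integrable_def integrable_restrict_space sets_completionI_sets borel_compact)
  qed
  show "locally_integrable \<Omega> \<phi>" using loc C1_on_UNIV(3)[OF C1] .
  show "locally_integrable \<Omega> (grad \<phi>)" using loc continuous_on_grad[OF C1] .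
  fix \<psi> :: "real ^ 'n \<Rightarrow> real" and i :: 'n
  assume \<psi>: "\<psi> \<in> C1_compact \<Omega>"
  obtain K where K: "C1_on UNIV \<psi>" "compact K" "K \<subseteq> \<Omega>" "\<And>x. x \<notin> K \<Longrightarrow> \<psi> x = 0"
    "\<And>x. x \<notin> K \<Longrightarrow> frechet_derivative \<psi> (at x) = (\<lambda>_. 0)"
    using C1_compactD[OF \<psi>] by metis
  define D where "D = (\<lambda>x. frechet_derivative \<psi> (at x) (axis i 1) *\<^sub>R \<phi> x)"
  define E where "E = (\<lambda>x. \<psi> x *\<^sub>R (grad \<phi> x $ i))"
  have cont: "continuous_on UNIV D" "continuous_on UNIV E"
    unfolding D_def E_def grad_nth
    by (intro continuous_intros C1_on_UNIV C1 K)+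
  have D0: "D x = 0" "E x = 0" if "x \<notin> K" for x
    using K(4,5)[OF that] by (simp_all add: D_def E_def)
  have int: "integrable lborel D" "integrable lborel E"
    using Cc_integrable[OF CcI[OF cont(1) K(2) D0(1)]] Cc_integrable[OF CcI[OF cont(2) K(2) D0(2)]] by auto
  have on: "(\<integral>x. f x \<partial>lebesgue_on \<Omega>) = (\<integral>x. f x \<partial>lborel)"
    if "continuous_on UNIV f" "\<And>x. x \<notin> K \<Longrightarrow> f x = 0" for f :: "real ^ 'n \<Rightarrow> 'b"
    using that K(3) by (intro integral_lebesgue_on_eq_lborel sets_lebesgue_open \<Omega> borel_measurable_continuous_onI) auto
  have "(\<lambda>x. \<psi> x *\<^sub>R \<phi> x) \<in> C1_compact UNIV"
    using C1_compact_scaleR[OF \<psi> \<phi>] by (auto simp: C1_compact_def)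
  then have "(\<integral>x. frechet_derivative (\<lambda>x. \<psi> x *\<^sub>R \<phi> x) (at x) (axis i 1) \<partial>lborel) = 0"
    by (rule integral_frechet_derivative_eq_0)
  also have "(\<lambda>x. frechet_derivative (\<lambda>x. \<psi> x *\<^sub>R \<phi> x) (at x) (axis i 1)) = (\<lambda>x. E x + D x)"
  proof
    fix x
    have "((\<lambda>x. \<psi> x *\<^sub>R \<phi> x) has_derivative
        (\<lambda>v. \<psi> x *\<^sub>R frechet_derivative \<phi> (at x) v + frechet_derivative \<psi> (at x) v *\<^sub>R \<phi> x)) (at x)"
      by (intro has_derivative_scaleR C1_on_UNIV C1 K)
    from frechet_derivative_at[OF this, symmetric]
    show "frechet_derivative (\<lambda>x. \<psi> x *\<^sub>R \<phi> x) (at x) (axis i 1) = E x + D x"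
      by (simp add: D_def E_def grad_nth)
  qed
  finally have "(\<integral>x. E x \<partial>lborel) + (\<integral>x. D x \<partial>lborel) = 0" using int by simp
  then have "(\<integral>x. D x \<partial>lebesgue_on \<Omega>) = - (\<integral>x. E x \<partial>lebesgue_on \<Omega>)"
    using on[OF cont(1) D0(1)] on[OF cont(2) D0(2)] by (simp add: eq_neg_iff_add_eq_0 add.commute)
  then show "(\<integral>x. frechet_derivative \<psi> (at x) (axis i 1) *\<^sub>R \<phi> x \<partial>lebesgue_on \<Omega>) =
        - (\<integral>x. \<psi> x *\<^sub>R (grad \<phi> x $ i) \<partial>lebesgue_on \<Omega>)"
    by (simp add: D_def E_def)
qed

section \<open>The fundamental lemma of the calculus of variations\<close>

text \<open>The squares make each factor continuously differentiable, and all factors are positive exactly in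
  the open box.\<close>

definition box_bump :: "real ^ 'n \<Rightarrow> real ^ 'n \<Rightarrow> real ^ 'n \<Rightarrow> real" where
  "box_bump a b x = (\<Prod>i\<in>UNIV. (max 0 (x $ i - a $ i))\<^sup>2 * (max 0 (b $ i - x $ i))\<^sup>2)"

text \<open>Squaring the positive part makes it differentiable also at \<open>0\<close>.\<close>

lemma has_real_derivative_max_0_square:
  "((\<lambda>t::real. (max 0 t)\<^sup>2) has_real_derivative 2 * max 0 t) (at t)"
proof -
  consider "t < 0" | "t = 0" | "0 < t" by linarith
  then show ?thesis
  proof cases
    case 1
    have "((\<lambda>t::real. 0) has_real_derivative 0) (at t)" by simp
    then have "((\<lambda>t::real. (max 0 t)\<^sup>2) has_real_derivative 0) (at t)"
      by (rule has_field_derivative_transform_within_open[where S="{..<0}"]) (use 1 in auto)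
    then show ?thesis using 1 by simp
  next
    case 2
    have "((\<lambda>h::real. (max 0 h)\<^sup>2 / h) \<longlongrightarrow> 0) (at 0)"
    proof (rule Lim_null_comparison)
      show "\<forall>\<^sub>F h::real in at 0. norm ((max 0 h)\<^sup>2 / h) \<le> \<bar>h\<bar>"
        by (intro always_eventually allI) (auto simp: max_def power2_eq_square)
      show "((\<lambda>h::real. \<bar>h\<bar>) \<longlongrightarrow> 0) (at 0)" by (intro tendsto_eq_intros) auto
    qed
    then show ?thesis using 2 by (simp add: DERIV_def)
  next
    case 3
    have "((\<lambda>t::real. t\<^sup>2) has_real_derivative 2 * t) (at t)"
      by (auto intro!: derivative_eq_intros)
    then have "((\<lambda>t::real. (max 0 t)\<^sup>2) has_real_derivative 2 * t) (at t)"
      by (rule has_field_derivative_transform_within_open[where S="{0<..}"]) (use 3 in auto)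
    then show ?thesis using 3 by simp
  qed
qed

lemma C1_on_box_bump: "C1_on UNIV (box_bump a b :: real ^ 'n \<Rightarrow> real)"
proof -
  have lin: "C1_on UNIV (\<lambda>x :: real ^ 'n. c * x $ i + d)" for c d :: real and i
    by (rule C1_onI[where f'="\<lambda>_ v. c * v $ i"])
      (auto intro!: derivative_eq_intros bounded_linear.has_derivative[OF bounded_linear_vec_nth])
  have sq: "C1_on UNIV (\<lambda>x :: real ^ 'n. (max 0 (c * x $ i + d))\<^sup>2)" for c d :: real and i
    by (rule C1_on_compose_real[OF lin has_real_derivative_max_0_square]) (intro continuous_intros)
  have "C1_on UNIV (\<lambda>x :: real ^ 'n.
      \<Prod>i\<in>UNIV. (max 0 (1 * x $ i + - a $ i))\<^sup>2 *\<^sub>R (max 0 (-1 * x $ i + b $ i))\<^sup>2)"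
    by (intro C1_on_prod C1_on_scaleR sq) auto
  then show ?thesis unfolding box_bump_def[abs_def] by simp
qed

lemma box_bump_pos: "x \<in> box a b \<Longrightarrow> 0 < box_bump a b x"
  unfolding box_bump_def by (intro prod_pos) (simp add: mem_box_cart less_imp_neq less_imp_neq[symmetric])

lemma box_bump_nonneg: "0 \<le> box_bump a b x"
  unfolding box_bump_def by (intro prod_nonneg) auto

lemma box_bump_eq_0: "x \<notin> box a b \<Longrightarrow> box_bump a b x = 0"
proof -
  assume "x \<notin> box a b"
  then obtain i where "x $ i \<le> a $ i \<or> b $ i \<le> x $ i" by (auto simp: mem_box_cart not_less)
  then have "(max 0 (x $ i - a $ i))\<^sup>2 * (max 0 (b $ i - x $ i))\<^sup>2 = 0" by auto
  then show ?thesis unfolding box_bump_def by (intro prod_zero) auto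
qed

text \<open>The product vanishes outside a compact subset of \<open>\<Omega>\<close>, where \<open>h\<close> is integrable and \<open>\<phi>\<close> bounded.\<close>

lemma locally_integrable_test_integrable:
  fixes h :: "real ^ 'n \<Rightarrow> 'b::euclidean_space"
  assumes \<Omega>: "open \<Omega>" and h: "locally_integrable \<Omega> h" and K: "compact K" "K \<subseteq> \<Omega>"
    and \<phi>: "continuous_on UNIV \<phi>" "\<And>x. x \<notin> K \<Longrightarrow> \<phi> x = 0"
  shows "integrable (lebesgue_on \<Omega>) (\<lambda>x. \<phi> x *\<^sub>R h x)"
proof -
  obtain M where M: "\<And>x. norm (\<phi> x) \<le> M" using Cc_bounded[OF CcI[OF \<phi>(1) K(1) \<phi>(2)]] by blast
  have [measurable]: "\<phi> \<in> borel_measurable borel" using \<phi>(1) by (rule borel_measurable_continuous_onI)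
  have Kl: "K \<in> sets lebesgue" using K(1) by (simp add: sets_completionI_sets borel_compact)
  have "integrable (lebesgue_on K) h" using h K by (simp add: locally_integrable_def)
  then have "integrable lebesgue (\<lambda>x. indicator K x *\<^sub>R h x)"
    using Kl by (simp add: integrable_restrict_space)
  then have hK: "integrable lebesgue (\<lambda>x. M *\<^sub>R (indicator K x *\<^sub>R h x))"
    by (rule integrable_scaleR_right)
  have "integrable lebesgue (\<lambda>x. \<phi> x *\<^sub>R (indicator K x *\<^sub>R h x))"
  proof (rule Bochner_Integration.integrable_bound[OF hK])
    have "(\<lambda>x. indicator K x *\<^sub>R h x) \<in> borel_measurable lebesgue"
      using \<open>integrable lebesgue (\<lambda>x. indicator K x *\<^sub>R h x)\<close> by simp
    moreover have "\<phi> \<in> borel_measurable lebesgue" by (simp add: measurable_completion)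
    ultimately show "(\<lambda>x. \<phi> x *\<^sub>R (indicator K x *\<^sub>R h x)) \<in> borel_measurable lebesgue"
      by - (rule borel_measurable_scaleR)
    show "AE x in lebesgue. norm (\<phi> x *\<^sub>R (indicator K x *\<^sub>R h x)) \<le> norm (M *\<^sub>R (indicator K x *\<^sub>R h x))"
    proof (intro AE_I2)
      fix x
      have "\<bar>\<phi> x\<bar> \<le> \<bar>M\<bar>" using M[of x] by simp
      then show "norm (\<phi> x *\<^sub>R (indicator K x *\<^sub>R h x)) \<le> norm (M *\<^sub>R (indicator K x *\<^sub>R h x))"
        unfolding norm_scaleR by (intro mult_right_mono) auto
    qed
  qed
  also have "(\<lambda>x. \<phi> x *\<^sub>R (indicator K x *\<^sub>R h x)) = (\<lambda>x. indicator \<Omega> x *\<^sub>R (\<phi> x *\<^sub>R h x))"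
    using K \<phi>(2) by (auto simp: fun_eq_iff indicator_def)
  finally show ?thesis using sets_lebesgue_open[OF \<Omega>] by (simp add: integrable_restrict_space)
qed

text \<open>Boxes generate the Borel sets and are stable under intersection, so the integral vanishes over
  every Borel set.\<close>

lemma box_integral_0_imp_AE_0:
  fixes h :: "'a::euclidean_space \<Rightarrow> 'b::euclidean_space"
  assumes h: "integrable lborel h" and 0: "\<And>a b. (\<integral>x\<in>box a b. h x \<partial>lborel) = 0"
    and total: "(\<integral>x. h x \<partial>lborel) = 0"
  shows "AE x in lborel. h x = 0"
proof (rule sigma_finite_measure.density_zero[OF sigma_finite_lborel h])
  fix A :: "'a set" assume "A \<in> sets lborel"
  then have A: "A \<in> sigma_sets UNIV (range (\<lambda>(a, b). box a b))"
    by (simp add: borel_eq_box)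
  have "Int_stable (range (\<lambda>(a, b). box a b :: 'a set))"
    by (auto simp: Int_stable_def box_Int_box)
  moreover have "range (\<lambda>(a, b). box a b :: 'a set) \<subseteq> Pow UNIV" by simp
  ultimately show "(\<integral>x\<in>A. h x \<partial>lborel) = 0" using A
  proof (induction rule: sigma_sets_induct_disjoint)
    case (basic A)
    then show ?case using 0 by auto
  next
    case empty
    show ?case by (simp add: set_lebesgue_integral_def)
  next
    case (compl A)
    then have A: "A \<in> sets lborel" by (simp add: borel_eq_box)
    have "set_integrable lborel B h" if "B \<in> sets lborel" for B
      unfolding set_integrable_def using that h by (rule integrable_mult_indicator)
    then have "(\<integral>x\<in>A \<union> (UNIV - A). h x \<partial>lborel) = (\<integral>x\<in>A. h x \<partial>lborel) + (\<integral>x\<in>UNIV - A. h x \<partial>lborel)"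
      using A by (intro set_integral_Un) auto
    then show ?case using compl total by (simp add: set_lebesgue_integral_def)
  next
    case (union A)
    then have A: "A i \<in> sets lborel" for i by (auto simp: borel_eq_box)
    have "(\<integral>x\<in>(\<Union>i. A i). h x \<partial>lborel) = (\<Sum>i. (\<integral>x\<in>A i. h x \<partial>lborel))"
      using A union h by (intro lebesgue_integral_countable_add)
        (auto simp: disjoint_family_on_def set_integrable_def intro!: integrable_mult_indicator)
    then show ?case using union by simp
  qed
qed

text \<open>The functions \<open>1 - exp (- k \<beta>)\<close>, with a \<open>C1\<close> function \<open>\<beta>\<close> that is positive exactly on an open
  box, increase to the indicator function of the box. Hence \<open>h\<close> has integral zero over every box,
  and boxes determine a density.\<close>

lemma fundamental_lemma_calculus_of_variations:
  fixes h :: "real ^ 'n \<Rightarrow> 'b::euclidean_space"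
  assumes \<Omega>: "open \<Omega>" and h: "locally_integrable \<Omega> h"
    and 0: "\<And>\<phi>. \<phi> \<in> C1_compact \<Omega> \<Longrightarrow> (\<integral>x. \<phi> x *\<^sub>R h x \<partial>lebesgue_on \<Omega>) = 0"
  shows "AE x in lebesgue_on \<Omega>. h x = 0"
proof -
  have cbox0: "AE x in lebesgue. x \<in> cbox a b \<longrightarrow> h x = 0" if sub: "cbox a b \<subseteq> \<Omega>" for a b
  proof -
    define H where "H = (\<lambda>x. indicator (cbox a b) x *\<^sub>R h x)"
    have "integrable (lebesgue_on (cbox a b)) h" using h sub by (simp add: locally_integrable_def)
    then have H: "integrable lebesgue H" by (simp add: H_def integrable_restrict_space)
    obtain g where gm[measurable]: "g \<in> borel_measurable borel" and gH: "AE x in lborel. H x = g x"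
      using lebesgue_borel_version[of H] H by auto
    have "integrable lebesgue g"
      using H gm gH by (subst integrable_cong_AE[of g _ H]) (auto simp: measurable_completion AE_completion_iff)
    then have g: "integrable lborel g" by (simp add: integrable_completion)
    have box0: "(\<integral>x. indicator (box c d) x *\<^sub>R g x \<partial>lborel) = 0" if cd: "box c d \<subseteq> cbox a b" for c d
    proof -
      define \<phi> where "\<phi> = (\<lambda>(k::nat) x. 1 - exp (- real k * box_bump c d x))"
      have \<phi>_C1: "C1_on UNIV (\<phi> k)" for k
        unfolding \<phi>_def
        by (rule C1_on_compose_real[OF C1_on_box_bump, where h'="\<lambda>t. real k * exp (- real k * t)"])
          (auto intro!: derivative_eq_intros continuous_intros)
      have \<phi>_0: "\<phi> k x = 0" if "x \<notin> box c d" for k x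
        using box_bump_eq_0[OF that] by (simp add: \<phi>_def)
      have \<phi>_in: "\<phi> k \<in> C1_compact \<Omega>" for k
        unfolding C1_compact_def using \<phi>_C1[of k] \<phi>_0 sub cd by (auto intro!: exI[of _ "cbox a b"])
      have [measurable]: "\<phi> k \<in> borel_measurable borel" for k
        by (rule Cc_measurable[OF C1_compact_Cc(1)[OF \<phi>_in]])
      have zero: "(\<integral>x. \<phi> k x *\<^sub>R g x \<partial>lborel) = 0" for k
      proof -
        have "(\<integral>x. \<phi> k x *\<^sub>R g x \<partial>lborel) = (\<integral>x. \<phi> k x *\<^sub>R g x \<partial>lebesgue)"
          by (subst integral_completion) auto
        also have "\<dots> = (\<integral>x. \<phi> k x *\<^sub>R H x \<partial>lebesgue)"
        proof (rule integral_cong_AE)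
          show eq: "AE x in lebesgue. \<phi> k x *\<^sub>R g x = \<phi> k x *\<^sub>R H x"
            using AE_completion[OF gH] by eventually_elim simp
          show m: "(\<lambda>x. \<phi> k x *\<^sub>R g x) \<in> borel_measurable lebesgue" by (rule measurable_completion) measurable
          show "(\<lambda>x. \<phi> k x *\<^sub>R H x) \<in> borel_measurable lebesgue" by (rule borel_measurable_AE[OF m eq])
        qed
        also have "(\<lambda>x. \<phi> k x *\<^sub>R H x) = (\<lambda>x. indicator \<Omega> x *\<^sub>R (\<phi> k x *\<^sub>R h x))"
          using sub cd \<phi>_0[of _ k] by (fastforce simp: H_def indicator_def fun_eq_iff)
        also have "(\<integral>x. indicator \<Omega> x *\<^sub>R (\<phi> k x *\<^sub>R h x) \<partial>lebesgue) = (\<integral>x. \<phi> k x *\<^sub>R h x \<partial>lebesgue_on \<Omega>)"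
          using sets_lebesgue_open[OF \<Omega>] by (subst integral_restrict_space) auto
        finally show ?thesis using 0[OF \<phi>_in] by simp
      qed
      have "(\<lambda>k. \<integral>x. \<phi> k x *\<^sub>R g x \<partial>lborel) \<longlonglongrightarrow> (\<integral>x. indicator (box c d) x *\<^sub>R g x \<partial>lborel)"
      proof (rule integral_dominated_convergence[where w="\<lambda>x. norm (g x)"])
        show "AE x in lborel. (\<lambda>k. \<phi> k x *\<^sub>R g x) \<longlonglongrightarrow> indicator (box c d) x *\<^sub>R g x"
        proof (intro AE_I2 tendsto_scaleR tendsto_const)
          fix x
          show "(\<lambda>k. \<phi> k x) \<longlonglongrightarrow> indicator (box c d) x"
          proof (cases "x \<in> box c d")
            case True
            define r where "r = exp (- box_bump c d x)"
            have "(\<lambda>k. r ^ k) \<longlonglongrightarrow> 0"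
              using box_bump_pos[OF True] by (intro LIMSEQ_realpow_zero) (simp_all add: r_def)
            then have "(\<lambda>k. 1 - r ^ k) \<longlonglongrightarrow> 1 - 0" by (intro tendsto_diff tendsto_const)
            moreover have "\<phi> k x = 1 - r ^ k" for k by (simp add: \<phi>_def r_def exp_of_nat_mult[symmetric])
            ultimately show ?thesis using True by simp
          qed (simp add: \<phi>_0)
        qed
        show "AE x in lborel. norm (\<phi> k x *\<^sub>R g x) \<le> norm (g x)" for k
        proof (intro AE_I2)
          fix x
          have "\<bar>\<phi> k x\<bar> \<le> 1" using box_bump_nonneg[of c d x] by (simp add: \<phi>_def)
          then show "norm (\<phi> k x *\<^sub>R g x) \<le> norm (g x)" by (simp add: mult_left_le_one_le)
        qed
      qed (use g in auto)
      then show ?thesis unfolding zero by (simp add: LIMSEQ_const_iff)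
    qed
    have "AE x in lborel. indicator (box a b) x *\<^sub>R g x = 0"
    proof (rule box_integral_0_imp_AE_0)
      show "integrable lborel (\<lambda>x. indicator (box a b) x *\<^sub>R g x)" using g by (intro integrable_mult_indicator) auto
      show "(\<integral>x. indicator (box a b) x *\<^sub>R g x \<partial>lborel) = 0" by (rule box0[OF box_subset_cbox])
      fix c d
      obtain c' d' where cd: "box c d \<inter> box a b = box c' d'" by (auto simp: box_Int_box)
      then have "box c' d' \<subseteq> cbox a b" using box_subset_cbox[of a b] by blast
      moreover have "(\<lambda>x. indicator (box c d) x *\<^sub>R indicator (box a b) x *\<^sub>R g x) = (\<lambda>x. indicator (box c' d') x *\<^sub>R g x)"
        unfolding cd[symmetric] by (auto simp: indicator_def fun_eq_iff)
      ultimately show "(\<integral>x\<in>box c d. (indicator (box a b) x *\<^sub>R g x) \<partial>lborel) = 0"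
        unfolding set_lebesgue_integral_def by (simp only: box0)
    qed
    with gH have "AE x in lborel. x \<in> box a b \<longrightarrow> h x = 0"
      by eventually_elim (use box_subset_cbox[of a b] in \<open>auto simp: H_def\<close>)
    then have "AE x in lebesgue. x \<in> box a b \<longrightarrow> h x = 0" by (rule AE_completion)
    \<comment> \<open>\<open>\<Omega>\<close> is a countable union of closed boxes, so the boundary of each box has to be included.\<close>
    moreover have "AE x in lebesgue. x \<notin> cbox a b - box a b"
      using negligible_frontier_interval[of a b] by (intro AE_not_in) (simp add: negligible_iff_null_sets)
    ultimately show ?thesis by eventually_elim auto
  qed
  obtain D where D: "countable D" "D \<subseteq> Pow \<Omega>" "\<And>C. C \<in> D \<Longrightarrow> \<exists>a b. C = cbox a b" "\<Union>D = \<Omega>"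
    using open_countable_Union_open_cbox[OF \<Omega>] by blast
  have "AE x in lebesgue. \<forall>C\<in>D. x \<in> C \<longrightarrow> h x = 0"
  proof (subst AE_ball_countable[OF D(1)], intro ballI)
    fix C assume "C \<in> D"
    then obtain a b where "C = cbox a b" "cbox a b \<subseteq> \<Omega>" using D(2,3) by blast
    then show "AE x in lebesgue. x \<in> C \<longrightarrow> h x = 0" using cbox0 by simp
  qed
  then have "AE x in lebesgue. x \<in> \<Omega> \<longrightarrow> h x = 0"
    by eventually_elim (use D(4) in blast)
  then show ?thesis using sets_lebesgue_open[OF \<Omega>] by (simp add: AE_restrict_space_iff)
qed

section \<open>Weak gradients\<close>

lemma locally_integrable_nth:
  fixes G :: "real ^ 'n \<Rightarrow> 'b::euclidean_space ^ 'n"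
  assumes "locally_integrable \<Omega> G"
  shows "locally_integrable \<Omega> (\<lambda>x. G x $ i)"
  using assms integrable_bounded_linear[OF bounded_linear_vec_nth]
  unfolding locally_integrable_def by blast

text \<open>The difference of two weak gradients is orthogonal to all test functions.\<close>

lemma weak_gradient_unique:
  fixes v :: "real ^ 'n \<Rightarrow> 'b::euclidean_space"
  assumes \<Omega>: "open \<Omega>" and G1: "has_weak_gradient \<Omega> v G1" and G2: "has_weak_gradient \<Omega> v G2"
  shows "AE x in lebesgue_on \<Omega>. G1 x = G2 x"
proof -
  let ?M = "lebesgue_on \<Omega>"
  have comp: "locally_integrable \<Omega> (\<lambda>x. G1 x $ i)" "locally_integrable \<Omega> (\<lambda>x. G2 x $ i)" for i
    using G1 G2 by (auto simp: has_weak_gradient_def intro: locally_integrable_nth)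
  have "AE x in ?M. G1 x $ i - G2 x $ i = 0" for i
  proof (rule fundamental_lemma_calculus_of_variations[OF \<Omega>])
    show "locally_integrable \<Omega> (\<lambda>x. G1 x $ i - G2 x $ i)"
      using comp[of i] by (simp add: locally_integrable_def)
    fix \<phi> :: "real ^ 'n \<Rightarrow> real" assume \<phi>: "\<phi> \<in> C1_compact \<Omega>"
    obtain K where K: "C1_on UNIV \<phi>" "compact K" "K \<subseteq> \<Omega>" "\<And>x. x \<notin> K \<Longrightarrow> \<phi> x = 0"
      using C1_compactD[OF \<phi>] by metis
    have int: "integrable ?M (\<lambda>x. \<phi> x *\<^sub>R G1 x $ i)" "integrable ?M (\<lambda>x. \<phi> x *\<^sub>R G2 x $ i)"
      using locally_integrable_test_integrable[OF \<Omega> _ K(2,3) C1_on_UNIV(3)[OF K(1)] K(4)] comp by auto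
    have "- (\<integral>x. \<phi> x *\<^sub>R (G1 x $ i) \<partial>?M) = - (\<integral>x. \<phi> x *\<^sub>R (G2 x $ i) \<partial>?M)"
      using G1[unfolded has_weak_gradient_def, THEN conjunct2, THEN conjunct2, rule_format, OF \<phi>, of i]
        G2[unfolded has_weak_gradient_def, THEN conjunct2, THEN conjunct2, rule_format, OF \<phi>, of i] by (rule trans[OF sym])
    then show "(\<integral>x. \<phi> x *\<^sub>R (G1 x $ i - G2 x $ i) \<partial>?M) = 0"
      using int by (simp add: scaleR_diff_right)
  qed
  then have "AE x in ?M. \<forall>i\<in>UNIV. G1 x $ i - G2 x $ i = 0"
    by (intro AE_finite_allI) auto
  then show ?thesis by eventually_elim (simp add: vec_eq_iff)
qed

lemma has_weak_gradient_diff: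
  fixes u v :: "real ^ 'n \<Rightarrow> 'b::euclidean_space"
  assumes \<Omega>: "open \<Omega>" and G: "has_weak_gradient \<Omega> u G" and H: "has_weak_gradient \<Omega> v H"
  shows "has_weak_gradient \<Omega> (\<lambda>x. u x - v x) (\<lambda>x. G x - H x)"
  unfolding has_weak_gradient_def
proof (intro conjI ballI allI)
  have loc: "locally_integrable \<Omega> u" "locally_integrable \<Omega> v" "locally_integrable \<Omega> G" "locally_integrable \<Omega> H"
    using G H by (auto simp: has_weak_gradient_def)
  then show "locally_integrable \<Omega> (\<lambda>x. u x - v x)" "locally_integrable \<Omega> (\<lambda>x. G x - H x)"
    by (auto simp: locally_integrable_def)
  fix \<phi> :: "real ^ 'n \<Rightarrow> real" and i assume \<phi>: "\<phi> \<in> C1_compact \<Omega>"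
  obtain K where K: "C1_on UNIV \<phi>" "compact K" "K \<subseteq> \<Omega>" "\<And>x. x \<notin> K \<Longrightarrow> \<phi> x = 0"
      "\<And>x. x \<notin> K \<Longrightarrow> frechet_derivative \<phi> (at x) = (\<lambda>_. 0)"
    using C1_compactD[OF \<phi>] by metis
  have intD: "integrable (lebesgue_on \<Omega>) (\<lambda>x. frechet_derivative \<phi> (at x) (axis i 1) *\<^sub>R f x)"
    if "locally_integrable \<Omega> f" for f :: "real ^ 'n \<Rightarrow> 'b"
    by (rule locally_integrable_test_integrable[OF \<Omega> that K(2,3) C1_on_UNIV(2)[OF K(1)]]) (simp add: K(5))
  have int: "integrable (lebesgue_on \<Omega>) (\<lambda>x. \<phi> x *\<^sub>R f x)"
    if "locally_integrable \<Omega> f" for f :: "real ^ 'n \<Rightarrow> 'b"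
    by (rule locally_integrable_test_integrable[OF \<Omega> that K(2,3) C1_on_UNIV(3)[OF K(1)] K(4)])
  have "(\<integral>x. frechet_derivative \<phi> (at x) (axis i 1) *\<^sub>R u x \<partial>lebesgue_on \<Omega>) =
        - (\<integral>x. \<phi> x *\<^sub>R (G x $ i) \<partial>lebesgue_on \<Omega>)"
      "(\<integral>x. frechet_derivative \<phi> (at x) (axis i 1) *\<^sub>R v x \<partial>lebesgue_on \<Omega>) =
        - (\<integral>x. \<phi> x *\<^sub>R (H x $ i) \<partial>lebesgue_on \<Omega>)"
    using G H \<phi> by (auto simp: has_weak_gradient_def)
  then show "(\<integral>x. frechet_derivative \<phi> (at x) (axis i 1) *\<^sub>R (u x - v x) \<partial>lebesgue_on \<Omega>) =
        - (\<integral>x. \<phi> x *\<^sub>R ((G x - H x) $ i) \<partial>lebesgue_on \<Omega>)"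
    using intD[OF loc(1)] intD[OF loc(2)] int[OF locally_integrable_nth[OF loc(3)]] int[OF locally_integrable_nth[OF loc(4)]]
    by (simp add: scaleR_diff_right)
qed

lemma has_weak_gradient_AE_cong:
  fixes u v :: "real ^ 'n \<Rightarrow> 'b::euclidean_space"
  assumes \<Omega>: "open \<Omega>" and G: "has_weak_gradient \<Omega> u G" and eq: "AE x in lebesgue_on \<Omega>. u x = v x"
    and m: "u \<in> borel_measurable (lebesgue_on \<Omega>)" "v \<in> borel_measurable (lebesgue_on \<Omega>)"
  shows "has_weak_gradient \<Omega> v G"
  unfolding has_weak_gradient_def
proof (intro conjI ballI allI)
  show "locally_integrable \<Omega> G" using G by (simp add: has_weak_gradient_def)
  show "locally_integrable \<Omega> v" unfolding locally_integrable_def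
  proof (intro allI impI)
    fix K assume K: "compact K \<and> K \<subseteq> \<Omega>"
    then have Kl: "K \<in> sets lebesgue" by (simp add: sets_completionI_sets borel_compact)
    have u: "integrable (lebesgue_on K) u"
      using G K by (simp add: has_weak_gradient_def locally_integrable_def)
    have AE: "AE x in lebesgue_on K. u x = v x"
    proof -
      have "AE x in lebesgue. x \<in> \<Omega> \<longrightarrow> u x = v x"
        using eq sets_lebesgue_open[OF \<Omega>] by (simp add: AE_restrict_space_iff)
      then have "AE x in lebesgue. x \<in> K \<longrightarrow> u x = v x"
        by eventually_elim (use K in auto)
      then show ?thesis using Kl by (simp add: AE_restrict_space_iff)
    qed
    have "v \<in> borel_measurable (lebesgue_on K)"
      using borel_measurable_lebesgue_on_AE[OF Kl _ AE] u by auto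
    with u AE show "integrable (lebesgue_on K) v"
      using integrable_cong_AE[of u "lebesgue_on K" v] by auto
  qed
  fix \<phi> :: "real ^ 'n \<Rightarrow> real" and i assume \<phi>: "\<phi> \<in> C1_compact \<Omega>"
  then have "continuous_on UNIV (\<lambda>x. frechet_derivative \<phi> (at x) (axis i 1))"
    by (intro C1_on_UNIV) (simp add: C1_compact_def)
  then have [measurable]: "(\<lambda>x. frechet_derivative \<phi> (at x) (axis i 1)) \<in> borel_measurable (lebesgue_on \<Omega>)"
    by (intro continuous_imp_measurable_on_sets_lebesgue sets_lebesgue_open \<Omega>) (auto intro: continuous_on_subset)
  note m[measurable]
  have "(\<integral>x. frechet_derivative \<phi> (at x) (axis i 1) *\<^sub>R v x \<partial>lebesgue_on \<Omega>)
      = (\<integral>x. frechet_derivative \<phi> (at x) (axis i 1) *\<^sub>R u x \<partial>lebesgue_on \<Omega>)"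
  proof (rule integral_cong_AE)
    show "AE x in lebesgue_on \<Omega>. frechet_derivative \<phi> (at x) (axis i 1) *\<^sub>R v x
        = frechet_derivative \<phi> (at x) (axis i 1) *\<^sub>R u x"
      using eq by eventually_elim simp
  qed measurable
  then show "(\<integral>x. frechet_derivative \<phi> (at x) (axis i 1) *\<^sub>R v x \<partial>lebesgue_on \<Omega>) =
        - (\<integral>x. \<phi> x *\<^sub>R (G x $ i) \<partial>lebesgue_on \<Omega>)"
    using G \<phi> by (auto simp: has_weak_gradient_def)
qed

section \<open>Sobolev spaces\<close>

text \<open>Functions that agree almost everywhere have the same weak gradients, so \<open>wgrad\<close> even makes the
  same choice for both of them.\<close>

lemma wgrad_cong_AE:
  assumes \<Omega>: "open \<Omega>" and eq: "AE x in lebesgue_on \<Omega>. u x = v x"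
    and m: "u \<in> borel_measurable (lebesgue_on \<Omega>)" "v \<in> borel_measurable (lebesgue_on \<Omega>)"
  shows "wgrad \<Omega> u = wgrad \<Omega> v"
proof -
  have eq': "AE x in lebesgue_on \<Omega>. v x = u x" using eq by eventually_elim simp
  have "has_weak_gradient \<Omega> u = has_weak_gradient \<Omega> v"
    using has_weak_gradient_AE_cong[OF \<Omega> _ eq m] has_weak_gradient_AE_cong[OF \<Omega> _ eq' m(2,1)] by blast
  then show ?thesis by (simp add: wgrad_def)
qed

lemma has_weak_gradient_wgrad:
  assumes "has_weak_gradient \<Omega> v G"
  shows "has_weak_gradient \<Omega> v (wgrad \<Omega> v)"
  unfolding wgrad_def using assms by (rule someI[where P="has_weak_gradient \<Omega> v"])

lemma wgrad_AE_eq: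
  assumes \<Omega>: "open \<Omega>" and G: "has_weak_gradient \<Omega> v G"
  shows "AE x in lebesgue_on \<Omega>. wgrad \<Omega> v x = G x"
  using weak_gradient_unique[OF \<Omega> has_weak_gradient_wgrad[OF G] G] .

lemma wgrad_measurable:
  assumes \<Omega>: "open \<Omega>" and G: "has_weak_gradient \<Omega> v G" "G \<in> borel_measurable (lebesgue_on \<Omega>)"
  shows "wgrad \<Omega> v \<in> borel_measurable (lebesgue_on \<Omega>)"
proof -
  have "AE x in lebesgue_on \<Omega>. G x = wgrad \<Omega> v x"
    using wgrad_AE_eq[OF \<Omega> G(1)] by eventually_elim simp
  from borel_measurable_lebesgue_on_AE[OF sets_lebesgue_open[OF \<Omega>] G(2) this] show ?thesis .
qed

lemma W1D:
  assumes \<Omega>: "open \<Omega>" and s: "exponent s" and v: "v \<in> W1 s \<Omega>"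
  shows "v \<in> Lspace s (lebesgue_on \<Omega>)" "has_weak_gradient \<Omega> v (wgrad \<Omega> v)"
    "wgrad \<Omega> v \<in> Lspace s (lebesgue_on \<Omega>)"
proof -
  from v obtain G where G: "v \<in> Lspace s (lebesgue_on \<Omega>)" "G \<in> Lspace s (lebesgue_on \<Omega>)" "has_weak_gradient \<Omega> v G"
    unfolding W1_def by blast
  show "v \<in> Lspace s (lebesgue_on \<Omega>)" by fact
  show "has_weak_gradient \<Omega> v (wgrad \<Omega> v)" using G(3) by (rule has_weak_gradient_wgrad)
  have "AE x in lebesgue_on \<Omega>. norm (wgrad \<Omega> v x) = norm (G x)"
    using wgrad_AE_eq[OF \<Omega> G(3)] by eventually_elim simp
  then show "wgrad \<Omega> v \<in> Lspace s (lebesgue_on \<Omega>)"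
    by (rule Lspace_AE_cong[OF s G(2) wgrad_measurable[OF \<Omega> G(3) Lspace_measurable[OF G(2)]]])
qed

lemma wgrad_diff:
  assumes \<Omega>: "open \<Omega>" and "has_weak_gradient \<Omega> u G" "has_weak_gradient \<Omega> v H"
  shows "AE x in lebesgue_on \<Omega>. wgrad \<Omega> (\<lambda>x. u x - v x) x = wgrad \<Omega> u x - wgrad \<Omega> v x"
  by (rule wgrad_AE_eq[OF \<Omega> has_weak_gradient_diff[OF \<Omega> assms(2,3)[THEN has_weak_gradient_wgrad]]])

lemma W1_diff:
  assumes \<Omega>: "open \<Omega>" and s: "exponent s" and u: "u \<in> W1 s \<Omega>" and v: "v \<in> W1 s \<Omega>"
  shows "(\<lambda>x. u x - v x) \<in> W1 s \<Omega>"
  using Lspace_diff[OF s W1D(1)[OF \<Omega> s u] W1D(1)[OF \<Omega> s v]]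
    Lspace_diff[OF s W1D(3)[OF \<Omega> s u] W1D(3)[OF \<Omega> s v]]
    has_weak_gradient_diff[OF \<Omega> W1D(2)[OF \<Omega> s u] W1D(2)[OF \<Omega> s v]]
  unfolding W1_def by (intro CollectI conjI bexI)

lemma C1_compact_W1_1:
  fixes \<phi> :: "real ^ 'n \<Rightarrow> 'b::euclidean_space"
  assumes \<Omega>: "open \<Omega>" and \<phi>: "\<phi> \<in> C1_compact \<Omega>"
  shows "\<phi> \<in> W1 1 \<Omega>"
proof -
  have int: "integrable (lebesgue_on \<Omega>) f" if "f \<in> Cc" for f :: "real ^ 'n \<Rightarrow> 'c::euclidean_space"
  proof -
    have "integrable lebesgue f" using Cc_integrable[OF that] by (simp add: integrable_completion)
    from integrable_mult_indicator[OF sets_lebesgue_open[OF \<Omega>] this]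
    show ?thesis using sets_lebesgue_open[OF \<Omega>] by (simp add: integrable_restrict_space)
  qed
  show ?thesis
    using int[OF C1_compact_Cc(1)[OF \<phi>]] int[OF C1_compact_Cc(2)[OF \<phi>]] has_weak_gradient_classical[OF \<Omega> \<phi>]
    unfolding W1_def Lspace_1_iff by (intro CollectI conjI bexI[of _ "grad \<phi>"]) (simp_all add: Lspace_1_iff)
qed

lemma W10_integrable:
  assumes \<Omega>: "open \<Omega>" and "v \<in> W10 s \<Omega>"
  shows "integrable (lebesgue_on \<Omega>) v"
  using W1D(1)[OF \<Omega> exponent_1, of v] assms(2) by (simp add: W10_def zero_trace_def Lspace_1_iff)

text \<open>The differences of the approximating functions approximate the difference; the triangle
  inequality holds for \<open>W1_norm 1 \<Omega>\<close> because \<open>wgrad\<close> is additive almost everywhere.\<close>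

lemma zero_trace_diff:
  fixes u v :: "real ^ 'n \<Rightarrow> 'b::euclidean_space"
  assumes \<Omega>: "open \<Omega>" and u: "zero_trace \<Omega> u" and v: "zero_trace \<Omega> v"
  shows "zero_trace \<Omega> (\<lambda>x. u x - v x)"
proof -
  let ?M = "lebesgue_on \<Omega>"
  from u obtain \<phi> where \<phi>: "u \<in> W1 1 \<Omega>" "\<And>k::nat. \<phi> k \<in> C1_compact \<Omega>"
    "(\<lambda>k. W1_norm 1 \<Omega> (\<lambda>x. u x - \<phi> k x)) \<longlonglongrightarrow> 0" by (auto simp: zero_trace_def)
  from v obtain \<psi> where \<psi>: "v \<in> W1 1 \<Omega>" "\<And>k::nat. \<psi> k \<in> C1_compact \<Omega>"
    "(\<lambda>k. W1_norm 1 \<Omega> (\<lambda>x. v x - \<psi> k x)) \<longlonglongrightarrow> 0" by (auto simp: zero_trace_def)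
  define a where "a = (\<lambda>k x. u x - \<phi> k x)"
  define b where "b = (\<lambda>k x. v x - \<psi> k x)"
  have ab: "a k \<in> W1 1 \<Omega>" "b k \<in> W1 1 \<Omega>" for k
    unfolding a_def b_def by (intro W1_diff \<Omega> exponent_1 \<phi> \<psi> C1_compact_W1_1)+
  have le: "W1_norm 1 \<Omega> (\<lambda>x. a k x - b k x) \<le> W1_norm 1 \<Omega> (a k) + W1_norm 1 \<Omega> (b k)" for k
  proof -
    have tri: "(\<integral>x. norm (f x) \<partial>?M) \<le> (\<integral>x. norm (g x) \<partial>?M) + (\<integral>x. norm (h x) \<partial>?M)"
      if "integrable ?M f" "integrable ?M g" "integrable ?M h"
        "AE x in ?M. f x = g x - h x" for f g h :: "real ^ 'n \<Rightarrow> 'c::euclidean_space"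
    proof -
      have "(\<integral>x. norm (f x) \<partial>?M) \<le> (\<integral>x. norm (g x) + norm (h x) \<partial>?M)"
        using that(1-3)
      proof (intro integral_mono_AE)
        show "AE x in ?M. norm (f x) \<le> norm (g x) + norm (h x)"
          using that(4) by eventually_elim (simp add: norm_triangle_ineq4)
      qed auto
      also have "\<dots> = (\<integral>x. norm (g x) \<partial>?M) + (\<integral>x. norm (h x) \<partial>?M)"
        using that by simp
      finally show ?thesis .
    qed
    note W = W1D[OF \<Omega> exponent_1 ab(1)[of k]] W1D[OF \<Omega> exponent_1 ab(2)[of k]]
      W1D[OF \<Omega> exponent_1 W1_diff[OF \<Omega> exponent_1 ab(1)[of k] ab(2)[of k]]]
    show ?thesis
      unfolding W1_norm_def Lnorm_1
      using tri[of "\<lambda>x. a k x - b k x" "a k" "b k"] tri[OF _ _ _ wgrad_diff[OF \<Omega> W(2) W(5)]]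
        W(1,3,4,6,7,9) unfolding Lspace_1_iff by fastforce
  qed
  have lim: "(\<lambda>k. W1_norm 1 \<Omega> (a k) + W1_norm 1 \<Omega> (b k)) \<longlonglongrightarrow> 0"
    using tendsto_add[OF \<phi>(3) \<psi>(3)] by (simp add: a_def b_def)
  have eq: "(\<lambda>x. (u x - v x) - (\<phi> k x - \<psi> k x)) = (\<lambda>x. a k x - b k x)" for k
    by (auto simp: a_def b_def fun_eq_iff)
  have "(\<lambda>k. W1_norm 1 \<Omega> (\<lambda>x. (u x - v x) - (\<phi> k x - \<psi> k x))) \<longlonglongrightarrow> 0"
    unfolding eq
    by (rule tendsto_sandwich[OF _ _ tendsto_const lim]) (use le in \<open>auto simp: W1_norm_def Lnorm_nonneg\<close>)
  then show ?thesis
    unfolding zero_trace_def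
    using W1_diff[OF \<Omega> exponent_1 \<phi>(1) \<psi>(1)] C1_compact_diff[OF \<phi>(2) \<psi>(2)]
    by (intro conjI exI[of _ "\<lambda>k x. \<phi> k x - \<psi> k x"]) auto
qed

lemma W10_diff:
  assumes \<Omega>: "open \<Omega>" and s: "exponent s" and "u \<in> W10 s \<Omega>" "v \<in> W10 s \<Omega>"
  shows "(\<lambda>x. u x - v x) \<in> W10 s \<Omega>"
  using assms W1_diff[OF \<Omega> s, of u v] zero_trace_diff[OF \<Omega>, of u v] by (simp add: W10_def)

lemma Lspace_zero:
  assumes "exponent s"
  shows "(\<lambda>_. 0 :: 'b::euclidean_space) \<in> Lspace s M" "Lnorm s M (\<lambda>_. 0 :: 'b) = 0"
  using assms unfolding exponent_def
  by (auto simp: Lspace_infinity_iff Lspace_finite_iff Lnorm_finite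
    intro!: antisym Lnorm_infinity_le Lnorm_nonneg exI[of _ 0])

lemma zero_in_W10:
  fixes \<Omega> :: "(real ^ 'n) set"
  assumes \<Omega>: "open \<Omega>" and s: "exponent s"
  shows "(\<lambda>_. 0 :: 'b::euclidean_space) \<in> W10 s \<Omega>" and "W1_norm s \<Omega> (\<lambda>_. 0 :: 'b) = 0"
proof -
  have C: "(\<lambda>_. 0 :: 'b) \<in> C1_compact \<Omega>"
    unfolding C1_compact_def by (auto intro!: exI[of _ "{}"] C1_onI[where f'="\<lambda>_ _. 0"])
  have "grad (\<lambda>_ :: real ^ 'n. 0 :: 'b) = (\<lambda>_. 0)" by (simp add: grad_def fun_eq_iff vec_eq_iff)
  then have w: "has_weak_gradient \<Omega> (\<lambda>_. 0 :: 'b) (\<lambda>_. 0)"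
    using has_weak_gradient_classical[OF \<Omega> C] by simp
  have norm0: "W1_norm s \<Omega> (\<lambda>_. 0 :: 'b) = 0" if s: "exponent s" for s
  proof -
    have "Lnorm s (lebesgue_on \<Omega>) (wgrad \<Omega> (\<lambda>_. 0 :: 'b)) = Lnorm s (lebesgue_on \<Omega>) (\<lambda>_. 0 :: 'b ^ 'n)"
      using wgrad_AE_eq[OF \<Omega> w] by (intro Lnorm_AE_cong wgrad_measurable[OF \<Omega> w]) auto
    then show ?thesis by (simp add: W1_norm_def Lspace_zero(2)[OF s])
  qed
  show "W1_norm s \<Omega> (\<lambda>_. 0 :: 'b) = 0" using norm0[OF s] .
  have "zero_trace \<Omega> (\<lambda>_. 0 :: 'b)"
    unfolding zero_trace_def using C1_compact_W1_1[OF \<Omega> C] C norm0[OF exponent_1]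
    by (auto intro!: exI[of _ "\<lambda>_ _. 0"])
  then show "(\<lambda>_. 0 :: 'b) \<in> W10 s \<Omega>"
    unfolding W10_def W1_def using w Lspace_zero(1)[OF s, where 'b='b] Lspace_zero(1)[OF s, where 'b="'b ^ 'n"] by blast
qed

section \<open>The regularisation error of a Sobolev function\<close>

abbreviation segment_weight :: "(real ^ 'n \<Rightarrow> real) \<Rightarrow> real \<Rightarrow> real ^ 'n \<Rightarrow> real" where
  "segment_weight \<delta> t y \<equiv> indicator {0..1} t * (\<bar>\<delta> y\<bar> * norm y)"

abbreviation kernel_average :: "(real ^ 'n \<Rightarrow> real) \<Rightarrow> (real ^ 'n \<Rightarrow> 'b::euclidean_space) \<Rightarrow> real ^ 'n \<Rightarrow> 'b" where
  "kernel_average \<delta> V x \<equiv> \<integral>y. \<delta> y *\<^sub>R V (x + y) \<partial>lborel"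

abbreviation moment_norm :: "real \<Rightarrow> (real ^ 'n) measure \<Rightarrow> (real ^ 'n \<Rightarrow> real) \<Rightarrow> real" where
  "moment_norm p M \<delta> \<equiv> Lnorm (ennreal p) M (\<lambda>y. \<delta> y *\<^sub>R y)"

text \<open>The integral of \<open>\<bar>\<delta> y\<bar> * norm y * g\<close> along all segments from \<open>x\<close> to \<open>x + y\<close>. With \<open>g\<close> the norm of
  the gradient of \<open>V\<close> it dominates the convolution defect below. It takes values in \<open>ennreal\<close> so that
  no integrability has to be known in advance.\<close>

definition segment_potential :: "(real ^ 'n \<Rightarrow> real) \<Rightarrow> (real ^ 'n \<Rightarrow> real) \<Rightarrow> real ^ 'n \<Rightarrow> ennreal" where
  "segment_potential \<delta> g x =
     (\<integral>\<^sup>+t. (\<integral>\<^sup>+y. ennreal (segment_weight \<delta> t y * g (x + t *\<^sub>R y)) \<partial>lborel) \<partial>lborel)"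

text \<open>This is \<open>\<integral> \<delta> y *\<^sub>R (V x - V (x + y)) dy\<close>, the error of averaging \<open>V\<close> with the kernel \<open>\<delta>\<close>
  apart from the defect \<open>1 - \<integral> \<delta>\<close> of its total mass.\<close>

definition convolution_defect ::
    "(real ^ 'n \<Rightarrow> real) \<Rightarrow> (real ^ 'n \<Rightarrow> 'b::euclidean_space) \<Rightarrow> real ^ 'n \<Rightarrow> 'b" where
  "convolution_defect \<delta> V x = (\<integral>y. \<delta> y \<partial>lborel) *\<^sub>R V x - (kernel_average \<delta> V x)"

text \<open>The fundamental theorem of calculus on the segment from \<open>x\<close> to \<open>x + y\<close>.\<close>

lemma norm_increment_le:
  fixes \<phi> :: "real ^ 'n \<Rightarrow> 'b::euclidean_space"
  assumes C1: "C1_on UNIV \<phi>"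
  shows "ennreal (norm (\<phi> x - \<phi> (x + y)))
    \<le> (\<integral>\<^sup>+t. ennreal (indicator {0..1} t * (norm y * norm (grad \<phi> (x + t *\<^sub>R y)))) \<partial>lborel)"
proof -
  have "((\<lambda>t. frechet_derivative \<phi> (at (x + t *\<^sub>R y)) y) has_integral
      (\<phi> (x + 1 *\<^sub>R y) - \<phi> (x + 0 *\<^sub>R y))) {0..1}"
  proof (rule fundamental_theorem_of_calculus)
    fix t :: real
    interpret D: bounded_linear "frechet_derivative \<phi> (at (x + t *\<^sub>R y))"
      using C1_on_UNIV(1)[OF C1] by (rule has_derivative_bounded_linear)
    have "((\<lambda>t. \<phi> (x + t *\<^sub>R y)) has_derivative (\<lambda>s. frechet_derivative \<phi> (at (x + t *\<^sub>R y)) (s *\<^sub>R y)))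
        (at t within {0..1})"
      by (rule has_derivative_compose[OF _ C1_on_UNIV(1)[OF C1]]) (auto intro!: derivative_eq_intros)
    then show "((\<lambda>t. \<phi> (x + t *\<^sub>R y)) has_vector_derivative frechet_derivative \<phi> (at (x + t *\<^sub>R y)) y)
        (at t within {0..1})"
      by (simp add: has_vector_derivative_def D.scaleR)
  qed simp
  then have 1: "((\<lambda>t. frechet_derivative \<phi> (at (x + t *\<^sub>R y)) y) has_integral (\<phi> (x + y) - \<phi> x)) {0..1}"
    by simp
  have cont: "continuous_on {0..1} (\<lambda>t::real. norm y * norm (grad \<phi> (x + t *\<^sub>R y)))"
    by (intro continuous_intros continuous_on_compose2[OF continuous_on_grad[OF C1]]) auto
  have 2: "((\<lambda>t. norm y * norm (grad \<phi> (x + t *\<^sub>R y))) has_integral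
      integral {0..1} (\<lambda>t. norm y * norm (grad \<phi> (x + t *\<^sub>R y)))) {0..1}"
    using integrable_continuous_interval[OF cont] by (rule integrable_integral)
  have "norm (\<phi> (x + y) - \<phi> x) \<le> integral {0..1} (\<lambda>t. norm y * norm (grad \<phi> (x + t *\<^sub>R y)))"
    using integral_norm_bound_integral[OF has_integral_integrable[OF 1] has_integral_integrable[OF 2]]
      norm_frechet_derivative_le_grad[OF C1] integral_unique[OF 1] by auto
  then have "ennreal (norm (\<phi> x - \<phi> (x + y)))
      \<le> ennreal (integral {0..1} (\<lambda>t. norm y * norm (grad \<phi> (x + t *\<^sub>R y))))"
    by (simp add: norm_minus_commute ennreal_leI)
  also have "\<dots> = (\<integral>\<^sup>+t. ennreal (indicator {0..1} t * (norm y * norm (grad \<phi> (x + t *\<^sub>R y)))) \<partial>lborel)"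
    by (rule nn_integral_has_integral_lebesgue[OF _ 2, symmetric]) simp
  finally show ?thesis .
qed

lemma nn_integral_translation:
  fixes f :: "'a::euclidean_space \<Rightarrow> ennreal"
  assumes "f \<in> borel_measurable borel"
  shows "(\<integral>\<^sup>+x. f (x + a) \<partial>lborel) = (\<integral>\<^sup>+x. f x \<partial>lborel)"
proof -
  have "(\<integral>\<^sup>+x. f (a + x) \<partial>lborel) = (\<integral>\<^sup>+x. f x \<partial>distr lborel borel ((+) a))"
    using assms by (subst nn_integral_distr) auto
  then show ?thesis by (simp add: lborel_distr_plus add.commute)
qed

context
  fixes \<delta> :: "real ^ 'n \<Rightarrow> real"
  assumes \<delta>: "\<delta> \<in> Cc"
begin

lemmas kernel_measurable = Cc_measurable[OF \<delta>] and kernel_integrable = Cc_integrable[OF \<delta>]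

lemma Cc_kernel_mult:
  fixes f :: "real ^ 'n \<Rightarrow> real"
  assumes "continuous_on UNIV f" "\<And>y. \<delta> y = 0 \<Longrightarrow> f y = 0"
  shows "f \<in> Cc"
  using \<delta> assms by (auto simp: Cc_def)

lemma kernel_mult_integrable:
  fixes V :: "real ^ 'n \<Rightarrow> 'b::euclidean_space"
  assumes V: "integrable lborel V"
  shows "integrable lborel (\<lambda>y. \<delta> y *\<^sub>R V (x + y))"
proof -
  obtain M where M: "0 \<le> M" "\<And>y. norm (\<delta> y) \<le> M" using Cc_bounded[OF \<delta>] by blast
  note [measurable] = kernel_measurable
  have [measurable]: "V \<in> borel_measurable borel" using V by auto
  have "integrable lborel (\<lambda>y. M *\<^sub>R V (x + y))"
    using lborel_translation(1)[OF V] by simp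
  then show ?thesis
    by (rule Bochner_Integration.integrable_bound) (use M in \<open>auto intro!: mult_right_mono\<close>)
qed

lemma segment_potential_measurable:
  assumes "g \<in> borel_measurable borel"
  shows "segment_potential \<delta> g \<in> borel_measurable borel"
proof -
  note [measurable] = assms kernel_measurable
  show ?thesis unfolding segment_potential_def[abs_def] by measurable
qed

text \<open>The increments are integrated against \<open>\<bar>\<delta>\<bar>\<close>, and Tonelli's theorem exchanges the kernel
  variable with the segment variable.\<close>

lemma convolution_defect_C1_le:
  fixes \<phi> :: "real ^ 'n \<Rightarrow> 'b::euclidean_space"
  assumes "\<phi> \<in> C1_compact UNIV"
  shows "ennreal (norm (convolution_defect \<delta> \<phi> x)) \<le> segment_potential \<delta> (\<lambda>z. norm (grad \<phi> z)) x"
proof -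
  let ?I = "\<lambda>y. \<integral>\<^sup>+t. ennreal (segment_weight \<delta> t y * norm (grad \<phi> (x + t *\<^sub>R y))) \<partial>lborel"
  have C1: "C1_on UNIV \<phi>" using assms by (simp add: C1_compact_def)
  note [measurable] = kernel_measurable Cc_measurable[OF C1_compact_Cc(1)[OF assms]]
    Cc_measurable[OF C1_compact_Cc(2)[OF assms]]
  have int: "integrable lborel \<phi>" by (rule Cc_integrable[OF C1_compact_Cc(1)[OF assms]])
  have "convolution_defect \<delta> \<phi> x = (\<integral>y. \<delta> y *\<^sub>R (\<phi> x - \<phi> (x + y)) \<partial>lborel)"
    unfolding convolution_defect_def scaleR_diff_right
    using kernel_mult_integrable[OF int, of x] kernel_integrable by simp
  then have "ennreal (norm (convolution_defect \<delta> \<phi> x)) \<le> (\<integral>\<^sup>+y. ennreal (norm (\<delta> y *\<^sub>R (\<phi> x - \<phi> (x + y)))) \<partial>lborel)"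
    using integral_norm_bound_ennreal[of lborel "\<lambda>y. \<delta> y *\<^sub>R (\<phi> x - \<phi> (x + y))"]
      kernel_mult_integrable[OF int, of x] kernel_integrable by (simp add: scaleR_diff_right)
  also have "\<dots> \<le> (\<integral>\<^sup>+y. ?I y \<partial>lborel)"
  proof (rule nn_integral_mono)
    fix y
    have "ennreal (norm (\<delta> y *\<^sub>R (\<phi> x - \<phi> (x + y)))) = ennreal \<bar>\<delta> y\<bar> * ennreal (norm (\<phi> x - \<phi> (x + y)))"
      by (simp add: ennreal_mult)
    also have "\<dots> \<le> ennreal \<bar>\<delta> y\<bar> * (\<integral>\<^sup>+t. ennreal (indicator {0..1} t * (norm y * norm (grad \<phi> (x + t *\<^sub>R y)))) \<partial>lborel)"
      by (intro mult_left_mono norm_increment_le[OF C1]) auto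
    also have "\<dots> = (\<integral>\<^sup>+t. ennreal \<bar>\<delta> y\<bar> * ennreal (indicator {0..1} t * (norm y * norm (grad \<phi> (x + t *\<^sub>R y)))) \<partial>lborel)"
      by (rule nn_integral_cmult[symmetric]) measurable
    also have "\<dots> = ?I y"
      by (intro nn_integral_cong) (simp add: ennreal_mult[symmetric] mult_ac)
    finally show "ennreal (norm (\<delta> y *\<^sub>R (\<phi> x - \<phi> (x + y))))
      \<le> ?I y" .
  qed
  also have "\<dots> = segment_potential \<delta> (\<lambda>z. norm (grad \<phi> z)) x"
    unfolding segment_potential_def by (rule lborel_pair.Fubini') measurable
  finally show ?thesis .
qed

text \<open>After exchanging the integrals, the integral over \<open>x\<close> is translation invariant, so \<open>t\<close> and \<open>y\<close>
  decouple from \<open>g\<close>. Together with the next lemma this is the \<open>L 1\<close> continuity that the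
  approximation argument needs.\<close>

lemma nn_integral_segment_potential:
  assumes [measurable]: "g \<in> borel_measurable borel" and g0: "\<And>z. 0 \<le> g z"
  shows "(\<integral>\<^sup>+x. segment_potential \<delta> g x \<partial>lborel)
    = (\<integral>\<^sup>+y. ennreal (\<bar>\<delta> y\<bar> * norm y) \<partial>lborel) * (\<integral>\<^sup>+z. ennreal (g z) \<partial>lborel)"
proof -
  let ?h = "\<lambda>x t y. ennreal (segment_weight \<delta> t y * g (x + t *\<^sub>R y))"
  let ?G = "\<integral>\<^sup>+z. ennreal (g z) \<partial>lborel"
  note [measurable] = kernel_measurable
  have "(\<integral>\<^sup>+x. segment_potential \<delta> g x \<partial>lborel)
      = (\<integral>\<^sup>+t. (\<integral>\<^sup>+x. (\<integral>\<^sup>+y. ?h x t y \<partial>lborel) \<partial>lborel) \<partial>lborel)"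
    unfolding segment_potential_def by (rule lborel_pair.Fubini') measurable
  also have "\<dots> = (\<integral>\<^sup>+t. (\<integral>\<^sup>+y. (\<integral>\<^sup>+x. ?h x t y \<partial>lborel) \<partial>lborel) \<partial>lborel)"
    by (intro nn_integral_cong lborel_pair.Fubini') measurable
  also have "\<dots> = (\<integral>\<^sup>+t. (\<integral>\<^sup>+y. ennreal (indicator {0..1::real} t) * ennreal (\<bar>\<delta> y\<bar> * norm y) * ?G \<partial>lborel) \<partial>lborel)"
  proof (intro nn_integral_cong)
    fix t :: real and y
    have "(\<integral>\<^sup>+x. ?h x t y \<partial>lborel)
        = (\<integral>\<^sup>+x. ennreal (indicator {0..1} t) * ennreal (\<bar>\<delta> y\<bar> * norm y) * ennreal (g (x + t *\<^sub>R y)) \<partial>lborel)"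
      using g0 by (intro nn_integral_cong) (simp add: ennreal_mult[symmetric])
    also have "\<dots> = ennreal (indicator {0..1} t) * ennreal (\<bar>\<delta> y\<bar> * norm y) * (\<integral>\<^sup>+x. ennreal (g (x + t *\<^sub>R y)) \<partial>lborel)"
      by (rule nn_integral_cmult) measurable
    also have "(\<integral>\<^sup>+x. ennreal (g (x + t *\<^sub>R y)) \<partial>lborel) = ?G"
      by (rule nn_integral_translation) measurable
    finally show "(\<integral>\<^sup>+x. ?h x t y \<partial>lborel)
      = ennreal (indicator {0..1} t) * ennreal (\<bar>\<delta> y\<bar> * norm y) * ?G" .
  qed
  also have "\<dots> = (\<integral>\<^sup>+t. ennreal (indicator {0..1::real} t) *
      ((\<integral>\<^sup>+y. ennreal (\<bar>\<delta> y\<bar> * norm y) \<partial>lborel) * ?G) \<partial>lborel)"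
    by (intro nn_integral_cong) (simp add: nn_integral_cmult nn_integral_multc mult.assoc)
  also have "\<dots> = (\<integral>\<^sup>+t. indicator {0..1::real} t \<partial>lborel) *
      ((\<integral>\<^sup>+y. ennreal (\<bar>\<delta> y\<bar> * norm y) \<partial>lborel) * ?G)"
    by (subst nn_integral_multc) (auto simp: ennreal_indicator)
  also have "(\<integral>\<^sup>+t. indicator {0..1::real} t \<partial>lborel) = 1" by simp
  finally show ?thesis by simp
qed

lemma nn_integral_convolution_defect_le:
  fixes W :: "real ^ 'n \<Rightarrow> 'b::euclidean_space"
  assumes W: "integrable lborel W"
  shows "(\<integral>\<^sup>+x. ennreal (norm (convolution_defect \<delta> W x)) \<partial>lborel)
    \<le> 2 * (\<integral>\<^sup>+y. ennreal \<bar>\<delta> y\<bar> \<partial>lborel) * (\<integral>\<^sup>+z. ennreal (norm (W z)) \<partial>lborel)"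
proof -
  note [measurable] = kernel_measurable
  let ?a = "\<lambda>x. \<integral>\<^sup>+y. ennreal \<bar>\<delta> y\<bar> * ennreal (norm (W (x + y))) \<partial>lborel"
  let ?d = "\<integral>\<^sup>+y. ennreal \<bar>\<delta> y\<bar> \<partial>lborel" and ?w = "\<integral>\<^sup>+z. ennreal (norm (W z)) \<partial>lborel"
  have [measurable]: "W \<in> borel_measurable borel" using W by auto
  have "(\<integral>\<^sup>+x. ennreal (norm (convolution_defect \<delta> W x)) \<partial>lborel)
      \<le> (\<integral>\<^sup>+x. ?d * ennreal (norm (W x)) + ?a x \<partial>lborel)"
  proof (rule nn_integral_mono)
    fix x
    have "ennreal (norm (convolution_defect \<delta> W x))
        \<le> ennreal (norm ((\<integral>y. \<delta> y \<partial>lborel) *\<^sub>R W x)) + ennreal (norm (kernel_average \<delta> W x))"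
      unfolding convolution_defect_def
      unfolding ennreal_plus[symmetric, OF norm_ge_zero norm_ge_zero]
      by (intro ennreal_leI norm_triangle_ineq4)
    also have "ennreal (norm ((\<integral>y. \<delta> y \<partial>lborel) *\<^sub>R W x)) \<le> ?d * ennreal (norm (W x))"
    proof -
      have "ennreal (norm (\<integral>y. \<delta> y \<partial>lborel)) \<le> ?d"
        using integral_norm_bound_ennreal[OF kernel_integrable] by simp
      then show ?thesis by (simp add: ennreal_mult mult_right_mono)
    qed
    also have "ennreal (norm (kernel_average \<delta> W x)) \<le> ?a x"
      using integral_norm_bound_ennreal[OF kernel_mult_integrable[OF W, of x]] by (simp add: ennreal_mult)
    finally show "ennreal (norm (convolution_defect \<delta> W x))
      \<le> ?d * ennreal (norm (W x)) + ?a x"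
      by (simp add: add_mono)
  qed
  also have "\<dots> = ?d * ?w + (\<integral>\<^sup>+x. ?a x \<partial>lborel)"
    by (subst nn_integral_add) (auto simp: nn_integral_cmult)
  also have "(\<integral>\<^sup>+x. ?a x \<partial>lborel)
      = (\<integral>\<^sup>+y. (\<integral>\<^sup>+x. ennreal \<bar>\<delta> y\<bar> * ennreal (norm (W (x + y))) \<partial>lborel) \<partial>lborel)"
    by (rule lborel_pair.Fubini') measurable
  also have "\<dots> = (\<integral>\<^sup>+y. ennreal \<bar>\<delta> y\<bar> * ?w \<partial>lborel)"
    by (intro nn_integral_cong)
      (simp add: nn_integral_cmult nn_integral_translation[of "\<lambda>z. ennreal (norm (W z))"])
  also have "\<dots> = ?d * ?w" by (simp add: nn_integral_multc)
  finally show ?thesis by (simp add: mult_2 distrib_right)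
qed

text \<open>The limit argument. The excess of the defect of \<open>V\<close> over the potential of \<open>G\<close> is at most the
  potential of \<open>G - grad (\<phi> k)\<close> plus the defect of \<open>V - \<phi> k\<close>, and the integrals of both tend to zero.\<close>

lemma convolution_defect_AE_le:
  fixes V :: "real ^ 'n \<Rightarrow> 'b::euclidean_space" and G :: "real ^ 'n \<Rightarrow> 'b ^ 'n"
  assumes V: "integrable lborel V" and [measurable]: "G \<in> borel_measurable borel"
    and \<phi>: "\<And>k::nat. \<phi> k \<in> C1_compact UNIV"
    and limV: "(\<lambda>k. \<integral>\<^sup>+x. ennreal (norm (V x - \<phi> k x)) \<partial>lborel) \<longlonglongrightarrow> 0"
    and limG: "(\<lambda>k. \<integral>\<^sup>+x. ennreal (norm (G x - grad (\<phi> k) x)) \<partial>lborel) \<longlonglongrightarrow> 0"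
  shows "AE x in lborel. ennreal (norm (convolution_defect \<delta> V x)) \<le> segment_potential \<delta> (\<lambda>z. norm (G z)) x"
proof -
  note [measurable] = kernel_measurable
  have [measurable]: "V \<in> borel_measurable borel" using V by auto
  have [measurable]: "grad (\<phi> k) \<in> borel_measurable borel" for k
    by (rule Cc_measurable[OF C1_compact_Cc(2)[OF \<phi>]])
  have \<phi>int: "integrable lborel (\<phi> k)" for k by (rule Cc_integrable[OF C1_compact_Cc(1)[OF \<phi>]])
  define W where "W = (\<lambda>k x. V x - \<phi> k x)"
  have W: "integrable lborel (W k)" for k unfolding W_def using V \<phi>int by simp
  define d where "d = (\<lambda>k x. norm (G x - grad (\<phi> k) x))"
  have [measurable]: "d k \<in> borel_measurable borel" for k unfolding d_def by measurable
  have sm [measurable]: "segment_potential \<delta> (d k) \<in> borel_measurable borel"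
      "segment_potential \<delta> (\<lambda>z. norm (G z)) \<in> borel_measurable borel" for k
    by (intro segment_potential_measurable; measurable)+
  have [measurable]: "convolution_defect \<delta> V \<in> borel_measurable borel"
    unfolding convolution_defect_def[abs_def] by measurable
  have Wm [measurable]: "W k \<in> borel_measurable borel" for k using W[of k] by auto
  have [measurable]: "convolution_defect \<delta> (W k) \<in> borel_measurable borel" for k
    unfolding convolution_defect_def[abs_def] by measurable
  \<comment> \<open>Truncated subtraction in \<open>ennreal\<close>: \<open>E x = 0\<close> is the claim at \<open>x\<close>.\<close>
  define E where "E = (\<lambda>x. ennreal (norm (convolution_defect \<delta> V x)) - segment_potential \<delta> (\<lambda>z. norm (G z)) x)"
  have [measurable]: "E \<in> borel_measurable borel" unfolding E_def by measurable
  have E_le: "E x \<le> segment_potential \<delta> (d k) x + ennreal (norm (convolution_defect \<delta> (W k) x))" for k x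
  proof -
    have "convolution_defect \<delta> V x = convolution_defect \<delta> (\<phi> k) x + convolution_defect \<delta> (W k) x"
      unfolding convolution_defect_def W_def scaleR_diff_right
      using kernel_mult_integrable[OF V, of x] kernel_mult_integrable[OF \<phi>int, of k x] by simp
    then have "ennreal (norm (convolution_defect \<delta> V x))
        \<le> ennreal (norm (convolution_defect \<delta> (\<phi> k) x)) + ennreal (norm (convolution_defect \<delta> (W k) x))"
      by (simp only: ennreal_plus[symmetric, OF norm_ge_zero norm_ge_zero]) (intro ennreal_leI norm_triangle_ineq)
    also have "ennreal (norm (convolution_defect \<delta> (\<phi> k) x)) \<le> segment_potential \<delta> (\<lambda>z. norm (grad (\<phi> k) z)) x"
      by (rule convolution_defect_C1_le[OF \<phi>])
    also have "\<dots> \<le> (\<integral>\<^sup>+t. (\<integral>\<^sup>+y. ennreal (segment_weight \<delta> t y * norm (G (x + t *\<^sub>R y)))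
        + ennreal (segment_weight \<delta> t y * d k (x + t *\<^sub>R y)) \<partial>lborel) \<partial>lborel)"
      unfolding segment_potential_def
    proof (intro nn_integral_mono)
      fix t y
      let ?z = "x + t *\<^sub>R y" and ?w = "segment_weight \<delta> t y"
      have "norm (grad (\<phi> k) ?z) \<le> norm (G ?z) + d k ?z"
        unfolding d_def by (metis norm_minus_commute norm_triangle_sub)
      then have "?w * norm (grad (\<phi> k) ?z)
          \<le> ?w * (norm (G ?z) + d k ?z)"
        by (intro mult_left_mono) auto
      then show "ennreal (?w * norm (grad (\<phi> k) ?z))
          \<le> ennreal (?w * norm (G ?z))
            + ennreal (?w * d k ?z)"
        by (subst ennreal_plus[symmetric])
          (auto simp: d_def distrib_left simp del: ennreal_plus intro: ennreal_leI)
    qed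
    also have "\<dots> = segment_potential \<delta> (\<lambda>z. norm (G z)) x + segment_potential \<delta> (d k) x"
      unfolding segment_potential_def
      by (subst nn_integral_add[symmetric]) (auto intro!: nn_integral_cong nn_integral_add)
    finally have "ennreal (norm (convolution_defect \<delta> V x))
        \<le> segment_potential \<delta> (\<lambda>z. norm (G z)) x
          + (segment_potential \<delta> (d k) x + ennreal (norm (convolution_defect \<delta> (W k) x)))"
      by (simp add: add_mono add.assoc)
    then show ?thesis unfolding E_def by (simp add: ennreal_minus_le_iff)
  qed
  define c1 where "c1 = (\<integral>\<^sup>+y. ennreal (\<bar>\<delta> y\<bar> * norm y) \<partial>lborel)"
  define c2 where "c2 = 2 * (\<integral>\<^sup>+y. ennreal \<bar>\<delta> y\<bar> \<partial>lborel)"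
  have c: "c1 \<noteq> top" "c2 \<noteq> top"
  proof -
    have "integrable lborel (\<lambda>y. \<bar>\<delta> y\<bar> * norm y)"
      using \<delta> by (intro Cc_integrable Cc_kernel_mult continuous_intros) (auto simp: Cc_def)
    from integrableD(2)[OF this] show "c1 \<noteq> top" unfolding c1_def by (simp add: abs_mult)
    have "(\<integral>\<^sup>+y. ennreal (norm (\<delta> y)) \<partial>lborel) < \<infinity>"
      using kernel_integrable by (simp add: integrable_iff_bounded)
    then show "c2 \<noteq> top" unfolding c2_def by (simp add: ennreal_mult_eq_top_iff less_top)
  qed
  have "(\<integral>\<^sup>+x. E x \<partial>lborel) \<le> c1 * (\<integral>\<^sup>+x. ennreal (d k x) \<partial>lborel) + c2 * (\<integral>\<^sup>+x. ennreal (norm (W k x)) \<partial>lborel)" for k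
  proof -
    have "(\<integral>\<^sup>+x. E x \<partial>lborel) \<le> (\<integral>\<^sup>+x. segment_potential \<delta> (d k) x + ennreal (norm (convolution_defect \<delta> (W k) x)) \<partial>lborel)"
      by (intro nn_integral_mono E_le)
    also have "\<dots> = (\<integral>\<^sup>+x. segment_potential \<delta> (d k) x \<partial>lborel) + (\<integral>\<^sup>+x. ennreal (norm (convolution_defect \<delta> (W k) x)) \<partial>lborel)"
      by (rule nn_integral_add) auto
    also have "(\<integral>\<^sup>+x. segment_potential \<delta> (d k) x \<partial>lborel) = c1 * (\<integral>\<^sup>+x. ennreal (d k x) \<partial>lborel)"
      unfolding c1_def by (rule nn_integral_segment_potential) (auto simp: d_def)
    also have "(\<integral>\<^sup>+x. ennreal (norm (convolution_defect \<delta> (W k) x)) \<partial>lborel) \<le> c2 * (\<integral>\<^sup>+x. ennreal (norm (W k x)) \<partial>lborel)"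
      unfolding c2_def by (rule nn_integral_convolution_defect_le[OF W])
    finally show ?thesis by (simp add: add_left_mono)
  qed
  moreover have "(\<lambda>k. c1 * (\<integral>\<^sup>+x. ennreal (d k x) \<partial>lborel) + c2 * (\<integral>\<^sup>+x. ennreal (norm (W k x)) \<partial>lborel)) \<longlonglongrightarrow> c1 * 0 + c2 * 0"
    using limV limG c unfolding W_def d_def
    by (intro tendsto_add ennreal_tendsto_cmult) (auto simp: less_top)
  ultimately have "(\<integral>\<^sup>+x. E x \<partial>lborel) \<le> c1 * 0 + c2 * 0"
    by (intro LIMSEQ_le_const) auto
  then have "(\<integral>\<^sup>+x. E x \<partial>lborel) \<le> 0" by simp
  then have "AE x in lborel. E x = 0" by (simp add: nn_integral_0_iff_AE)
  then show ?thesis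
  proof eventually_elim
    case (elim x)
    then show ?case unfolding E_def by (rule ennreal_minus_eq_0)
  qed
qed

lemma kernel_moment_Lspace:
  assumes "1 \<le> p"
  shows "(\<lambda>y. \<bar>\<delta> y\<bar> * norm y) \<in> Lspace (ennreal p) lborel"
proof -
  note [measurable] = kernel_measurable
  have "continuous_on UNIV (\<lambda>y. norm (\<bar>\<delta> y\<bar> * norm y) powr p)"
    by (rule continuous_on_powr') (use assms \<delta> in \<open>auto intro!: continuous_intros simp: Cc_def\<close>)
  then have "integrable lborel (\<lambda>y. norm (\<bar>\<delta> y\<bar> * norm y) powr p)"
    by (intro Cc_integrable Cc_kernel_mult) auto
  then show ?thesis using assms by (simp add: Lspace_finite_iff)
qed

text \<open>Hoelder's inequality in \<open>y\<close> at fixed \<open>t\<close>, then integration of the scaling factor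
  \<open>t powr (- a)\<close> with \<open>a = n (1 - 1 / p) < 1\<close> over the unit interval, which gives \<open>1 / (1 - a)\<close>.\<close>

lemma segment_potential_le:
  fixes g :: "real ^ 'n \<Rightarrow> real"
  assumes p: "1 \<le> p" and a: "real CARD('n) * (1 - 1 / p) < 1"
    and g: "g \<in> Lspace (conj_exponent p) lborel" and g0: "\<And>z. 0 \<le> g z"
  shows "segment_potential \<delta> g x \<le> ennreal (moment_norm p lborel \<delta>
    * Lnorm (conj_exponent p) lborel g / (1 - real CARD('n) * (1 - 1 / p)))"
proof -
  note [measurable] = kernel_measurable
  let ?I = "\<lambda>t. \<integral>\<^sup>+y. ennreal (segment_weight \<delta> t y * g (x + t *\<^sub>R y)) \<partial>lborel"
  define a where "a = real CARD('n) * (1 - 1 / p)"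
  define A where "A = moment_norm p lborel \<delta>"
  define B where "B = Lnorm (conj_exponent p) lborel g"
  have AB: "0 \<le> A" "0 \<le> B" unfolding A_def B_def by (rule Lnorm_nonneg)+
  have [measurable]: "g \<in> borel_measurable borel" using Lspace_measurable[OF g] by simp
  have Aeq: "Lnorm (ennreal p) lborel (\<lambda>y. \<bar>\<delta> y\<bar> * norm y) = A"
    unfolding A_def by (rule Lnorm_AE_cong) auto
  have inner: "?I t
      \<le> ennreal (indicator {0..1} t * ((A * B) * t powr (- a)))" if "t \<noteq> 0" for t
  proof (cases "t \<in> {0..1}")
    case True
    with that have t: "0 < t" by simp
    have "?I t
        = (\<integral>\<^sup>+y. ennreal (\<bar>\<bar>\<delta> y\<bar> * norm y\<bar> * \<bar>g (x + t *\<^sub>R y)\<bar>) \<partial>lborel)"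
      using True g0 by (simp add: abs_mult)
    also have "\<dots> \<le> ennreal (Lnorm (ennreal p) lborel (\<lambda>y. \<bar>\<delta> y\<bar> * norm y)
        * Lnorm (conj_exponent p) lborel (\<lambda>y. g (x + t *\<^sub>R y)))"
      by (rule nn_Holder_inequality[OF p kernel_moment_Lspace[OF p] Lspace_affine(1)[OF p g t]])
    also have "\<dots> \<le> ennreal (A * (t powr (- a) * B))"
      unfolding Aeq using Lspace_affine(2)[OF p g t, of x] AB(1)
      by (intro ennreal_leI mult_left_mono) (simp_all add: a_def B_def)
    finally show ?thesis using True by (simp add: mult_ac)
  qed simp
  have a0: "0 \<le> a" "a < 1" using p a by (auto simp: a_def)
  have "segment_potential \<delta> g x \<le> (\<integral>\<^sup>+t. ennreal (indicator {0..1} t * ((A * B) * t powr (- a))) \<partial>lborel)"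
    unfolding segment_potential_def
  proof (rule nn_integral_mono_AE)
    \<comment> \<open>At \<open>t = 0\<close> only the value \<open>g x\<close> occurs, which no norm controls.\<close>
    have "AE t in lborel. t \<noteq> (0::real)" by (rule AE_lborel_singleton)
    then show "AE t in lborel. ?I t
        \<le> ennreal (indicator {0..1} t * ((A * B) * t powr (- a)))"
      by eventually_elim (rule inner)
  qed
  also have "\<dots> = ennreal ((A * B) * (1 / (1 - a)))"
  proof (rule nn_integral_has_integral_lebesgue)
    have "((\<lambda>t. t powr (- a)) has_integral 1 powr (- a + 1) / (- a + 1)) {0..1::real}"
      using a0 by (intro has_integral_powr_from_0) auto
    then show "((\<lambda>t. (A * B) * t powr (- a)) has_integral (A * B) * (1 / (1 - a))) {0..1}"
      by (intro has_integral_mult_right) simp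
  qed (use AB in auto)
  finally show ?thesis by (simp add: A_def B_def a_def)
qed

end

text \<open>Stated for a Borel version \<open>F\<close> of the extension of \<open>f\<close> by zero, so that the translation and scaling
  rules of \<open>lborel\<close> apply to it.\<close>

lemma Lspace_zero_extension_conj:
  fixes f F :: "real ^ 'n \<Rightarrow> 'b::euclidean_space"
  assumes \<Omega>: "open \<Omega>" and s: "exponent s" and f: "f \<in> Lspace s (lebesgue_on \<Omega>)"
    and F[measurable]: "F \<in> borel_measurable borel"
    and eq: "AE x in lborel. F x = (if x \<in> \<Omega> then f x else 0)"
  shows "F \<in> Lspace s lborel \<and> Lnorm s lborel F \<le> Lnorm s (lebesgue_on \<Omega>) f"
proof -
  note O = sets_lebesgue_open[OF \<Omega>]
  show ?thesis using s unfolding exponent_def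
  proof (elim disjE exE conjE)
    assume [simp]: "s = top"
    have "AE x in lebesgue. x \<in> \<Omega> \<longrightarrow> norm (f x) \<le> Lnorm top (lebesgue_on \<Omega>) f"
      using AE_le_Lnorm_infinity[of f "lebesgue_on \<Omega>"] f O by (simp add: AE_restrict_space_iff)
    then have AE: "AE x in lborel. norm (F x) \<le> Lnorm top (lebesgue_on \<Omega>) f"
      using eq unfolding AE_completion_iff by eventually_elim (auto simp: Lnorm_nonneg)
    then show ?thesis
      using Lnorm_infinity_le[OF _ AE Lnorm_nonneg] by (auto simp: Lspace_infinity_iff)
  next
    fix q :: real assume q: "1 \<le> q" "s = ennreal q"
    have int: "integrable (lebesgue_on \<Omega>) (\<lambda>x. norm (f x) powr q)"
      using f q by (simp add: Lspace_finite_iff)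
    define h where "h = (\<lambda>x. indicator \<Omega> x *\<^sub>R (norm (f x) powr q))"
    have h: "integrable lebesgue h" "(\<integral>x. h x \<partial>lebesgue) = (\<integral>x. norm (f x) powr q \<partial>lebesgue_on \<Omega>)"
      using int O by (simp_all add: h_def integrable_restrict_space integral_restrict_space)
    have Fm: "(\<lambda>x. norm (F x) powr q) \<in> borel_measurable lborel" by measurable
    have AE: "AE x in lebesgue. norm (F x) powr q = h x"
      using AE_completion[OF eq] by eventually_elim (auto simp: h_def)
    have "integrable lebesgue (\<lambda>x. norm (F x) powr q)"
      using h(1) AE Fm by (subst integrable_cong_AE[of _ _ h]) (auto simp: measurable_completion)
    moreover have "(\<integral>x. norm (F x) powr q \<partial>lebesgue) = (\<integral>x. h x \<partial>lebesgue)"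
      using h(1) AE Fm by (intro integral_cong_AE) (auto simp: measurable_completion)
    ultimately show ?thesis
      using Fm q h(2) by (simp add: Lspace_finite_iff Lnorm_finite integrable_completion integral_completion)
  qed
qed

lemmas Lspace_zero_extension = Lspace_zero_extension_conj[THEN conjunct1] Lspace_zero_extension_conj[THEN conjunct2]

lemma zero_extension_borel_version:
  fixes f :: "real ^ 'n \<Rightarrow> 'b::euclidean_space"
  assumes \<Omega>: "open \<Omega>" and f: "f \<in> borel_measurable (lebesgue_on \<Omega>)"
  obtains F where "F \<in> borel_measurable borel" "AE x in lborel. F x = (if x \<in> \<Omega> then f x else 0)"
proof -
  have "(\<lambda>x. if x \<in> \<Omega> then f x else 0) \<in> borel_measurable lebesgue"
    using f sets_lebesgue_open[OF \<Omega>] by (rule borel_measurable_if_I)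
  from lebesgue_borel_version[OF this] obtain F
    where F: "F \<in> borel_measurable borel" "AE x in lborel. (if x \<in> \<Omega> then f x else 0) = F x" by blast
  from F(2) have "AE x in lborel. F x = (if x \<in> \<Omega> then f x else 0)" by eventually_elim simp
  with F(1) show ?thesis by (rule that)
qed

lemma nn_integral_zero_extension_le:
  fixes f F :: "real ^ 'n \<Rightarrow> 'b::euclidean_space"
  assumes \<Omega>: "open \<Omega>" and f: "f \<in> Lspace 1 (lebesgue_on \<Omega>)" and F: "F \<in> borel_measurable borel"
    and eq: "AE x in lborel. F x = (if x \<in> \<Omega> then f x else 0)"
  shows "(\<integral>\<^sup>+x. ennreal (norm (F x)) \<partial>lborel) \<le> ennreal (Lnorm 1 (lebesgue_on \<Omega>) f)"
proof -
  note L = Lspace_zero_extension[OF \<Omega> exponent_1 f F eq]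
  have "(\<integral>\<^sup>+x. ennreal (norm (F x)) \<partial>lborel) = ennreal (\<integral>x. norm (F x) \<partial>lborel)"
    using L(1) by (intro nn_integral_eq_integral) (auto simp: Lspace_1_iff)
  then show ?thesis using L(2) by (simp add: Lnorm_1 ennreal_leI)
qed

text \<open>A zero trace means that the extension by zero is approximated on the whole space, gradients
  included, by the extensions of \<open>C1\<close> functions with compact support in \<open>\<Omega>\<close>.\<close>

lemma zero_trace_convolution_defect_AE_le:
  fixes v V :: "real ^ 'n \<Rightarrow> 'b::euclidean_space" and G :: "real ^ 'n \<Rightarrow> 'b ^ 'n"
  assumes \<Omega>: "open \<Omega>" and v: "zero_trace \<Omega> v"
    and V: "V \<in> borel_measurable borel" "AE x in lborel. V x = (if x \<in> \<Omega> then v x else 0)"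
    and G: "G \<in> borel_measurable borel" "AE x in lborel. G x = (if x \<in> \<Omega> then wgrad \<Omega> v x else 0)"
    and \<delta>: "\<delta> \<in> Cc"
  shows "AE x in lborel. ennreal (norm (convolution_defect \<delta> V x)) \<le> segment_potential \<delta> (\<lambda>z. norm (G z)) x"
proof -
  from v obtain \<phi> where v1: "v \<in> W1 1 \<Omega>" and \<phi>: "\<And>k::nat. \<phi> k \<in> C1_compact \<Omega>"
    and lim: "(\<lambda>k. W1_norm 1 \<Omega> (\<lambda>x. v x - \<phi> k x)) \<longlonglongrightarrow> 0" by (auto simp: zero_trace_def)
  let ?N = "\<lambda>k. ennreal (W1_norm 1 \<Omega> (\<lambda>x. v x - \<phi> k x))"
  have lim': "(\<lambda>k. ?N k) \<longlonglongrightarrow> 0"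
    using tendsto_ennrealI[OF lim] by simp
  have \<phi>0: "\<phi> k x = 0" "grad (\<phi> k) x = 0" if "x \<notin> \<Omega>" for k x
    using C1_compactD[OF \<phi>[of k]] that by (metis subsetD)+
  have \<phi>m: "\<phi> k \<in> borel_measurable borel" "grad (\<phi> k) \<in> borel_measurable borel" for k
    by (intro Cc_measurable C1_compact_Cc[OF \<phi>])+
  have W: "(\<lambda>x. v x - \<phi> k x) \<in> W1 1 \<Omega>" for k
    by (intro W1_diff \<Omega> exponent_1 v1 C1_compact_W1_1 \<phi>)
  note WD = W1D[OF \<Omega> exponent_1 W]
  have le: "(\<integral>\<^sup>+x. ennreal (norm (V x - \<phi> k x)) \<partial>lborel) \<le> ?N k" for k
  proof -
    have "AE x in lborel. V x - \<phi> k x = (if x \<in> \<Omega> then v x - \<phi> k x else 0)"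
      using V(2) by eventually_elim (simp add: \<phi>0)
    then have "(\<integral>\<^sup>+x. ennreal (norm (V x - \<phi> k x)) \<partial>lborel) \<le> ennreal (Lnorm 1 (lebesgue_on \<Omega>) (\<lambda>x. v x - \<phi> k x))"
      using V(1) \<phi>m by (intro nn_integral_zero_extension_le[OF \<Omega> WD(1)]) auto
    also have "\<dots> \<le> ?N k"
      by (intro ennreal_leI) (simp add: W1_norm_def Lnorm_nonneg)
    finally show ?thesis .
  qed
  have leG: "(\<integral>\<^sup>+x. ennreal (norm (G x - grad (\<phi> k) x)) \<partial>lborel) \<le> ?N k" for k
  proof -
    have "has_weak_gradient \<Omega> (\<lambda>x. v x - \<phi> k x) (\<lambda>x. wgrad \<Omega> v x - grad (\<phi> k) x)"
      by (intro has_weak_gradient_diff \<Omega> W1D(2)[OF \<Omega> exponent_1 v1] has_weak_gradient_classical \<phi>)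
    from wgrad_AE_eq[OF \<Omega> this]
    have "AE x in lborel. x \<in> \<Omega> \<longrightarrow> wgrad \<Omega> (\<lambda>x. v x - \<phi> k x) x = wgrad \<Omega> v x - grad (\<phi> k) x"
      using sets_lebesgue_open[OF \<Omega>] by (simp add: AE_restrict_space_iff AE_completion_iff)
    with G(2) have "AE x in lborel. G x - grad (\<phi> k) x = (if x \<in> \<Omega> then wgrad \<Omega> (\<lambda>x. v x - \<phi> k x) x else 0)"
      by eventually_elim (simp add: \<phi>0)
    then have "(\<integral>\<^sup>+x. ennreal (norm (G x - grad (\<phi> k) x)) \<partial>lborel)
        \<le> ennreal (Lnorm 1 (lebesgue_on \<Omega>) (wgrad \<Omega> (\<lambda>x. v x - \<phi> k x)))"
      using G(1) \<phi>m by (intro nn_integral_zero_extension_le[OF \<Omega> WD(3)]) auto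
    also have "\<dots> \<le> ?N k"
      by (intro ennreal_leI) (simp add: W1_norm_def Lnorm_nonneg)
    finally show ?thesis .
  qed
  show ?thesis
  proof (rule convolution_defect_AE_le[OF \<delta> _ G(1)])
    show "integrable lborel V"
      using Lspace_zero_extension(1)[OF \<Omega> exponent_1 W1D(1)[OF \<Omega> exponent_1 v1] V]
      by (simp add: Lspace_1_iff)
    show "\<phi> k \<in> C1_compact UNIV" for k using \<phi>[of k] by (auto simp: C1_compact_def)
    show "(\<lambda>k. \<integral>\<^sup>+x. ennreal (norm (V x - \<phi> k x)) \<partial>lborel) \<longlonglongrightarrow> 0"
      by (rule tendsto_sandwich[OF _ _ tendsto_const lim']) (auto intro: le always_eventually)
    show "(\<lambda>k. \<integral>\<^sup>+x. ennreal (norm (G x - grad (\<phi> k) x)) \<partial>lborel) \<longlonglongrightarrow> 0"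
      by (rule tendsto_sandwich[OF _ _ tendsto_const lim']) (auto intro: leG always_eventually)
  qed
qed

lemma W10_convolution_defect_AE_le:
  fixes v V :: "real ^ 'n \<Rightarrow> 'b::euclidean_space"
  assumes \<Omega>: "open \<Omega>" and p: "1 \<le> p" and a: "real CARD('n) * (1 - 1 / p) < 1"
    and v: "v \<in> W10 (conj_exponent p) \<Omega>"
    and V: "V \<in> borel_measurable borel" "AE x in lborel. V x = (if x \<in> \<Omega> then v x else 0)"
    and \<delta>: "\<delta> \<in> Cc"
  shows "AE x in lborel. norm (convolution_defect \<delta> V x) \<le> moment_norm p lborel \<delta>
    * Lnorm (conj_exponent p) (lebesgue_on \<Omega>) (wgrad \<Omega> v) / (1 - real CARD('n) * (1 - 1 / p))"
proof -
  let ?q = "conj_exponent p"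
  note s = exponent_conj_exponent[OF p]
  from v have v1: "v \<in> W1 ?q \<Omega>" and tr: "zero_trace \<Omega> v" by (auto simp: W10_def)
  note W = W1D[OF \<Omega> s v1]
  obtain G where G: "G \<in> borel_measurable borel" "AE x in lborel. G x = (if x \<in> \<Omega> then wgrad \<Omega> v x else 0)"
    using zero_extension_borel_version[OF \<Omega> Lspace_measurable[OF W(3)]] by blast
  note GL = Lspace_zero_extension[OF \<Omega> s W(3) G]
  have g: "(\<lambda>z. norm (G z)) \<in> Lspace ?q lborel"
    by (rule Lspace_AE_cong[OF s GL(1)]) (use G in auto)
  have "Lnorm ?q lborel (\<lambda>z. norm (G z)) = Lnorm ?q lborel G"
    by (rule Lnorm_AE_cong) (use G in auto)
  then have gn: "Lnorm ?q lborel (\<lambda>z. norm (G z)) \<le> Lnorm ?q (lebesgue_on \<Omega>) (wgrad \<Omega> v)"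
    using GL(2) by simp
  let ?A = "moment_norm p lborel \<delta>" and ?a = "real CARD('n) * (1 - 1 / p)"
  let ?N = "Lnorm ?q (lebesgue_on \<Omega>) (wgrad \<Omega> v)"
  have "AE x in lborel. ennreal (norm (convolution_defect \<delta> V x)) \<le> segment_potential \<delta> (\<lambda>z. norm (G z)) x"
    by (rule zero_trace_convolution_defect_AE_le[OF \<Omega> tr V G \<delta>])
  then show ?thesis
  proof eventually_elim
    case (elim x)
    note elim
    also have "segment_potential \<delta> (\<lambda>z. norm (G z)) x
        \<le> ennreal (?A * Lnorm ?q lborel (\<lambda>z. norm (G z)) / (1 - ?a))"
      by (rule segment_potential_le[OF \<delta> p a g]) auto
    also have "\<dots> \<le> ennreal (?A * ?N / (1 - ?a))"
      using a by (intro ennreal_leI divide_right_mono mult_left_mono gn Lnorm_nonneg) auto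
    finally have "ennreal (norm (convolution_defect \<delta> V x)) \<le> ennreal (?A * ?N / (1 - ?a))" .
    moreover have "0 \<le> ?A * ?N / (1 - ?a)"
      using a by (intro divide_nonneg_nonneg mult_nonneg_nonneg Lnorm_nonneg) auto
    ultimately show ?case by (simp add: ennreal_le_iff)
  qed
qed

section \<open>The continuous representative\<close>

text \<open>The substitution \<open>z = x + y\<close> moves the variable \<open>x\<close> into the continuous kernel, where dominated
  convergence applies.\<close>

lemma continuous_on_kernel_integral:
  fixes V :: "real ^ 'n \<Rightarrow> 'b::euclidean_space" and \<delta> :: "real ^ 'n \<Rightarrow> real"
  assumes \<delta>: "\<delta> \<in> Cc" and V: "integrable lborel V"
  shows "(kernel_average \<delta> V x) = (\<integral>z. \<delta> (z - x) *\<^sub>R V z \<partial>lborel)"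
    and "continuous_on UNIV (\<lambda>x. \<integral>y. \<delta> y *\<^sub>R V (x + y) \<partial>lborel)"
proof -
  have [measurable]: "\<delta> \<in> borel_measurable borel" by (rule Cc_measurable[OF \<delta>])
  have [measurable]: "V \<in> borel_measurable borel" using V by auto
  have eq: "(kernel_average \<delta> V x) = (\<integral>z. \<delta> (z - x) *\<^sub>R V z \<partial>lborel)" for x
  proof -
    have "integrable lborel (\<lambda>z. \<delta> (z - x) *\<^sub>R V z)"
      using lborel_translation(1)[OF kernel_mult_integrable[OF \<delta> V, of x], of "- x"] by simp
    from lborel_translation(2)[OF this, of x] show ?thesis by simp
  qed
  show "(kernel_average \<delta> V x) = (\<integral>z. \<delta> (z - x) *\<^sub>R V z \<partial>lborel)" by (rule eq)
  obtain M where M: "0 \<le> M" "\<And>y. norm (\<delta> y) \<le> M" using Cc_bounded[OF \<delta>] by blast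
  show "continuous_on UNIV (\<lambda>x. \<integral>y. \<delta> y *\<^sub>R V (x + y) \<partial>lborel)"
    unfolding eq continuous_on_sequentially
  proof (intro allI ballI impI, elim conjE)
    fix u :: "nat \<Rightarrow> real ^ 'n" and x assume u: "u \<longlonglongrightarrow> x"
    have "(\<lambda>k. \<integral>z. \<delta> (z - u k) *\<^sub>R V z \<partial>lborel) \<longlonglongrightarrow> (\<integral>z. \<delta> (z - x) *\<^sub>R V z \<partial>lborel)"
    proof (rule integral_dominated_convergence[where w="\<lambda>z. M * norm (V z)"])
      show "AE z in lborel. (\<lambda>k. \<delta> (z - u k) *\<^sub>R V z) \<longlonglongrightarrow> \<delta> (z - x) *\<^sub>R V z"
      proof (intro AE_I2 tendsto_scaleR tendsto_const)
        fix z
        have "isCont \<delta> (z - x)" using \<delta> by (simp add: Cc_def continuous_on_eq_continuous_at)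
        then show "(\<lambda>k. \<delta> (z - u k)) \<longlonglongrightarrow> \<delta> (z - x)"
          by (rule isCont_tendsto_compose) (intro tendsto_diff tendsto_const u)
      qed
    qed (use M V in \<open>auto intro!: mult_right_mono\<close>)
    then show "((\<lambda>x. \<integral>z. \<delta> (z - x) *\<^sub>R V z \<partial>lborel) \<circ> u) \<longlonglongrightarrow> (\<integral>z. \<delta> (z - x) *\<^sub>R V z \<partial>lborel)"
      by (simp add: o_def)
  qed
qed

lemma continuous_le_if_AE_le:
  fixes f g :: "'a::euclidean_space \<Rightarrow> real"
  assumes "continuous_on UNIV f" "AE x in lborel. f x \<le> c"
  shows "f x \<le> c"
proof -
  have "closed {x. f x \<le> c}" using assms(1) by (intro closed_Collect_le continuous_intros) auto
  moreover have "AE x in lebesgue. x \<in> {x. f x \<le> c}" using AE_completion[OF assms(2)] by simp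
  ultimately have "x \<in> {x. f x \<le> c}" by (rule mem_closed_if_AE_lebesgue)
  then show ?thesis by simp
qed

text \<open>Rescaled hat functions. The first moment in \<open>L p\<close> scales like \<open>r powr (1 - a)\<close> with
  \<open>a = n (1 - 1 / p)\<close>, so it tends to zero precisely because \<open>a < 1\<close>.\<close>

lemma mollifier_exists:
  assumes p: "1 \<le> p" and a: "real CARD('n) * (1 - 1 / p) < 1"
  obtains \<eta> :: "nat \<Rightarrow> real ^ 'n \<Rightarrow> real" where "\<And>k. \<eta> k \<in> Cc" "\<And>k. (\<integral>y. \<eta> k y \<partial>lborel) = 1"
    "(\<lambda>k. moment_norm p lborel (\<eta> k)) \<longlonglongrightarrow> 0"
proof -
  define b where "b = (\<lambda>y :: real ^ 'n. max 0 (1 - norm y))"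
  have b_cont: "continuous_on UNIV b" unfolding b_def by (intro continuous_intros)
  have b0: "b y = 0" if "y \<notin> cball 0 1" for y using that by (simp add: b_def)
  have [measurable]: "b \<in> borel_measurable borel" using b_cont by (rule borel_measurable_continuous_onI)
  have b_int: "integrable lborel b" by (rule Cc_integrable[OF CcI[OF b_cont compact_cball b0]])
  define c where "c = (\<integral>y. b y \<partial>lborel)"
  have "c \<noteq> 0"
  proof
    assume "c = 0"
    then have "AE y in lborel. b y = 0"
      unfolding c_def using b_int by (subst (asm) integral_nonneg_eq_0_iff_AE) (auto simp: b_def)
    then have "AE y in lborel. b y \<le> 0" by eventually_elim simp
    from continuous_le_if_AE_le[OF b_cont this, of 0] show False by (simp add: b_def)
  qed
  define r where "r = (\<lambda>k. 1 / real (Suc k))"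
  have r: "0 < r k" for k by (simp add: r_def)
  have r_lim: "r \<longlonglongrightarrow> 0" unfolding r_def by (rule LIMSEQ_Suc[OF lim_1_over_n])
  define \<eta> where "\<eta> = (\<lambda>k y. b (y /\<^sub>R r k) / (c * r k ^ CARD('n)))"
  have scale: "(\<integral>y. f (y /\<^sub>R r k) \<partial>lborel) = r k ^ CARD('n) * (\<integral>y. f y \<partial>lborel)"
    if [measurable]: "f \<in> borel_measurable borel" for f :: "real ^ 'n \<Rightarrow> real" and k
    using lborel_integral_affine(2)[OF r, of "\<lambda>y. f (y /\<^sub>R r k)" k 0] r[of k] by simp
  show ?thesis
  proof (rule that[of \<eta>])
    show "\<eta> k \<in> Cc" for k
    proof (rule CcI[OF _ compact_cball])
      show "continuous_on UNIV (\<eta> k)"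
        unfolding \<eta>_def using \<open>c \<noteq> 0\<close> r[of k]
        by (intro continuous_intros continuous_on_compose2[OF b_cont]) auto
      show "\<eta> k y = 0" if "y \<notin> cball 0 (r k)" for y
        using that r[of k] by (simp add: \<eta>_def b_def max_def field_simps)
    qed
    show "(\<integral>y. \<eta> k y \<partial>lborel) = 1" for k
      using scale[of b k] r[of k] \<open>c \<noteq> 0\<close> by (simp add: \<eta>_def c_def)
    define m where "m = (\<integral>y. (\<bar>b y\<bar> * norm y) powr p \<partial>lborel)"
    define a where "a = real CARD('n) * (1 - 1 / p)"
    have "moment_norm p lborel (\<eta> k) = r k powr (1 - a) * (m powr (1 / p) / \<bar>c\<bar>)" for k
    proof -
      have "(norm (\<eta> k y *\<^sub>R y)) powr p = (r k / (\<bar>c\<bar> * r k ^ CARD('n))) powr p * (\<bar>b (y /\<^sub>R r k)\<bar> * norm (y /\<^sub>R r k)) powr p" for y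
      proof -
        have "norm (\<eta> k y *\<^sub>R y) = (r k / (\<bar>c\<bar> * r k ^ CARD('n))) * (\<bar>b (y /\<^sub>R r k)\<bar> * norm (y /\<^sub>R r k))"
          using r[of k] by (simp add: \<eta>_def abs_mult power_abs)
        then show ?thesis by (simp only: powr_mult)
      qed
      then have "(\<integral>y. norm (\<eta> k y *\<^sub>R y) powr p \<partial>lborel)
          = (r k / (\<bar>c\<bar> * r k ^ CARD('n))) powr p * (r k ^ CARD('n) * m)"
        using scale[of "\<lambda>y. (\<bar>b y\<bar> * norm y) powr p" k] by (simp add: m_def)
      then have "moment_norm p lborel (\<eta> k)
          = ((r k / (\<bar>c\<bar> * r k ^ CARD('n))) powr p * (r k ^ CARD('n) * m)) powr (1 / p)"
        using p by (simp add: Lnorm_finite)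
      also have "\<dots> = (r k / (\<bar>c\<bar> * r k ^ CARD('n))) * ((r k ^ CARD('n)) powr (1 / p) * m powr (1 / p))"
        using p r[of k] by (simp add: powr_mult powr_powr)
      also have "\<dots> = r k powr (1 - a) * (m powr (1 / p) / \<bar>c\<bar>)"
      proof -
        have "(r k ^ CARD('n)) powr (1 / p) = r k powr (real CARD('n) / p)"
          using r[of k] by (simp add: powr_realpow[symmetric] powr_powr)
        moreover have "r k / r k ^ CARD('n) = r k powr (1 - real CARD('n))"
          using r[of k] by (simp add: powr_diff powr_realpow)
        moreover have "1 - a = (1 - real CARD('n)) + real CARD('n) / p" by (simp add: a_def algebra_simps)
        ultimately have "r k powr (1 - a) = (r k / r k ^ CARD('n)) * (r k ^ CARD('n)) powr (1 / p)"
          by (simp only: powr_add)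
        then show ?thesis by (simp add: mult_ac)
      qed
      finally show ?thesis .
    qed
    moreover have "(\<lambda>k. r k powr (1 - a) * (m powr (1 / p) / \<bar>c\<bar>)) \<longlonglongrightarrow> 0 powr (1 - a) * (m powr (1 / p) / \<bar>c\<bar>)"
      using r_lim r assms(2) by (intro tendsto_mult tendsto_const tendsto_powr2) (auto simp: a_def less_imp_le)
    ultimately show "(\<lambda>k. moment_norm p lborel (\<eta> k)) \<longlonglongrightarrow> 0" by simp
  qed
qed

text \<open>The averages of \<open>V\<close> with the mollifiers are continuous and, by the almost everywhere estimate,
  uniformly close to \<open>V\<close> off a null set. Differences of two averages are continuous, so they are
  uniformly small everywhere and the averages converge uniformly. The limit is \<open>\<psi>\<close>, and
  the estimate for a general kernel extends from almost every point to every point by continuity.\<close>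

lemma W10_continuous_representative_extension:
  fixes v V :: "real ^ 'n \<Rightarrow> 'b::euclidean_space"
  assumes \<Omega>: "open \<Omega>" and p: "1 \<le> p" and a: "real CARD('n) * (1 - 1 / p) < 1"
    and v: "v \<in> W10 (conj_exponent p) \<Omega>"
    and V: "V \<in> borel_measurable borel" "AE x in lborel. V x = (if x \<in> \<Omega> then v x else 0)"
  obtains \<psi> where "continuous_on UNIV \<psi>" "AE x in lborel. V x = \<psi> x"
    "\<And>\<delta> x. \<delta> \<in> Cc \<Longrightarrow> norm ((\<integral>y. \<delta> y \<partial>lborel) *\<^sub>R \<psi> x - (kernel_average \<delta> V x))
        \<le> moment_norm p lborel \<delta>
          * Lnorm (conj_exponent p) (lebesgue_on \<Omega>) (wgrad \<Omega> v) / (1 - real CARD('n) * (1 - 1 / p))"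
proof -
  define N where "N = Lnorm (conj_exponent p) (lebesgue_on \<Omega>) (wgrad \<Omega> v) / (1 - real CARD('n) * (1 - 1 / p))"
  have V_int: "integrable lborel V"
    using Lspace_zero_extension(1)[OF \<Omega> exponent_1 _ V] W10_integrable[OF \<Omega> v] by (simp add: Lspace_1_iff)
  have AE: "AE x in lborel. norm (convolution_defect \<delta> V x) \<le> moment_norm p lborel \<delta> * N"
    if "\<delta> \<in> Cc" for \<delta>
    using W10_convolution_defect_AE_le[OF \<Omega> p a v V that] by (simp add: N_def)
  obtain \<eta> :: "nat \<Rightarrow> real ^ 'n \<Rightarrow> real" where \<eta>: "\<And>k. \<eta> k \<in> Cc" "\<And>k. (\<integral>y. \<eta> k y \<partial>lborel) = 1"
    "(\<lambda>k. moment_norm p lborel (\<eta> k)) \<longlonglongrightarrow> 0"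
    using mollifier_exists[OF p a] by blast
  define A where "A = (\<lambda>k x. \<integral>y. \<eta> k y *\<^sub>R V (x + y) \<partial>lborel)"
  define e where "e = (\<lambda>k. moment_norm p lborel (\<eta> k) * N)"
  have e_lim: "e \<longlonglongrightarrow> 0" unfolding e_def using tendsto_mult_right[OF \<eta>(3), of N] by simp
  have A_cont: "continuous_on UNIV (A k)" for k
    unfolding A_def by (rule continuous_on_kernel_integral(2)[OF \<eta>(1) V_int])
  have VA: "AE x in lborel. norm (V x - A k x) \<le> e k" for k
  proof -
    have "AE x in lborel. norm (convolution_defect (\<eta> k) V x) \<le> e k"
      unfolding e_def by (rule AE[OF \<eta>(1)])
    then show ?thesis by (simp add: convolution_defect_def \<eta>(2) A_def)
  qed
  have AA: "norm (A k x - A l x) \<le> e k + e l" for k l x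
  proof (rule continuous_le_if_AE_le[where f="\<lambda>x. norm (A k x - A l x)"])
    show "continuous_on UNIV (\<lambda>x. norm (A k x - A l x))" by (intro continuous_intros A_cont)
    show "AE x in lborel. norm (A k x - A l x) \<le> e k + e l"
      using VA[of k] VA[of l]
    proof eventually_elim
      case (elim x)
      then show ?case using norm_triangle_ineq4[of "V x - A l x" "V x - A k x"] by simp
    qed
  qed
  have "Cauchy (\<lambda>k. A k x)" for x
  proof (rule metric_CauchyI)
    fix d :: real assume "0 < d"
    then have "eventually (\<lambda>k. e k < d / 2) sequentially"
      using order_tendstoD(2)[OF e_lim, of "d / 2"] by simp
    then obtain M where M: "\<And>k. M \<le> k \<Longrightarrow> e k < d / 2" by (auto simp: eventually_sequentially)
    have "dist (A k x) (A l x) < d" if "M \<le> k" "M \<le> l" for k l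
      using AA[of k x l] M[OF that(1)] M[OF that(2)] by (simp add: dist_norm)
    then show "\<exists>M. \<forall>m\<ge>M. \<forall>n\<ge>M. dist (A m x) (A n x) < d" by blast
  qed
  then have conv: "(\<lambda>k. A k x) \<longlonglongrightarrow> lim (\<lambda>k. A k x)" for x
    by (simp add: Cauchy_convergent_iff convergent_LIMSEQ_iff)
  define \<psi> where "\<psi> = (\<lambda>x. lim (\<lambda>k. A k x))"
  have A\<psi>: "norm (A k x - \<psi> x) \<le> e k" for k x
  proof (rule LIMSEQ_le)
    show "(\<lambda>l. norm (A k x - A l x)) \<longlonglongrightarrow> norm (A k x - \<psi> x)"
      unfolding \<psi>_def by (intro tendsto_intros conv)
    show "(\<lambda>l. e k + e l) \<longlonglongrightarrow> e k" using tendsto_add[OF tendsto_const e_lim, of "e k"] by simp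
    show "\<exists>N. \<forall>n\<ge>N. norm (A k x - A n x) \<le> e k + e n" using AA by blast
  qed
  have unif: "uniform_limit UNIV A \<psi> sequentially"
    unfolding uniform_limit_iff
  proof (intro allI impI)
    fix d :: real assume "0 < d"
    then have "eventually (\<lambda>k. e k < d) sequentially" using order_tendstoD(2)[OF e_lim] by simp
    then show "\<forall>\<^sub>F k in sequentially. \<forall>x\<in>UNIV. dist (A k x) (\<psi> x) < d"
      by eventually_elim (use A\<psi> in \<open>auto simp: dist_norm intro: le_less_trans\<close>)
  qed
  have \<psi>_cont: "continuous_on UNIV \<psi>"
    by (rule uniform_limit_theorem[OF _ unif]) (auto simp: A_cont)
  have V\<psi>: "AE x in lborel. V x = \<psi> x"
  proof -
    have "AE x in lborel. \<forall>k. norm (V x - A k x) \<le> e k" using VA by (simp add: AE_all_countable)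
    then show ?thesis
    proof eventually_elim
      case (elim x)
      have "(\<lambda>k. A k x - V x) \<longlonglongrightarrow> 0"
        by (rule Lim_null_comparison[OF _ e_lim]) (use elim in \<open>auto simp: norm_minus_commute\<close>)
      then have "(\<lambda>k. A k x) \<longlonglongrightarrow> V x" by (rule LIM_zero_cancel)
      then show ?case using conv[of x] unfolding \<psi>_def by (rule LIMSEQ_unique)
    qed
  qed
  show ?thesis
  proof (rule that[OF \<psi>_cont V\<psi>])
    fix \<delta> :: "real ^ 'n \<Rightarrow> real" and x assume \<delta>: "\<delta> \<in> Cc"
    have "norm ((\<integral>y. \<delta> y \<partial>lborel) *\<^sub>R \<psi> x - (kernel_average \<delta> V x))
        \<le> moment_norm p lborel \<delta> * N"
    proof (rule continuous_le_if_AE_le[where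
          f="\<lambda>x. norm ((\<integral>y. \<delta> y \<partial>lborel) *\<^sub>R \<psi> x - (kernel_average \<delta> V x))"])
      show "continuous_on UNIV (\<lambda>x. norm ((\<integral>y. \<delta> y \<partial>lborel) *\<^sub>R \<psi> x - (kernel_average \<delta> V x)))"
        by (intro continuous_intros \<psi>_cont continuous_on_kernel_integral(2)[OF \<delta> V_int]) 
      have "AE x in lborel. norm (convolution_defect \<delta> V x) \<le> moment_norm p lborel \<delta> * N"
        by (rule AE[OF \<delta>])
      with V\<psi> show "AE x in lborel. norm ((\<integral>y. \<delta> y \<partial>lborel) *\<^sub>R \<psi> x - (kernel_average \<delta> V x))
          \<le> moment_norm p lborel \<delta> * N"
        by eventually_elim (simp add: convolution_defect_def)
    qed
    then show "norm ((\<integral>y. \<delta> y \<partial>lborel) *\<^sub>R \<psi> x - (kernel_average \<delta> V x))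
        \<le> moment_norm p lborel \<delta>
          * Lnorm (conj_exponent p) (lebesgue_on \<Omega>) (wgrad \<Omega> v) / (1 - real CARD('n) * (1 - 1 / p))"
      by (simp add: N_def)
  qed
qed

text \<open>This is \<open>kernel_average \<delta> V x\<close> for the extension \<open>V\<close> of \<open>v\<close> by zero.\<close>

abbreviation domain_average ::
    "(real ^ 'n) set \<Rightarrow> (real ^ 'n \<Rightarrow> real) \<Rightarrow> (real ^ 'n \<Rightarrow> 'b::euclidean_space) \<Rightarrow> real ^ 'n \<Rightarrow> 'b" where
  "domain_average \<Omega> \<delta> v x \<equiv> \<integral>z. \<delta> (z - x) *\<^sub>R v z \<partial>lebesgue_on \<Omega>"

text \<open>Point values of \<open>\<psi>\<close> are controlled by the Sobolev norm of \<open>v\<close>, and averaging with a kernel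
  changes them, apart from its total mass, by at most a multiple of its first moment.\<close>

definition pointwise_representative ::
    "real \<Rightarrow> (real ^ 'n) set \<Rightarrow> real \<Rightarrow> (real ^ 'n \<Rightarrow> 'b::euclidean_space) \<Rightarrow> (real ^ 'n \<Rightarrow> 'b) \<Rightarrow> bool" where
  "pointwise_representative p \<Omega> C v \<psi> \<longleftrightarrow>
     continuous_on UNIV \<psi> \<and> (AE x in lebesgue_on \<Omega>. \<psi> x = v x) \<and>
     (\<forall>x. norm (\<psi> x) \<le> C * W1_norm (conj_exponent p) \<Omega> v) \<and>
     (\<forall>\<delta>\<in>Cc. \<forall>x. norm ((\<integral>y. \<delta> y \<partial>lebesgue) *\<^sub>R \<psi> x - (domain_average \<Omega> \<delta> v x))
       \<le> C * moment_norm p lebesgue \<delta> * W1_norm (conj_exponent p) \<Omega> v)"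

text \<open>The constant is uniform in \<open>v\<close>, \<open>\<delta>\<close> and \<open>x\<close>. The bound for the supremum compares \<open>\<psi> x\<close> with the
  average of \<open>v\<close> against one fixed kernel of integral \<open>1\<close>, which is controlled by Hoelder's inequality.\<close>

lemma W10_continuous_representative:
  fixes \<Omega> :: "(real ^ 'n) set"
  assumes \<Omega>: "open \<Omega>" and p: "1 \<le> p" and a: "real CARD('n) * (1 - 1 / p) < 1"
  shows "\<exists>C>0. \<forall>v :: real ^ 'n \<Rightarrow> 'b::euclidean_space. v \<in> W10 (conj_exponent p) \<Omega> \<longrightarrow>
    (\<exists>\<psi>. pointwise_representative p \<Omega> C v \<psi>)"
proof -
  let ?M = "lebesgue_on \<Omega>" and ?q = "conj_exponent p"
  define c where "c = 1 / (1 - real CARD('n) * (1 - 1 / p))"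
  have c: "0 < c" using a by (simp add: c_def)
  obtain \<eta>s :: "nat \<Rightarrow> real ^ 'n \<Rightarrow> real" where \<eta>s: "\<And>k. \<eta>s k \<in> Cc" "\<And>k. (\<integral>y. \<eta>s k y \<partial>lborel) = 1"
    "(\<lambda>k. moment_norm p lborel (\<eta>s k)) \<longlonglongrightarrow> 0"
    using mollifier_exists[OF p a] by blast
  define \<eta> where "\<eta> = \<eta>s 0"
  have \<eta>: "\<eta> \<in> Cc" "(\<integral>y. \<eta> y \<partial>lborel) = 1" using \<eta>s by (auto simp: \<eta>_def)
  have \<eta>m [measurable]: "\<eta> \<in> borel_measurable borel" by (rule Cc_measurable[OF \<eta>(1)])
  have \<eta>L: "\<eta> \<in> Lspace (ennreal p) lborel"
  proof -
    have "continuous_on UNIV (\<lambda>y. norm (\<eta> y) powr p)"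
      by (rule continuous_on_powr') (use p \<eta>(1) in \<open>auto intro!: continuous_intros simp: Cc_def\<close>)
    then have "integrable lborel (\<lambda>y. norm (\<eta> y) powr p)"
      by (intro Cc_integrable Cc_kernel_mult[OF \<eta>(1)]) auto
    then show ?thesis using p by (simp add: Lspace_finite_iff)
  qed
  \<comment> \<open>The summand \<open>c\<close> serves the estimate for general kernels, the other two the supremum bound.\<close>
  define C where "C = c + Lnorm (ennreal p) lborel \<eta> + c * moment_norm p lborel \<eta>"
  have C: "c \<le> C" "0 < C" using c by (auto simp: C_def Lnorm_nonneg add_pos_nonneg)
  show ?thesis
  proof (intro exI[of _ C] conjI allI impI C(2))
    fix v :: "real ^ 'n \<Rightarrow> 'b" assume v: "v \<in> W10 ?q \<Omega>"
    note s = exponent_conj_exponent[OF p]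
    have v1: "v \<in> W1 ?q \<Omega>" using v by (simp add: W10_def)
    note W = W1D[OF \<Omega> s v1]
    let ?Nv = "Lnorm ?q ?M v"
    let ?Ng = "Lnorm ?q ?M (wgrad \<Omega> v)"
    have W1n: "W1_norm ?q \<Omega> v = ?Nv + ?Ng" by (simp add: W1_norm_def)
    obtain V where V: "V \<in> borel_measurable borel" "AE x in lborel. V x = (if x \<in> \<Omega> then v x else 0)"
      using zero_extension_borel_version[OF \<Omega> Lspace_measurable[OF W(1)]] by blast
    note [measurable] = V(1)
    have V_int: "integrable lborel V"
      using Lspace_zero_extension(1)[OF \<Omega> exponent_1 _ V] W10_integrable[OF \<Omega> v] by (simp add: Lspace_1_iff)
    note VL = Lspace_zero_extension[OF \<Omega> s W(1) V]
    obtain \<psi> where \<psi>: "continuous_on UNIV \<psi>" "AE x in lborel. V x = \<psi> x"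
      and est: "\<And>\<delta> x. \<delta> \<in> Cc \<Longrightarrow> norm ((\<integral>y. \<delta> y \<partial>lborel) *\<^sub>R \<psi> x - (kernel_average \<delta> V x))
        \<le> moment_norm p lborel \<delta> * ?Ng / (1 - real CARD('n) * (1 - 1 / p))"
      using W10_continuous_representative_extension[OF \<Omega> p a v V] by blast
    have sup: "norm (\<psi> x) \<le> C * W1_norm ?q \<Omega> v" for x
    proof -
      have Vx: "(\<lambda>y. norm (V (x + 1 *\<^sub>R y))) \<in> Lspace ?q lborel"
        "Lnorm ?q lborel (\<lambda>y. norm (V (x + 1 *\<^sub>R y))) \<le> ?Nv"
      proof -
        have g: "(\<lambda>z. norm (V z)) \<in> Lspace ?q lborel"
          by (rule Lspace_AE_cong[OF s VL(1)]) auto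
        have "Lnorm ?q lborel (\<lambda>z. norm (V z)) = Lnorm ?q lborel V"
          by (rule Lnorm_AE_cong) auto
        then show "(\<lambda>y. norm (V (x + 1 *\<^sub>R y))) \<in> Lspace ?q lborel"
          "Lnorm ?q lborel (\<lambda>y. norm (V (x + 1 *\<^sub>R y))) \<le> ?Nv"
          using Lspace_affine[OF p g, of 1 x] VL(2) by auto
      qed
      have "norm (kernel_average \<eta> V x) \<le> (\<integral>y. norm (\<eta> y) * norm (norm (V (x + 1 *\<^sub>R y))) \<partial>lborel)"
        using integral_norm_bound[of lborel "\<lambda>y. \<eta> y *\<^sub>R V (x + y)"] by simp
      also have "\<dots> \<le> Lnorm (ennreal p) lborel \<eta> * Lnorm ?q lborel (\<lambda>y. norm (V (x + 1 *\<^sub>R y)))"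
        by (rule Holder_inequality(2)[OF p \<eta>L Vx(1)])
      also have "\<dots> \<le> Lnorm (ennreal p) lborel \<eta> * ?Nv" by (intro mult_left_mono Vx(2) Lnorm_nonneg)
      finally have 1: "norm (kernel_average \<eta> V x) \<le> Lnorm (ennreal p) lborel \<eta> * ?Nv" .
      have "norm (\<psi> x - (kernel_average \<eta> V x)) \<le> c * moment_norm p lborel \<eta> * ?Ng"
        using est[OF \<eta>(1), of x] by (simp add: \<eta>(2) c_def)
      then have "norm (\<psi> x) \<le> c * moment_norm p lborel \<eta> * ?Ng + Lnorm (ennreal p) lborel \<eta> * ?Nv"
        using 1 norm_triangle_sub[of "\<psi> x" "kernel_average \<eta> V x"] by simp
      also have "\<dots> \<le> C * ?Ng + C * ?Nv"
        using c by (intro add_mono mult_right_mono) (auto simp: C_def Lnorm_nonneg)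
      finally show ?thesis by (simp add: W1n distrib_left)
    qed
    have AE\<Omega>: "AE x in ?M. \<psi> x = v x"
    proof -
      have "AE x in lborel. x \<in> \<Omega> \<longrightarrow> \<psi> x = v x" using \<psi>(2) V(2) by eventually_elim auto
      then show ?thesis using sets_lebesgue_open[OF \<Omega>] by (simp add: AE_restrict_space_iff AE_completion_iff)
    qed
    have est': "norm ((\<integral>y. \<delta> y \<partial>lebesgue) *\<^sub>R \<psi> x - (domain_average \<Omega> \<delta> v x))
          \<le> C * moment_norm p lebesgue \<delta> * W1_norm ?q \<Omega> v"
      if \<delta>: "\<delta> \<in> Cc" for \<delta> x
    proof -
      have [measurable]: "\<delta> \<in> borel_measurable borel" by (rule Cc_measurable[OF \<delta>])
      have I: "(kernel_average \<delta> V x) = (domain_average \<Omega> \<delta> v x)"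
      proof -
        have "(kernel_average \<delta> V x) = (\<integral>z. \<delta> (z - x) *\<^sub>R V z \<partial>lborel)"
          by (rule continuous_on_kernel_integral(1)[OF \<delta> V_int])
        also have "\<dots> = (\<integral>z. \<delta> (z - x) *\<^sub>R V z \<partial>lebesgue)" by (subst integral_completion) auto
        also have "\<dots> = (\<integral>z. indicator \<Omega> z *\<^sub>R (\<delta> (z - x) *\<^sub>R v z) \<partial>lebesgue)"
        proof (rule integral_cong_AE)
          show "(\<lambda>z. \<delta> (z - x) *\<^sub>R V z) \<in> borel_measurable lebesgue" by (rule measurable_completion) measurable
          have eq: "AE z in lebesgue. \<delta> (z - x) *\<^sub>R V z = indicator \<Omega> z *\<^sub>R (\<delta> (z - x) *\<^sub>R v z)"
            using AE_completion[OF V(2)] by eventually_elim auto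
          then show "AE z in lebesgue. \<delta> (z - x) *\<^sub>R V z = indicator \<Omega> z *\<^sub>R (\<delta> (z - x) *\<^sub>R v z)" .
          show "(\<lambda>z. indicator \<Omega> z *\<^sub>R (\<delta> (z - x) *\<^sub>R v z)) \<in> borel_measurable lebesgue"
            by (rule borel_measurable_AE[OF _ eq]) (rule measurable_completion, measurable)
        qed
        also have "\<dots> = (domain_average \<Omega> \<delta> v x)"
          using sets_lebesgue_open[OF \<Omega>] by (simp add: integral_restrict_space)
        finally show ?thesis .
      qed
      have J: "(\<integral>y. \<delta> y \<partial>lebesgue) = (\<integral>y. \<delta> y \<partial>lborel)" by (subst integral_completion) auto
      have L: "moment_norm p lebesgue \<delta> = moment_norm p lborel \<delta>"
        using p by (simp add: Lnorm_finite integral_completion)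
      have "norm ((\<integral>y. \<delta> y \<partial>lebesgue) *\<^sub>R \<psi> x - (domain_average \<Omega> \<delta> v x))
          \<le> c * moment_norm p lebesgue \<delta> * ?Ng"
        unfolding I[symmetric] J L using est[OF \<delta>, of x] by (simp add: c_def)
      also have "\<dots> \<le> C * moment_norm p lebesgue \<delta> * W1_norm ?q \<Omega> v"
        unfolding W1n using C c by (intro mult_mono mult_nonneg_nonneg) (auto simp: Lnorm_nonneg)
      finally show ?thesis .
    qed
    show "\<exists>\<psi>. pointwise_representative p \<Omega> C v \<psi>"
      unfolding pointwise_representative_def
      using \<psi>(1) AE\<Omega> sup est' by (intro exI[of _ \<psi>] conjI allI ballI)
  qed
qed

text \<open>Hoelder's inequality against the constant function \<open>1\<close>.\<close>

lemma Lspace_imp_integrable: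
  fixes f :: "'a \<Rightarrow> 'b::euclidean_space"
  assumes M: "finite_measure M" and p: "1 \<le> p" and f: "f \<in> Lspace (ennreal p) M"
  shows "integrable M f"
    and "(\<integral>x. norm (f x) \<partial>M) \<le> Lnorm (conj_exponent p) M (\<lambda>_. 1 :: real) * Lnorm (ennreal p) M f"
proof -
  have 1: "(\<lambda>_. 1 :: real) \<in> Lspace (conj_exponent p) M"
    by (rule Lspace_bounded[OF M exponent_conj_exponent[OF p], where C=1]) auto
  have "integrable M (\<lambda>x. norm (f x))" using Holder_inequality(1)[OF p f 1] by simp
  then show "integrable M f" using Lspace_measurable[OF f] integrable_norm_cancel by blast
  show "(\<integral>x. norm (f x) \<partial>M) \<le> Lnorm (conj_exponent p) M (\<lambda>_. 1 :: real) * Lnorm (ennreal p) M f"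
    using Holder_inequality(2)[OF p f 1] by (simp add: mult.commute)
qed

lemma finite_measure_lebesgue_on_bounded:
  fixes S :: "'a::euclidean_space set"
  shows "bounded S \<Longrightarrow> S \<in> sets lebesgue \<Longrightarrow> finite_measure (lebesgue_on S)"
  by (intro finite_measure_lebesgue_on bounded_set_imp_lmeasurable)

section \<open>The difference of two Stokes solutions\<close>

lemma Lspace_matrix_nth:
  fixes U :: "real ^ 'n \<Rightarrow> real ^ 'n ^ 'n"
  assumes "exponent s" "U \<in> Lspace s M"
  shows "(\<lambda>x. U x $ i $ j) \<in> Lspace s M"
proof (rule Lspace_dominated[OF assms, where c=1])
  have "(\<lambda>A :: real ^ 'n ^ 'n. A $ i $ j) \<in> borel_measurable borel"
    by (intro borel_measurable_continuous_onI continuous_intros)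
  from measurable_compose[OF Lspace_measurable[OF assms(2)] this]
  show "(\<lambda>x. U x $ i $ j) \<in> borel_measurable M" .
  show "AE x in M. norm (U x $ i $ j) \<le> 1 * norm (U x)"
    unfolding mult_1 by (intro AE_I2 order_trans[OF Finite_Cartesian_Product.norm_nth_le Finite_Cartesian_Product.norm_nth_le])
qed simp

lemma stokes_a_integrable:
  fixes U V :: "real ^ 'n \<Rightarrow> real ^ 'n ^ 'n"
  assumes p: "1 \<le> p" and U: "U \<in> Lspace (ennreal p) M" and V: "V \<in> Lspace (conj_exponent p) M"
  shows "integrable M (\<lambda>x. \<Sum>i\<in>UNIV. \<Sum>j\<in>UNIV.
    (U x $ i $ j + U x $ j $ i) * (V x $ i $ j + V x $ j $ i))"
  by (intro Bochner_Integration.integrable_sum Holder_integrable_mult[OF p] Lspace_add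
    exponent_ennreal[OF p] exponent_conj_exponent[OF p] Lspace_matrix_nth U V)

lemma stokes_b_integrable:
  fixes q :: "real ^ 'n \<Rightarrow> real" and V :: "real ^ 'n \<Rightarrow> real ^ 'n ^ 'n"
  assumes p: "1 \<le> p" and q: "q \<in> Lspace (ennreal p) M" and V: "V \<in> Lspace (conj_exponent p) M"
  shows "integrable M (\<lambda>x. q x * (\<Sum>i\<in>UNIV. V x $ i $ i))"
  unfolding sum_distrib_left
  by (intro Bochner_Integration.integrable_sum Holder_integrable_mult[OF p q]
    exponent_conj_exponent[OF p] Lspace_matrix_nth V)

lemma stokes_b_integrable':
  fixes q :: "real ^ 'n \<Rightarrow> real" and V :: "real ^ 'n \<Rightarrow> real ^ 'n ^ 'n"
  assumes p: "1 \<le> p" and q: "q \<in> Lspace (conj_exponent p) M" and V: "V \<in> Lspace (ennreal p) M"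
  shows "integrable M (\<lambda>x. q x * (\<Sum>i\<in>UNIV. V x $ i $ i))"
proof -
  have "integrable M (\<lambda>x. \<Sum>i\<in>UNIV. V x $ i $ i * q x)"
    by (intro Bochner_Integration.integrable_sum Holder_integrable_mult[OF p _ q]
      exponent_ennreal[OF p] Lspace_matrix_nth V)
  then show ?thesis by (simp add: sum_distrib_left mult.commute)
qed

text \<open>The forms are bilinear where the products of weak gradients are integrable, which Hoelder's
  inequality guarantees, and \<open>wgrad\<close> is additive almost everywhere. Finiteness of the measure
  makes the pressures integrable, so that their means can be subtracted.\<close>

lemma weak_stokes_solution_diff:
  fixes \<Omega> :: "(real ^ 'n) set"
  assumes \<Omega>: "open \<Omega>" and fin: "finite_measure (lebesgue_on \<Omega>)" and p: "1 \<le> p"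
    and 1: "weak_stokes_solution \<nu> p \<Omega> f u \<pi>" and 2: "weak_stokes_solution \<nu> p \<Omega> f' u' \<pi>'"
  shows "weak_stokes_solution \<nu> p \<Omega> (\<lambda>\<phi>. f \<phi> - f' \<phi>) (\<lambda>x. u x - u' x) (\<lambda>x. \<pi> x - \<pi>' x)"
proof -
  let ?M = "lebesgue_on \<Omega>"
  note sp = exponent_ennreal[OF p] and sq = exponent_conj_exponent[OF p]
  have u: "u \<in> W10 (ennreal p) \<Omega>" "u' \<in> W10 (ennreal p) \<Omega>"
    and \<pi>: "\<pi> \<in> L0space (ennreal p) \<Omega>" "\<pi>' \<in> L0space (ennreal p) \<Omega>"
    using 1 2 by (auto simp: weak_stokes_solution_def)
  have u1: "u \<in> W1 (ennreal p) \<Omega>" "u' \<in> W1 (ennreal p) \<Omega>" using u by (auto simp: W10_def)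
  note W = W1D[OF \<Omega> sp u1(1)] W1D[OF \<Omega> sp u1(2)]
  note Wd = W1D[OF \<Omega> sp W1_diff[OF \<Omega> sp u1]]
  have AE: "AE x in ?M. wgrad \<Omega> (\<lambda>x. u x - u' x) x = wgrad \<Omega> u x - wgrad \<Omega> u' x"
    by (rule wgrad_diff[OF \<Omega> W(2,5)])
  have \<pi>L: "\<pi> \<in> Lspace (ennreal p) ?M" "\<pi>' \<in> Lspace (ennreal p) ?M"
    and \<pi>0: "(\<integral>x. \<pi> x \<partial>?M) = 0" "(\<integral>x. \<pi>' x \<partial>?M) = 0"
    using \<pi> by (auto simp: L0space_def)
  have \<pi>d: "(\<lambda>x. \<pi> x - \<pi>' x) \<in> Lspace (ennreal p) ?M" by (rule Lspace_diff[OF sp \<pi>L])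
  show ?thesis
    unfolding weak_stokes_solution_def
  proof (intro conjI ballI)
    show "(\<lambda>x. u x - u' x) \<in> W10 (ennreal p) \<Omega>" by (rule W10_diff[OF \<Omega> sp u])
    show "(\<lambda>x. \<pi> x - \<pi>' x) \<in> L0space (ennreal p) \<Omega>"
      using \<pi>d \<pi>0 Lspace_imp_integrable(1)[OF fin p \<pi>L(1)] Lspace_imp_integrable(1)[OF fin p \<pi>L(2)]
      by (simp add: L0space_def)
  next
    fix v :: "real ^ 'n \<Rightarrow> real ^ 'n" assume v: "v \<in> W10 (conj_exponent p) \<Omega>"
    then have "v \<in> W1 (conj_exponent p) \<Omega>" by (simp add: W10_def)
    note V = W1D[OF \<Omega> sq this]
    have "stokes_a \<nu> \<Omega> (\<lambda>x. u x - u' x) v = stokes_a \<nu> \<Omega> u v - stokes_a \<nu> \<Omega> u' v"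
    proof -
      let ?E = "\<lambda>U x. \<Sum>i\<in>UNIV. \<Sum>j\<in>UNIV. (U x $ i $ j + U x $ j $ i) *
        (wgrad \<Omega> v x $ i $ j + wgrad \<Omega> v x $ j $ i)"
      note I = stokes_a_integrable[OF p _ V(3)]
      have "(\<integral>x. ?E (wgrad \<Omega> (\<lambda>x. u x - u' x)) x \<partial>?M) = (\<integral>x. ?E (wgrad \<Omega> u) x - ?E (wgrad \<Omega> u') x \<partial>?M)"
      proof (rule integral_cong_AE)
        show "AE x in ?M. ?E (wgrad \<Omega> (\<lambda>x. u x - u' x)) x = ?E (wgrad \<Omega> u) x - ?E (wgrad \<Omega> u') x"
          using AE
        proof eventually_elim
          case (elim x)
          show ?case unfolding elim sum_subtractf[symmetric]
            by (intro sum.cong refl) (simp add: algebra_simps)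
        qed
      qed (use I[OF Wd(3)] I[OF W(3)] I[OF W(6)] in auto)
      also have "\<dots> = (\<integral>x. ?E (wgrad \<Omega> u) x \<partial>?M) - (\<integral>x. ?E (wgrad \<Omega> u') x \<partial>?M)"
        by (rule Bochner_Integration.integral_diff[OF I[OF W(3)] I[OF W(6)]])
      finally show ?thesis by (simp add: stokes_a_def right_diff_distrib)
    qed
    moreover have "stokes_b \<Omega> (\<lambda>x. \<pi> x - \<pi>' x) v = stokes_b \<Omega> \<pi> v - stokes_b \<Omega> \<pi>' v"
      using stokes_b_integrable[OF p \<pi>L(1) V(3)] stokes_b_integrable[OF p \<pi>L(2) V(3)]
      by (simp add: stokes_b_def left_diff_distrib)
    moreover have "stokes_a \<nu> \<Omega> u v + stokes_b \<Omega> \<pi> v = f v" "stokes_a \<nu> \<Omega> u' v + stokes_b \<Omega> \<pi>' v = f' v"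
      using 1 2 v by (auto simp: weak_stokes_solution_def)
    ultimately show "stokes_a \<nu> \<Omega> (\<lambda>x. u x - u' x) v + stokes_b \<Omega> (\<lambda>x. \<pi> x - \<pi>' x) v = f v - f' v"
      by simp
  next
    fix q assume q: "q \<in> L0space (conj_exponent p) \<Omega>"
    then have qL: "q \<in> Lspace (conj_exponent p) ?M" by (simp add: L0space_def)
    let ?B = "\<lambda>U x. q x * (\<Sum>i\<in>UNIV. U x $ i $ i)"
    note I = stokes_b_integrable'[OF p qL]
    have "(\<integral>x. ?B (wgrad \<Omega> (\<lambda>x. u x - u' x)) x \<partial>?M) = (\<integral>x. ?B (wgrad \<Omega> u) x - ?B (wgrad \<Omega> u') x \<partial>?M)"
    proof (rule integral_cong_AE)
      show "AE x in ?M. ?B (wgrad \<Omega> (\<lambda>x. u x - u' x)) x = ?B (wgrad \<Omega> u) x - ?B (wgrad \<Omega> u') x"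
        using AE by eventually_elim (simp add: sum_subtractf right_diff_distrib)
    qed (use I[OF Wd(3)] I[OF W(3)] I[OF W(6)] in auto)
    also have "\<dots> = (\<integral>x. ?B (wgrad \<Omega> u) x \<partial>?M) - (\<integral>x. ?B (wgrad \<Omega> u') x \<partial>?M)"
      by (rule Bochner_Integration.integral_diff[OF I[OF W(3)] I[OF W(6)]])
    finally have "stokes_b \<Omega> q (\<lambda>x. u x - u' x) = stokes_b \<Omega> q u - stokes_b \<Omega> q u'"
      by (simp add: stokes_b_def)
    then show "stokes_b \<Omega> q (\<lambda>x. u x - u' x) = 0"
      using 1 2 q by (simp add: weak_stokes_solution_def)
  qed
qed

section \<open>The two force functionals\<close>

lemma continuous_AE_eq_imp_eq:
  fixes f g :: "'a::euclidean_space \<Rightarrow> 'b::euclidean_space"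
  assumes \<Omega>: "open \<Omega>" and "continuous_on \<Omega> f" "continuous_on \<Omega> g"
    and AE: "AE x in lebesgue_on \<Omega>. f x = g x" and x: "x \<in> \<Omega>"
  shows "f x = g x"
proof -
  have "closedin (top_of_set \<Omega>) {x \<in> \<Omega>. f x - g x = 0}"
    using assms by (intro continuous_closedin_preimage_constant continuous_intros)
  then obtain C where C: "closed C" "{x \<in> \<Omega>. f x - g x = 0} = \<Omega> \<inter> C" by (auto simp: closedin_closed)
  have "\<Omega> \<in> sets lebesgue" using \<Omega> by (simp add: sets_completionI_sets)
  then have "AE x in lebesgue. x \<in> \<Omega> \<longrightarrow> f x = g x" using AE by (simp add: AE_restrict_space_iff)
  then have "AE x\<in>\<Omega> in lebesgue. x \<in> C" by eventually_elim (use C(2) in auto)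
  from mem_closed_if_AE_lebesgue_open[OF \<Omega> C(1) this x] show ?thesis using C(2) x by auto
qed

text \<open>Two continuous functions that agree almost everywhere on an open set agree on it, so the choice
  made by \<open>cont_rep\<close> is harmless.\<close>

lemma cont_rep_eq:
  fixes \<phi> \<psi> :: "real ^ 'n \<Rightarrow> real ^ 'n"
  assumes \<Omega>: "open \<Omega>" and \<psi>: "continuous_on \<Omega> \<psi>" "AE x in lebesgue_on \<Omega>. \<psi> x = \<phi> x" and x: "x \<in> \<Omega>"
  shows "cont_rep \<Omega> \<phi> x = \<psi> x"
proof -
  have *: "continuous_on \<Omega> (cont_rep \<Omega> \<phi>) \<and> (AE x in lebesgue_on \<Omega>. cont_rep \<Omega> \<phi> x = \<phi> x)"
    unfolding cont_rep_def by (rule someI[where x=\<psi>]) (use \<psi> in simp)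
  then have "AE x in lebesgue_on \<Omega>. cont_rep \<Omega> \<phi> x = \<psi> x"
  proof (elim conjE)
    assume "AE x in lebesgue_on \<Omega>. cont_rep \<Omega> \<phi> x = \<phi> x"
    then show ?thesis using \<psi>(2) by eventually_elim simp
  qed
  then show ?thesis using * \<psi>(1) continuous_AE_eq_imp_eq[OF \<Omega> _ _ _ x] by blast
qed

text \<open>Fubini's theorem for \<open>\<delta> (z - X \<theta>) * (F \<theta> \<bullet> v z)\<close>, dominated by a multiple of
  \<open>norm (v z) * norm (F \<theta>)\<close>.\<close>

lemma volume_functional_regularized_force:
  fixes \<Omega> :: "(real ^ 'n) set" and \<Theta> :: "(real ^ 'm) set"
    and X F :: "real ^ 'm \<Rightarrow> real ^ 'n" and \<delta> :: "real ^ 'n \<Rightarrow> real" and v :: "real ^ 'n \<Rightarrow> real ^ 'n"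
  assumes fin: "finite_measure (lebesgue_on \<Omega>)" "finite_measure (lebesgue_on \<Theta>)"
    and Xm: "X \<in> borel_measurable (lebesgue_on \<Theta>)" and idm: "(\<lambda>x. x) \<in> borel_measurable (lebesgue_on \<Omega>)"
    and \<delta>m: "\<delta> \<in> borel_measurable borel" and M: "\<And>y. norm (\<delta> y) \<le> M"
    and F: "integrable (lebesgue_on \<Theta>) F" and v: "integrable (lebesgue_on \<Omega>) v"
  shows "integrable (lebesgue_on \<Omega>) (\<lambda>x. regularized_force \<Theta> X F \<delta> x \<bullet> v x)"
    and "integrable (lebesgue_on \<Theta>) (\<lambda>\<theta>. F \<theta> \<bullet> (domain_average \<Omega> \<delta> v (X \<theta>)))"
    and "volume_functional \<Omega> (regularized_force \<Theta> X F \<delta>) v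
      = (\<integral>\<theta>. F \<theta> \<bullet> (domain_average \<Omega> \<delta> v (X \<theta>)) \<partial>lebesgue_on \<Theta>)"
proof -
  let ?O = "lebesgue_on \<Omega>" and ?T = "lebesgue_on \<Theta>"
  interpret O: finite_measure ?O by fact
  interpret T: finite_measure ?T by fact
  interpret P: pair_sigma_finite ?O ?T ..
  note [measurable] = Xm idm \<delta>m
  have [measurable]: "F \<in> borel_measurable ?T" "v \<in> borel_measurable ?O" using F v by auto
  have vF: "integrable (?O \<Otimes>\<^sub>M ?T) (\<lambda>(z, \<theta>). norm (v z) * norm (F \<theta>))"
  proof (rule P.Fubini_integrable)
    show "(\<lambda>(z, \<theta>). norm (v z) * norm (F \<theta>)) \<in> borel_measurable (?O \<Otimes>\<^sub>M ?T)" by measurable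
    show "integrable ?O (\<lambda>z. \<integral>\<theta>. norm (case (z, \<theta>) of (z, \<theta>) \<Rightarrow> norm (v z) * norm (F \<theta>)) \<partial>?T)"
      using v F by (simp add: abs_mult)
    show "AE z in ?O. integrable ?T (\<lambda>\<theta>. case (z, \<theta>) of (z, \<theta>) \<Rightarrow> norm (v z) * norm (F \<theta>))"
      using F by simp
  qed
  define h where "h = (\<lambda>z \<theta>. \<delta> (z - X \<theta>) * (F \<theta> \<bullet> v z))"
  have hm: "(\<lambda>(z, \<theta>). h z \<theta>) \<in> borel_measurable (?O \<Otimes>\<^sub>M ?T)"
    unfolding h_def by measurable
  have h: "integrable (?O \<Otimes>\<^sub>M ?T) (\<lambda>(z, \<theta>). h z \<theta>)"
  proof (rule Bochner_Integration.integrable_bound[OF integrable_mult_right[OF vF, of M] hm])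
    show "AE x in ?O \<Otimes>\<^sub>M ?T. norm (case x of (z, \<theta>) \<Rightarrow> h z \<theta>)
        \<le> norm (M * (case x of (z, \<theta>) \<Rightarrow> norm (v z) * norm (F \<theta>)))"
    proof (intro AE_I2)
      fix x :: "(real ^ 'n) \<times> (real ^ 'm)"
      obtain z :: "real ^ 'n" and \<theta> where x: "x = (z, \<theta>)" by (cases x)
      have "\<bar>\<delta> (z - X \<theta>)\<bar> * \<bar>F \<theta> \<bullet> v z\<bar> \<le> \<bar>M\<bar> * (norm (F \<theta>) * norm (v z))"
        using M[of "z - X \<theta>"] by (intro mult_mono Cauchy_Schwarz_ineq2) auto
      then show "norm (case x of (z, \<theta>) \<Rightarrow> h z \<theta>) \<le> norm (M * (case x of (z, \<theta>) \<Rightarrow> norm (v z) * norm (F \<theta>)))"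
        by (simp add: x h_def abs_mult mult_ac)
    qed
  qed
  have \<delta>F: "integrable ?T (\<lambda>\<theta>. \<delta> (z - X \<theta>) *\<^sub>R F \<theta>)" for z
  proof (rule Bochner_Integration.integrable_bound[of _ "\<lambda>\<theta>. M *\<^sub>R F \<theta>"])
    show "AE \<theta> in ?T. norm (\<delta> (z - X \<theta>) *\<^sub>R F \<theta>) \<le> norm (M *\<^sub>R F \<theta>)"
    proof (intro AE_I2)
      fix \<theta>
      have "\<bar>\<delta> (z - X \<theta>)\<bar> \<le> \<bar>M\<bar>" using M[of "z - X \<theta>"] by simp
      then show "norm (\<delta> (z - X \<theta>) *\<^sub>R F \<theta>) \<le> norm (M *\<^sub>R F \<theta>)"
        by (simp add: mult_right_mono)
    qed
  qed (use F in auto)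
  have \<delta>v: "integrable ?O (\<lambda>z. \<delta> (z - X \<theta>) *\<^sub>R v z)" for \<theta>
  proof (rule Bochner_Integration.integrable_bound[of _ "\<lambda>z. M *\<^sub>R v z"])
    show "AE z in ?O. norm (\<delta> (z - X \<theta>) *\<^sub>R v z) \<le> norm (M *\<^sub>R v z)"
    proof (intro AE_I2)
      fix z
      have "\<bar>\<delta> (z - X \<theta>)\<bar> \<le> \<bar>M\<bar>" using M[of "z - X \<theta>"] by simp
      then show "norm (\<delta> (z - X \<theta>) *\<^sub>R v z) \<le> norm (M *\<^sub>R v z)"
        by (simp add: mult_right_mono)
    qed
  qed (use v in auto)
  have 1: "(\<integral>\<theta>. h z \<theta> \<partial>?T) = regularized_force \<Theta> X F \<delta> z \<bullet> v z" for z
    unfolding regularized_force_def h_def using integral_inner_left[OF \<delta>F, of z "v z"] by simp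
  have 2: "(\<integral>z. h z \<theta> \<partial>?O) = F \<theta> \<bullet> (domain_average \<Omega> \<delta> v (X \<theta>))" for \<theta>
    unfolding h_def using integral_inner_right[OF \<delta>v, of "F \<theta>" \<theta>] by simp
  show "integrable ?O (\<lambda>x. regularized_force \<Theta> X F \<delta> x \<bullet> v x)"
    using P.integrable_fst'[OF h] by (simp add: 1)
  show "integrable ?T (\<lambda>\<theta>. F \<theta> \<bullet> (domain_average \<Omega> \<delta> v (X \<theta>)))"
    using P.integrable_snd[OF h] by (simp add: 2)
  show "volume_functional \<Omega> (regularized_force \<Theta> X F \<delta>) v
      = (\<integral>\<theta>. F \<theta> \<bullet> (domain_average \<Omega> \<delta> v (X \<theta>)) \<partial>?T)"
    unfolding volume_functional_def using P.Fubini_integral[OF h] by (simp add: 1 2)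
qed

abbreviation force_error where
  "force_error \<Omega> \<Theta> X F \<delta> \<phi> \<equiv>
     immersed_force \<Omega> \<Theta> X F \<phi> - volume_functional \<Omega> (regularized_force \<Theta> X F \<delta>) \<phi>"

text \<open>Both functionals integrate \<open>F\<close> over \<open>\<Theta>\<close>, the first against \<open>\<psi> (X \<theta>)\<close> and the second against an
  average of \<open>\<psi>\<close> around \<open>X \<theta>\<close>. The difference of the two values is bounded uniformly in \<open>\<theta>\<close>.\<close>

lemma immersed_force_error_Wdual:
  fixes \<Omega> :: "(real ^ 'n) set" and \<Theta> :: "(real ^ 'm) set" and X :: "real ^ 'm \<Rightarrow> real ^ 'n"
  assumes \<Omega>: "open \<Omega>" "bounded \<Omega>" and \<Theta>: "bounded \<Theta>" "\<Theta> \<in> sets lebesgue"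
    and X: "continuous_on \<Theta> X" "X ` \<Theta> \<subseteq> \<Omega>"
    and p: "1 \<le> p" and a: "real CARD('n) * (1 - 1 / p) < 1"
  shows "\<exists>C>0. \<forall>F\<in>Lspace (ennreal p) (lebesgue_on \<Theta>). \<forall>\<delta>\<in>Cc.
      force_error \<Omega> \<Theta> X F \<delta> \<in> Wdual p \<Omega> \<and>
      Wdual_norm p \<Omega> (force_error \<Omega> \<Theta> X F \<delta>) \<le> C * Lnorm (ennreal p) (lebesgue_on \<Theta>) F *
        (\<bar>1 - (\<integral>y. \<delta> y \<partial>lebesgue)\<bar> + moment_norm p lebesgue \<delta>)"
proof -
  let ?O = "lebesgue_on \<Omega>" and ?T = "lebesgue_on \<Theta>"
  let ?W = "W10 (conj_exponent p) \<Omega> :: (real ^ 'n \<Rightarrow> real ^ 'n) set"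
  let ?N = "W1_norm (conj_exponent p) \<Omega> :: (real ^ 'n \<Rightarrow> real ^ 'n) \<Rightarrow> real"
  have O: "\<Omega> \<in> sets lebesgue" using \<Omega>(1) by (simp add: sets_completionI_sets)
  have finO: "finite_measure ?O" by (rule finite_measure_lebesgue_on_bounded[OF \<Omega>(2) O])
  have finT: "finite_measure ?T" by (rule finite_measure_lebesgue_on_bounded[OF \<Theta>])
  have Xm: "X \<in> borel_measurable ?T" by (rule continuous_imp_measurable_on_sets_lebesgue[OF X(1) \<Theta>(2)])
  have idm: "(\<lambda>x. x) \<in> borel_measurable ?O"
    by (rule continuous_imp_measurable_on_sets_lebesgue[OF _ O]) (intro continuous_intros)
  obtain C where C: "0 < C"
    and rep: "\<And>v :: real ^ 'n \<Rightarrow> real ^ 'n. v \<in> ?W \<Longrightarrow> \<exists>\<psi>. pointwise_representative p \<Omega> C v \<psi>"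
    using W10_continuous_representative[OF \<Omega>(1) p a, where 'b="real ^ 'n"] by blast
  define \<kappa> where "\<kappa> = Lnorm (conj_exponent p) ?T (\<lambda>_. 1 :: real)"
  have \<kappa>: "0 \<le> \<kappa>" unfolding \<kappa>_def by (rule Lnorm_nonneg)
  have main: "force_error \<Omega> \<Theta> X F \<delta> \<in> Wdual p \<Omega> \<and>
      Wdual_norm p \<Omega> (force_error \<Omega> \<Theta> X F \<delta>) \<le> C * (\<kappa> + 1) * Lnorm (ennreal p) ?T F *
        (\<bar>1 - (\<integral>y. \<delta> y \<partial>lebesgue)\<bar> + moment_norm p lebesgue \<delta>)"
    if F: "F \<in> Lspace (ennreal p) ?T" and \<delta>: "\<delta> \<in> Cc" for F and \<delta> :: "real ^ 'n \<Rightarrow> real"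
  proof -
    define g where "g = force_error \<Omega> \<Theta> X F \<delta>"
    define R where "R = \<bar>1 - (\<integral>y. \<delta> y \<partial>lebesgue)\<bar> + moment_norm p lebesgue \<delta>"
    have R: "0 \<le> R" by (simp add: R_def Lnorm_nonneg)
    obtain M where M: "\<And>y. norm (\<delta> y) \<le> M" using Cc_bounded[OF \<delta>] by blast
    have F_int: "integrable ?T F"
      and F_norm: "(\<integral>\<theta>. norm (F \<theta>) \<partial>?T) \<le> \<kappa> * Lnorm (ennreal p) ?T F"
      unfolding \<kappa>_def by (rule Lspace_imp_integrable[OF finT p F])+
    note vol = volume_functional_regularized_force
      [OF finO finT Xm idm Cc_measurable[OF \<delta>] M F_int W10_integrable[OF \<Omega>(1)]]
    have imm_eq: "immersed_force \<Omega> \<Theta> X F v = (\<integral>\<theta>. F \<theta> \<bullet> \<psi> (X \<theta>) \<partial>?T)"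
      if "continuous_on UNIV \<psi>" "AE x in ?O. \<psi> x = v x" for \<psi> v
      unfolding immersed_force_def
    proof (rule Bochner_Integration.integral_cong[OF refl])
      fix \<theta> assume "\<theta> \<in> space ?T"
      then have "X \<theta> \<in> \<Omega>" using X(2) by auto
      then show "F \<theta> \<bullet> cont_rep \<Omega> v (X \<theta>) = F \<theta> \<bullet> \<psi> (X \<theta>)"
        using cont_rep_eq[OF \<Omega>(1) continuous_on_subset[OF that(1)] that(2)] by simp
    qed
    have imm_int: "integrable ?T (\<lambda>\<theta>. F \<theta> \<bullet> \<psi> (X \<theta>))"
      if \<psi>: "continuous_on UNIV \<psi>" "\<And>x. norm (\<psi> x) \<le> B" for \<psi> :: "real ^ 'n \<Rightarrow> real ^ 'n" and B
    proof (rule Bochner_Integration.integrable_bound[of _ "\<lambda>\<theta>. norm (F \<theta>) * B"])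
      have "\<psi> \<in> borel_measurable borel" using \<psi>(1) by (rule borel_measurable_continuous_onI)
      from measurable_compose[OF Xm this]
      show "(\<lambda>\<theta>. F \<theta> \<bullet> \<psi> (X \<theta>)) \<in> borel_measurable ?T"
        using F_int by (intro borel_measurable_inner) auto
      show "AE \<theta> in ?T. norm (F \<theta> \<bullet> \<psi> (X \<theta>)) \<le> norm (norm (F \<theta>) * B)"
      proof (intro AE_I2)
        fix \<theta>
        have "\<bar>F \<theta> \<bullet> \<psi> (X \<theta>)\<bar> \<le> norm (F \<theta>) * norm (\<psi> (X \<theta>))" by (rule Cauchy_Schwarz_ineq2)
        also have "\<dots> \<le> norm (F \<theta>) * B" by (intro mult_left_mono \<psi>(2)) auto
        finally show "norm (F \<theta> \<bullet> \<psi> (X \<theta>)) \<le> norm (norm (F \<theta>) * B)" by simp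
      qed
    qed (use F_int in auto)
    have add: "g (\<lambda>x. v x + w x) = g v + g w" if v: "v \<in> ?W" and w: "w \<in> ?W" for v w
    proof -
      obtain \<psi> where \<psi>: "continuous_on UNIV \<psi>" "AE x in ?O. \<psi> x = v x" "\<And>x. norm (\<psi> x) \<le> C * ?N v"
        using rep[OF v] unfolding pointwise_representative_def by blast
      obtain \<zeta> where \<zeta>: "continuous_on UNIV \<zeta>" "AE x in ?O. \<zeta> x = w x" "\<And>x. norm (\<zeta> x) \<le> C * ?N w"
        using rep[OF w] unfolding pointwise_representative_def by blast
      have "continuous_on UNIV (\<lambda>x. \<psi> x + \<zeta> x)" by (intro continuous_intros \<psi> \<zeta>)
      moreover have "AE x in ?O. \<psi> x + \<zeta> x = v x + w x"
        using \<psi>(2) \<zeta>(2) by eventually_elim simp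
      ultimately have "immersed_force \<Omega> \<Theta> X F (\<lambda>x. v x + w x) = (\<integral>\<theta>. F \<theta> \<bullet> (\<psi> (X \<theta>) + \<zeta> (X \<theta>)) \<partial>?T)"
        by (rule imm_eq)
      also have "\<dots> = immersed_force \<Omega> \<Theta> X F v + immersed_force \<Omega> \<Theta> X F w"
        using imm_int[OF \<psi>(1,3)] imm_int[OF \<zeta>(1,3)]
        by (simp add: inner_add_right imm_eq[OF \<psi>(1,2)] imm_eq[OF \<zeta>(1,2)])
      finally show ?thesis
        using vol(1)[OF v] vol(1)[OF w] by (simp add: g_def volume_functional_def inner_add_right)
    qed
    have scale: "g (\<lambda>x. c *\<^sub>R v x) = c * g v" if v: "v \<in> ?W" for c v
    proof -
      obtain \<psi> where \<psi>: "continuous_on UNIV \<psi>" "AE x in ?O. \<psi> x = v x" "\<And>x. norm (\<psi> x) \<le> C * ?N v"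
        using rep[OF v] unfolding pointwise_representative_def by blast
      have "continuous_on UNIV (\<lambda>x. c *\<^sub>R \<psi> x)" by (intro continuous_intros \<psi>)
      moreover have "AE x in ?O. c *\<^sub>R \<psi> x = c *\<^sub>R v x"
        using \<psi>(2) by eventually_elim simp
      ultimately have "immersed_force \<Omega> \<Theta> X F (\<lambda>x. c *\<^sub>R v x) = (\<integral>\<theta>. F \<theta> \<bullet> (c *\<^sub>R \<psi> (X \<theta>)) \<partial>?T)"
        by (rule imm_eq)
      then show ?thesis
        by (simp add: g_def volume_functional_def imm_eq[OF \<psi>(1,2)] right_diff_distrib)
    qed
    define B where "B = C * (\<kappa> + 1) * Lnorm (ennreal p) ?T F * R"
    have B0: "0 \<le> B" unfolding B_def using C \<kappa> R by (intro mult_nonneg_nonneg Lnorm_nonneg) auto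
    have bound: "\<bar>g v\<bar> \<le> B * ?N v" if v: "v \<in> ?W" for v
    proof -
      obtain \<psi> where \<psi>: "continuous_on UNIV \<psi>" "AE x in ?O. \<psi> x = v x" "\<And>x. norm (\<psi> x) \<le> C * ?N v"
        and est: "\<And>x. norm ((\<integral>y. \<delta> y \<partial>lebesgue) *\<^sub>R \<psi> x - (domain_average \<Omega> \<delta> v x))
            \<le> C * moment_norm p lebesgue \<delta> * ?N v"
        using rep[OF v] \<delta> unfolding pointwise_representative_def by blast
      define A where "A = domain_average \<Omega> \<delta> v"
      have N: "0 \<le> ?N v" by (simp add: W1_norm_def Lnorm_nonneg)
      have diff: "norm (\<psi> x - A x) \<le> C * R * ?N v" for x
      proof -
        have "\<psi> x - A x = (1 - (\<integral>y. \<delta> y \<partial>lebesgue)) *\<^sub>R \<psi> x + ((\<integral>y. \<delta> y \<partial>lebesgue) *\<^sub>R \<psi> x - A x)"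
          by (simp add: scaleR_diff_left)
        then have "norm (\<psi> x - A x) \<le> \<bar>1 - (\<integral>y. \<delta> y \<partial>lebesgue)\<bar> * norm (\<psi> x)
            + norm ((\<integral>y. \<delta> y \<partial>lebesgue) *\<^sub>R \<psi> x - A x)"
          by (metis norm_scaleR norm_triangle_ineq)
        also have "\<dots> \<le> \<bar>1 - (\<integral>y. \<delta> y \<partial>lebesgue)\<bar> * (C * ?N v)
            + C * moment_norm p lebesgue \<delta> * ?N v"
          using est[of x] unfolding A_def by (intro add_mono mult_left_mono \<psi>(3)) auto
        finally show ?thesis by (simp add: R_def algebra_simps)
      qed
      note int = imm_int[OF \<psi>(1,3)] vol(2)[OF v]
      have int': "integrable ?T (\<lambda>\<theta>. F \<theta> \<bullet> (\<psi> (X \<theta>) - A (X \<theta>)))"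
        unfolding inner_diff_right A_def by (intro Bochner_Integration.integrable_diff int)
      have "g v = (\<integral>\<theta>. F \<theta> \<bullet> (\<psi> (X \<theta>) - A (X \<theta>)) \<partial>?T)"
        unfolding g_def imm_eq[OF \<psi>(1,2)] vol(3)[OF v] inner_diff_right A_def
        by (rule Bochner_Integration.integral_diff[OF int, symmetric])
      then have "\<bar>g v\<bar> \<le> (\<integral>\<theta>. norm (F \<theta> \<bullet> (\<psi> (X \<theta>) - A (X \<theta>))) \<partial>?T)"
        using integral_norm_bound[of "?T" "\<lambda>\<theta>. F \<theta> \<bullet> (\<psi> (X \<theta>) - A (X \<theta>))"] by simp
      also have "\<dots> \<le> (\<integral>\<theta>. norm (F \<theta>) * (C * R * ?N v) \<partial>?T)"
      proof (rule integral_mono)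
        fix \<theta>
        show "norm (F \<theta> \<bullet> (\<psi> (X \<theta>) - A (X \<theta>))) \<le> norm (F \<theta>) * (C * R * ?N v)"
          using Cauchy_Schwarz_ineq2[of "F \<theta>" "\<psi> (X \<theta>) - A (X \<theta>)"] mult_left_mono[OF diff[of "X \<theta>"] norm_ge_zero[of "F \<theta>"]]
          by simp
      qed (use int' F_int in auto)
      also have "\<dots> = (\<integral>\<theta>. norm (F \<theta>) \<partial>?T) * (C * R * ?N v)" by simp
      also have "\<dots> \<le> (\<kappa> * Lnorm (ennreal p) ?T F) * (C * R * ?N v)"
        using F_norm C R N by (intro mult_right_mono) auto
      also have "\<dots> \<le> ((\<kappa> + 1) * Lnorm (ennreal p) ?T F) * (C * R * ?N v)"
        using C R N by (intro mult_right_mono) (auto simp: Lnorm_nonneg)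
      also have "\<dots> = B * ?N v" by (simp add: B_def mult_ac)
      finally show ?thesis .
    qed
    have "g \<in> Wdual p \<Omega>"
      unfolding Wdual_def using add scale bound by blast
    moreover have "Wdual_norm p \<Omega> g \<le> B"
      unfolding Wdual_norm_def
    proof (rule cSup_least)
      show "{\<bar>g v\<bar> |v. v \<in> ?W \<and> ?N v \<le> 1} \<noteq> {}"
        using zero_in_W10[OF \<Omega>(1) exponent_conj_exponent[OF p], where 'b="real ^ 'n"] by fastforce
      fix y assume "y \<in> {\<bar>g v\<bar> |v. v \<in> ?W \<and> ?N v \<le> 1}"
      then obtain v where v: "y = \<bar>g v\<bar>" "v \<in> ?W" "?N v \<le> 1" by blast
      have "\<bar>g v\<bar> \<le> B * ?N v" by (rule bound[OF v(2)])
      also have "\<dots> \<le> B * 1" by (intro mult_left_mono v(3) B0)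
      finally show "y \<le> B" using v(1) by simp
    qed
    ultimately show ?thesis by (simp add: g_def B_def R_def)
  qed
  \<comment> \<open>The factor \<open>\<kappa> + 1\<close> instead of \<open>\<kappa>\<close> keeps the constant positive for a null set \<open>\<Theta>\<close>.\<close>
  have "0 < C * (\<kappa> + 1)" using C \<kappa> by simp
  then show ?thesis using main by blast
qed

section \<open>The error of the regularised Stokes problem\<close>

theorem proposition8:
  fixes \<Omega> \<Omega>0 \<Omega>1 \<Gamma> :: "(real ^ 'n) set"
    and \<Theta> :: "(real ^ 'm) set"
    and X :: "real ^ 'm \<Rightarrow> real ^ 'n"
    and DX :: "real ^ 'm \<Rightarrow> real ^ 'm ^ 'n"
    and p :: real
  assumes "CARD('n) = 2 \<or> CARD('n) = 3"
    and "CARD('n) = CARD('m) + 1"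
    and "polyhedral_domain \<Omega>"
    and "immersed_boundary \<Omega> \<Omega>0 \<Omega>1 \<Gamma>"
    and "bounded \<Theta>" and "\<Theta> \<in> sets lebesgue"
    and "\<Gamma> = X ` \<Theta>"
    and "C1_parametrization \<Theta> X DX"
    and "\<forall>\<theta>\<in>\<Theta>. surface_jacobian (DX \<theta>) \<noteq> 0"
    and "1 \<le> p" and "p < real CARD('n) / (real CARD('n) - 1)"
  shows "\<exists>C0 > 0. \<forall>\<nu> > 0. \<forall>C1 > 0. \<forall>C2 > 0. stokes_A1 \<nu> p \<Omega> C1 C2 \<longrightarrow>
    (\<forall>(F :: real ^ 'm \<Rightarrow> real ^ 'n) (\<epsilon> :: real) (K :: real) (\<delta> :: real ^ 'n \<Rightarrow> real) u \<pi> u\<epsilon> \<pi>\<epsilon>.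
       F \<in> Lspace (ennreal p) (lebesgue_on \<Theta>) \<longrightarrow> \<epsilon> > 0 \<longrightarrow> K > 0 \<longrightarrow>
       continuous_on UNIV \<delta> \<longrightarrow> closure {x. \<delta> x \<noteq> 0} \<subseteq> ball 0 (K * \<epsilon>) \<longrightarrow>
       weak_stokes_solution \<nu> p \<Omega> (immersed_force \<Omega> \<Theta> X F) u \<pi> \<longrightarrow>
       weak_stokes_solution \<nu> p \<Omega> (volume_functional \<Omega> (regularized_force \<Theta> X F \<delta>)) u\<epsilon> \<pi>\<epsilon> \<longrightarrow>
       W1_norm (ennreal p) \<Omega> (\<lambda>x. u x - u\<epsilon> x)
         + Lnorm (ennreal p) (lebesgue_on \<Omega>) (\<lambda>x. \<pi> x - \<pi>\<epsilon> x)
       \<le> C0 * C1 * Lnorm (ennreal p) (lebesgue_on \<Theta>) F *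
           (\<bar>1 - (\<integral>y. \<delta> y \<partial>lebesgue)\<bar> + Lnorm (ennreal p) lebesgue (\<lambda>y. \<delta> y *\<^sub>R y)))"
proof -
  have \<Omega>: "open \<Omega>" using assms(3) by (simp add: polyhedral_domain_def)
  have bd: "bounded \<Omega>"
  proof -
    from assms(3) obtain \<P> where "finite \<P>" "\<forall>P\<in>\<P>. polytope P" "closure \<Omega> = \<Union>\<P>"
      by (auto simp: polyhedral_domain_def)
    then have "bounded (closure \<Omega>)"
      by (simp add: bounded_Union polytope_imp_bounded)
    then show ?thesis using bounded_subset closure_subset by blast
  qed
  have X: "continuous_on \<Theta> X"
    using assms(8) unfolding C1_parametrization_def
    by (auto simp: continuous_on_eq_continuous_within intro: has_derivative_continuous)
  have X\<Omega>: "X ` \<Theta> \<subseteq> \<Omega>" using assms(4,7) by (simp add: immersed_boundary_def)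
  note p = assms(10)
  have a: "real CARD('n) * (1 - 1 / p) < 1"
  proof -
    have n: "1 < real CARD('n)" using assms(1) by auto
    then have "p * (real CARD('n) - 1) < real CARD('n)" using assms(11) by (simp add: pos_less_divide_eq)
    then show ?thesis using p by (simp add: field_simps)
  qed
  have fin: "finite_measure (lebesgue_on \<Omega>)"
    using \<Omega> bd by (intro finite_measure_lebesgue_on_bounded) (auto simp: sets_completionI_sets)
  obtain C where C: "0 < C" and est: "\<And>F \<delta>. F \<in> Lspace (ennreal p) (lebesgue_on \<Theta>) \<Longrightarrow> \<delta> \<in> Cc \<Longrightarrow>
      force_error \<Omega> \<Theta> X F \<delta> \<in> Wdual p \<Omega> \<and>
      Wdual_norm p \<Omega> (force_error \<Omega> \<Theta> X F \<delta>) \<le> C * Lnorm (ennreal p) (lebesgue_on \<Theta>) F *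
        (\<bar>1 - (\<integral>y. \<delta> y \<partial>lebesgue)\<bar> + Lnorm (ennreal p) lebesgue (\<lambda>y. \<delta> y *\<^sub>R y))"
    using immersed_force_error_Wdual[OF \<Omega> bd assms(5,6) X X\<Omega> p a] by blast
  show ?thesis
  proof (intro exI[of _ C] conjI C allI impI)
    fix \<nu> C1 C2 :: real and F :: "real ^ 'm \<Rightarrow> real ^ 'n" and \<epsilon> K :: real and \<delta> :: "real ^ 'n \<Rightarrow> real"
      and u \<pi> u\<epsilon> \<pi>\<epsilon>
    assume "0 < C1" and A1: "stokes_A1 \<nu> p \<Omega> C1 C2" and F: "F \<in> Lspace (ennreal p) (lebesgue_on \<Theta>)"
      and \<delta>: "continuous_on UNIV \<delta>" and supp: "closure {x. \<delta> x \<noteq> 0} \<subseteq> ball 0 (K * \<epsilon>)"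
      and u: "weak_stokes_solution \<nu> p \<Omega> (immersed_force \<Omega> \<Theta> X F) u \<pi>"
      and u\<epsilon>: "weak_stokes_solution \<nu> p \<Omega> (volume_functional \<Omega> (regularized_force \<Theta> X F \<delta>)) u\<epsilon> \<pi>\<epsilon>"
    let ?g = "force_error \<Omega> \<Theta> X F \<delta>"
    let ?R = "Lnorm (ennreal p) (lebesgue_on \<Theta>) F *
           (\<bar>1 - (\<integral>y. \<delta> y \<partial>lebesgue)\<bar> + Lnorm (ennreal p) lebesgue (\<lambda>y. \<delta> y *\<^sub>R y))"
    have Cc: "\<delta> \<in> Cc"
      by (rule CcI[OF \<delta> compact_cball[of 0 "K * \<epsilon>"]])
        (use supp closure_subset[of "{x. \<delta> x \<noteq> 0}"] in fastforce)
    have g: "?g \<in> Wdual p \<Omega>" and gn: "Wdual_norm p \<Omega> ?g \<le> C * ?R"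
      using est[OF F Cc] by (auto simp: mult.assoc)
    obtain w r where w: "weak_stokes_solution \<nu> p \<Omega> ?g w r"
      and uniq: "\<And>w' r'. weak_stokes_solution \<nu> p \<Omega> ?g w' r' \<Longrightarrow> AE x in lebesgue_on \<Omega>. w' x = w x \<and> r' x = r x"
      and wn: "W1_norm (ennreal p) \<Omega> w + Lnorm (ennreal p) (lebesgue_on \<Omega>) r \<le> C1 * Wdual_norm p \<Omega> ?g"
      using A1 g unfolding stokes_A1_def by blast
    have d: "weak_stokes_solution \<nu> p \<Omega> ?g (\<lambda>x. u x - u\<epsilon> x) (\<lambda>x. \<pi> x - \<pi>\<epsilon> x)"
      by (rule weak_stokes_solution_diff[OF \<Omega> fin p u u\<epsilon>])
    have AE: "AE x in lebesgue_on \<Omega>. u x - u\<epsilon> x = w x" "AE x in lebesgue_on \<Omega>. \<pi> x - \<pi>\<epsilon> x = r x"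
      using uniq[OF d] by (auto elim: eventually_mono)
    note sp = exponent_ennreal[OF p]
    have meas: "w' \<in> borel_measurable (lebesgue_on \<Omega>)" "r' \<in> borel_measurable (lebesgue_on \<Omega>)"
      "wgrad \<Omega> w' \<in> borel_measurable (lebesgue_on \<Omega>)" if "weak_stokes_solution \<nu> p \<Omega> ?g w' r'" for w' r'
    proof -
      have "w' \<in> W1 (ennreal p) \<Omega>" "r' \<in> Lspace (ennreal p) (lebesgue_on \<Omega>)"
        using that by (auto simp: weak_stokes_solution_def W10_def L0space_def)
      then show "w' \<in> borel_measurable (lebesgue_on \<Omega>)" "r' \<in> borel_measurable (lebesgue_on \<Omega>)"
        "wgrad \<Omega> w' \<in> borel_measurable (lebesgue_on \<Omega>)"
        using W1D[OF \<Omega> sp, of w'] by (auto dest: Lspace_measurable)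
    qed
    have "wgrad \<Omega> (\<lambda>x. u x - u\<epsilon> x) = wgrad \<Omega> w"
      by (rule wgrad_cong_AE[OF \<Omega> AE(1) meas(1)[OF d] meas(1)[OF w]])
    moreover have "Lnorm (ennreal p) (lebesgue_on \<Omega>) (\<lambda>x. u x - u\<epsilon> x) = Lnorm (ennreal p) (lebesgue_on \<Omega>) w"
      using AE(1) by (intro Lnorm_AE_cong meas(1)[OF d] meas(1)[OF w]) (auto elim: eventually_mono)
    ultimately have "W1_norm (ennreal p) \<Omega> (\<lambda>x. u x - u\<epsilon> x) = W1_norm (ennreal p) \<Omega> w"
      by (simp add: W1_norm_def)
    moreover have "Lnorm (ennreal p) (lebesgue_on \<Omega>) (\<lambda>x. \<pi> x - \<pi>\<epsilon> x) = Lnorm (ennreal p) (lebesgue_on \<Omega>) r"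
      using AE(2) by (intro Lnorm_AE_cong meas(2)[OF d] meas(2)[OF w]) (auto elim: eventually_mono)
    moreover have "C1 * Wdual_norm p \<Omega> ?g \<le> C1 * (C * ?R)"
      using \<open>0 < C1\<close> by (intro mult_left_mono gn) auto
    ultimately show "W1_norm (ennreal p) \<Omega> (\<lambda>x. u x - u\<epsilon> x)
         + Lnorm (ennreal p) (lebesgue_on \<Omega>) (\<lambda>x. \<pi> x - \<pi>\<epsilon> x)
       \<le> C * C1 * Lnorm (ennreal p) (lebesgue_on \<Theta>) F *
           (\<bar>1 - (\<integral>y. \<delta> y \<partial>lebesgue)\<bar> + Lnorm (ennreal p) lebesgue (\<lambda>y. \<delta> y *\<^sub>R y))"
      using wn by (simp add: mult_ac)
  qed
qed

end
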